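(* Let $D$ be a blockwise category of interval partitions. Then for any $n,k\in\mathbb N$, $$\mathrm{Fix}(\Lambda_n^k)=\mathrm{Span}\{T^{(n)}_\pi:\pi\in D(k)\}.$$ Moreover, for any $n\in\mathbb N$ there exists a unique unital Haar functional $h_D$ on $\mathcal A_p[D;n]$, and it satisfies (1) $h_D(p)=1$; (2) $h_D(p\,u_{i_1j_1}\cdots u_{i_kj_k}\,p)=H^{D(k)}_{\mathbf i\mathbf j}$ for all $\mathbf i,\mathbf j\in[n]^k$ and $k\in\mathbb N$; (3) $h_D(a_1\cdots a_l)=h_D(a_1)\cdots h_D(a_l)$ for all $l\in\mathbb N$ and $a_1,\dots,a_l\in V_n^D$.
   Context: Partitions. $\mathbb N=\{1,2,\dots\}$, $[n]=\{1,\dots,n\}$. $I(k)$ is the set of partitions of $[k]$ all of whose blocks consist of consecutive elements; $\pi\le\sigma$ means each block of $\pi$ lies in a block of $\sigma$; $\otimes$ of partitions is horizontal concatenation; $\mathbf 1_k$ is the one-block partition of $[k]$; for $\mathbf j\in[n]^k$, $\ker\mathbf j$ is the partition of $[k]$ with $r\sim s$ iff $j_r=j_s$. A category of interval partitions is a family $D=(D(k))_{k\in\mathbb N}$, $D(k)\subset I(k)$, stable under $\otimes$ and containing $\sqcap=\mathbf 1_2$. $L_D:=\{k:\mathbf 1_k\in D(k)\}$. $D$ is blockwise if: (D1) for every $\pi\in D(k)$ and every block $V$ of $\pi$, $\mathbf 1_{|V|}\in D(|V|)$; (D2) if $\rho,\sigma\in D(k)$, $\pi\in I(k)$ and $\rho\le\pi\le\sigma$,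 then $\pi\in D(k)$; (D3) for $l\in\mathbb N$, if there is $k\in L_D$ with $D(k+l)\ne\emptyset$, then $D(l)\neq\emptyset$. Algebras. $\mathcal A[D;n]$ is the non-unital $*$-algebra generated by self-adjoint $u_{ij}$ ($i,j\in[n]$) and a projection $p$ subject to: for all $k\in L_D$ and $\mathbf i,\mathbf j\in[n]^k$, $\sum_{i=1}^n u_{ij_1}\cdots u_{ij_k}p=p$ if $j_1=\dots=j_k$ and $=0$ otherwise; $\sum_{j=1}^n u_{i_1j}\cdots u_{i_kj}p=p$ if $i_1=\dots=i_k$ and $=0$ otherwise. $\mathcal A_p[D;n]:=p\,\mathcal A[D;n]\,p$ is unital with unit $p$, with coproduct $\Delta$ the restriction of the $*$-homomorphism determined by $\Delta(p)=p\otimes p$, $\Delta(u_{ij})=\sum_{k=1}^nu_{ik}\otimes u_{kj}$. $V_n^D:=\mathrm{Span}(\{p\}\cup\{p\,u_{i_1j_1}\cdots u_{i_kj_k}\,p:\mathbf i,\mathbf j\in[n]^k,k\in\mathbb N\})$. Haar functional. A linear functional $h$ on a unital $*$-algebra $\mathcal A$ with coproduct $\Delta$ is a Haar functional if $(\mathrm{id}\otimes h)\Delta=h(\cdot)1_{\mathcal A}=(h\otimes\mathrm{id})\Delta$. Vectors. $l^2_n$ is the $n$-dimensional Hilbert space with orthonormal basis $(e_i)_{i\in[n]}$, $e_{\mathbf j}=e_{j_1}\otimes\cdots\otimes e_{j_k}\in(l_n^2)^{\otimes k}$, $T^{(n)}_\pi=\sum_{\mathbf j\in[n]^k,\ \pi\le\ker\mathbf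 j}e_{\mathbf j}$. $H^{D(k)}$ is the orthogonal projection of $(l^2_n)^{\otimes k}$ onto $\mathrm{Span}\{T_\pi^{(n)}:\pi\in D(k)\}$ and $H^{D(k)}_{\mathbf i\mathbf j}=\langle e_{\mathbf i},H^{D(k)}e_{\mathbf j}\rangle$. $\Lambda_n^k:(l^2_n)^{\otimes k}\to(l_n^2)^{\otimes k}\otimes V_n^D$ is the linear map $\Lambda^k_n(e_{\mathbf j})=\sum_{\mathbf i\in[n]^k}e_{\mathbf i}\otimes p\,u_{i_1j_1}\cdots u_{i_kj_k}\,p$, and $\mathrm{Fix}(\Lambda_n^k)=\{\xi:\Lambda_n^k(\xi)=\xi\otimes p\}$. *)

theory Defs
  imports
    Complex_Main
    "HOL-Library.Poly_Mapping"
    "HOL-Library.Product_Plus"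
    "HOL-Library.Set_Algebras"
    "HOL-Library.Disjoint_Sets"
    "HOL-Library.FuncSet"
begin

section \<open>Interval partitions\<close>

type_synonym partition = "nat set set"

definition interval_partitions :: "nat \<Rightarrow> partition set" where
  "interval_partitions k = {\<pi>. partition_on {1..k} \<pi> \<and> (\<forall>V\<in>\<pi>. \<exists>a b. V = {a..b})}"

definition one_block :: "nat \<Rightarrow> partition" where
  "one_block k = {{1..k}}"

text \<open>Horizontal concatenation; \<open>k\<close> is the number of points of the left factor.\<close>

definition pconcat :: "nat \<Rightarrow> partition \<Rightarrow> partition \<Rightarrow> partition" where
  "pconcat k \<pi> \<sigma> = \<pi> \<union> (\<lambda>V. (\<lambda>r. k + r) ` V) ` \<sigma>"

text \<open>Families are indexed by \<open>k \<ge> 1\<close>; the value of \<open>D\<close> at \<open>0\<close> is irrelevant.\<close>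

definition interval_category :: "(nat \<Rightarrow> partition set) \<Rightarrow> bool" where
  "interval_category D \<longleftrightarrow>
     (\<forall>k\<ge>1. D k \<subseteq> interval_partitions k) \<and>
     (\<forall>k\<ge>1. \<forall>l\<ge>1. \<forall>\<pi>\<in>D k. \<forall>\<sigma>\<in>D l. pconcat k \<pi> \<sigma> \<in> D (k + l)) \<and>
     one_block 2 \<in> D 2"

definition block_lengths :: "(nat \<Rightarrow> partition set) \<Rightarrow> nat set" where
  "block_lengths D = {k. k \<ge> 1 \<and> one_block k \<in> D k}"

definition blockwise :: "(nat \<Rightarrow> partition set) \<Rightarrow> bool" where
  "blockwise D \<longleftrightarrow> interval_category D \<and>
     (\<forall>k\<ge>1. \<forall>\<pi>\<in>D k. \<forall>V\<in>\<pi>. one_block (card V) \<in> D (card V)) \<and>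
     (\<forall>k\<ge>1. \<forall>\<rho>\<in>D k. \<forall>\<sigma>\<in>D k. \<forall>\<pi>\<in>interval_partitions k.
        refines {1..k} \<rho> \<pi> \<and> refines {1..k} \<pi> \<sigma> \<longrightarrow> \<pi> \<in> D k) \<and>
     (\<forall>l\<ge>1. (\<exists>k\<in>block_lengths D. D (k + l) \<noteq> {}) \<longrightarrow> D l \<noteq> {})"


section \<open>Free complex vector spaces and their tensor products\<close>

text \<open>
  \<open>'a \<Rightarrow>\<^sub>0 complex\<close> is the complex vector space with basis \<open>'a\<close>; for a monoid \<open>'a\<close> its
  multiplication is that of the monoid algebra. Below the monoids are lists under
  concatenation, giving free (tensor) algebras, and pairs of lists, giving their tensor squares.
\<close>

instantiation list :: (type) monoid_add
begin

definition zero_list :: "'a list" where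
  "zero_list = []"

definition plus_list :: "'a list \<Rightarrow> 'a list \<Rightarrow> 'a list" where
  "plus_list xs ys = xs @ ys"

instance
  by standard (simp_all add: zero_list_def plus_list_def)

end

definition scale :: "complex \<Rightarrow> ('a \<Rightarrow>\<^sub>0 complex) \<Rightarrow> ('a \<Rightarrow>\<^sub>0 complex)" where
  "scale c x = Poly_Mapping.map ((*) c) x"

lemma lookup_scale [simp]: "Poly_Mapping.lookup (scale c x) w = c * Poly_Mapping.lookup x w"
  by (simp add: scale_def Poly_Mapping.map.rep_eq when_def)

global_interpretation pm: vector_space "scale :: complex \<Rightarrow> ('a \<Rightarrow>\<^sub>0 complex) \<Rightarrow> ('a \<Rightarrow>\<^sub>0 complex)"
  by standard (auto intro!: poly_mapping_eqI simp: lookup_add algebra_simps)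

definition tens :: "('a \<Rightarrow>\<^sub>0 complex) \<Rightarrow> ('b \<Rightarrow>\<^sub>0 complex) \<Rightarrow> ('a \<times> 'b \<Rightarrow>\<^sub>0 complex)" where
  "tens x y = (\<Sum>v\<in>Poly_Mapping.keys x. \<Sum>w\<in>Poly_Mapping.keys y. Poly_Mapping.single (v, w) (Poly_Mapping.lookup x v * Poly_Mapping.lookup y w))"

text \<open>
  A vector space presented as a quotient \<open>E / M\<close> is represented by the cosets \<open>x +o M\<close>,
  \<open>x \<in> E\<close>. The tensor product of \<open>E / M\<close> and \<open>F / N\<close> is \<open>(E \<otimes> F) / (M \<otimes> F + E \<otimes> N)\<close>,
  and \<open>tensor_null E M F N\<close> is the denominator.
\<close>

definition tensor_null ::
  "('a \<Rightarrow>\<^sub>0 complex) set \<Rightarrow> ('a \<Rightarrow>\<^sub>0 complex) set \<Rightarrow> ('b \<Rightarrow>\<^sub>0 complex) set \<Rightarrow> ('b \<Rightarrow>\<^sub>0 complex) set \<Rightarrow>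
   ('a \<times> 'b \<Rightarrow>\<^sub>0 complex) set" where
  "tensor_null E M F N =
     pm.span ({tens x y | x y. x \<in> M \<and> y \<in> F} \<union> {tens x y | x y. x \<in> E \<and> y \<in> N})"


section \<open>The algebras\<close>

text \<open>
  The index set \<open>[n]\<close> is a finite type \<open>'n\<close> with \<open>n\<close> elements, and multi-indices in \<open>[n]^k\<close> are
  lists of length \<open>k\<close>. All generators are self-adjoint, so the free \<open>*\<close>-algebra on them has as
  basis the words in the generators, with reversal of words as involution. It is non-unital:
  only nonempty words occur in \<open>free_alg\<close>.
\<close>

datatype 'n gen = U 'n 'n | P

type_synonym 'n falg = "'n gen list \<Rightarrow>\<^sub>0 complex"

definition free_alg :: "'n falg set" where
  "free_alg = {x. [] \<notin> Poly_Mapping.keys x}"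

definition star :: "'n falg \<Rightarrow> 'n falg" where
  "star x = (\<Sum>w\<in>Poly_Mapping.keys x. Poly_Mapping.single (rev w) (cnj (Poly_Mapping.lookup x w)))"

definition pgen :: "'n falg" where
  "pgen = Poly_Mapping.single [P] 1"

definition ugen :: "'n \<Rightarrow> 'n \<Rightarrow> 'n falg" where
  "ugen i j = Poly_Mapping.single [U i j] 1"

definition uprod :: "'n list \<Rightarrow> 'n list \<Rightarrow> 'n falg" where
  "uprod i j = prod_list (map2 ugen i j)"

definition relators :: "(nat \<Rightarrow> partition set) \<Rightarrow> 'n::finite falg set" where
  "relators D =
     {pgen * pgen - pgen} \<union>
     {(\<Sum>i\<in>UNIV. uprod (replicate k i) j) * pgen - (if \<exists>a. j = replicate k a then pgen else 0) |
        k j. k \<in> block_lengths D \<and> length j = k} \<union>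
     {(\<Sum>j\<in>UNIV. uprod i (replicate k j)) * pgen - (if \<exists>a. i = replicate k a then pgen else 0) |
        k i. k \<in> block_lengths D \<and> length i = k}"

text \<open>
  The two-sided \<open>*\<close>-ideal of \<open>free_alg\<close> generated by the relators; the multipliers \<open>x\<close>, \<open>y\<close> range
  over the free algebra with unit adjoined, so that the relators themselves are included.
\<close>

definition rel_ideal :: "(nat \<Rightarrow> partition set) \<Rightarrow> 'n::finite falg set" where
  "rel_ideal D = pm.span {x * r * y | x r y. r \<in> relators D \<union> star ` relators D}"

definition cls :: "(nat \<Rightarrow> partition set) \<Rightarrow> 'n::finite falg \<Rightarrow> 'n falg set" where
  "cls D x = x +o rel_ideal D"

definition alg :: "(nat \<Rightarrow> partition set) \<Rightarrow> 'n::finite falg set set" where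
  "alg D = cls D ` free_alg"

text \<open>
  Operations on cosets are images of the operations on representatives, saturated by adding the
  null space; sums of cosets are their elementwise sums. The unsaturated images would be too small
  for products and for multiplication by the scalar \<open>0\<close>.
\<close>

definition alg_mult :: "(nat \<Rightarrow> partition set) \<Rightarrow> 'n::finite falg set \<Rightarrow> 'n falg set \<Rightarrow> 'n falg set" where
  "alg_mult D X Y = X * Y + rel_ideal D"

definition alg_scale :: "(nat \<Rightarrow> partition set) \<Rightarrow> complex \<Rightarrow> 'n::finite falg set \<Rightarrow> 'n falg set" where
  "alg_scale D c X = scale c ` X + rel_ideal D"

definition corner :: "(nat \<Rightarrow> partition set) \<Rightarrow> 'n::finite falg set set" where
  "corner D = {alg_mult D (alg_mult D (cls D pgen) X) (cls D pgen) | X. X \<in> alg D}"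

text \<open>The product of a list in the corner, whose unit is the class of \<open>p\<close>.\<close>

definition corner_prod :: "(nat \<Rightarrow> partition set) \<Rightarrow> 'n::finite falg set list \<Rightarrow> 'n falg set" where
  "corner_prod D as = foldr (alg_mult D) as (cls D pgen)"

definition coeff_space :: "(nat \<Rightarrow> partition set) \<Rightarrow> 'n::finite falg set set" where
  "coeff_space D = cls D `
     pm.span ({pgen} \<union> {pgen * uprod i j * pgen | i j. length i = length j \<and> i \<noteq> []})"


section \<open>Coproduct and Haar functionals\<close>

definition alg2_null :: "(nat \<Rightarrow> partition set) \<Rightarrow> ('n::finite gen list \<times> 'n gen list \<Rightarrow>\<^sub>0 complex) set" where
  "alg2_null D = tensor_null free_alg (rel_ideal D) free_alg (rel_ideal D)"

fun comult_gen :: "'n::finite gen \<Rightarrow> ('n gen list \<times> 'n gen list \<Rightarrow>\<^sub>0 complex)" where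
  "comult_gen P = tens pgen pgen"
| "comult_gen (U i j) = (\<Sum>k\<in>UNIV. tens (ugen i k) (ugen k j))"

definition free_comult :: "'n::finite falg \<Rightarrow> ('n gen list \<times> 'n gen list \<Rightarrow>\<^sub>0 complex)" where
  "free_comult x = (\<Sum>w\<in>Poly_Mapping.keys x. scale (Poly_Mapping.lookup x w) (prod_list (map comult_gen w)))"

definition coproduct ::
  "(nat \<Rightarrow> partition set) \<Rightarrow> 'n::finite falg set \<Rightarrow> ('n gen list \<times> 'n gen list \<Rightarrow>\<^sub>0 complex) set" where
  "coproduct D X = free_comult ` X + alg2_null D"

text \<open>
  The subspace of representatives of the tensor square of the corner: it consists of the
  combinations of pairs of words that both have the form \<open>p w p\<close> with \<open>w\<close> a nonempty word.
\<close>

definition corner2_reps :: "('n gen list \<times> 'n gen list \<Rightarrow>\<^sub>0 complex) set" where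
  "corner2_reps = pm.span {tens (pgen * x * pgen) (pgen * y * pgen) | x y. x \<in> free_alg \<and> y \<in> free_alg}"

text \<open>
  The maps \<open>id \<otimes> h\<close> and \<open>h \<otimes> id\<close> from the tensor square of the corner to the corner, for a
  linear functional \<open>h\<close> on the corner. Representatives are taken in \<open>corner2_reps\<close>, so that
  \<open>h\<close> is only applied to elements of the corner.
\<close>

definition id_tensor ::
  "(nat \<Rightarrow> partition set) \<Rightarrow> ('n::finite falg set \<Rightarrow> complex) \<Rightarrow>
   ('n gen list \<times> 'n gen list \<Rightarrow>\<^sub>0 complex) set \<Rightarrow> 'n falg set" where
  "id_tensor D h Z =
     (\<lambda>t. \<Sum>(v, w)\<in>Poly_Mapping.keys t.
        Poly_Mapping.single v (Poly_Mapping.lookup t (v, w) * h (cls D (Poly_Mapping.single w 1))))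
       ` (Z \<inter> corner2_reps) + rel_ideal D"

definition tensor_id ::
  "(nat \<Rightarrow> partition set) \<Rightarrow> ('n::finite falg set \<Rightarrow> complex) \<Rightarrow>
   ('n gen list \<times> 'n gen list \<Rightarrow>\<^sub>0 complex) set \<Rightarrow> 'n falg set" where
  "tensor_id D h Z =
     (\<lambda>t. \<Sum>(v, w)\<in>Poly_Mapping.keys t.
        Poly_Mapping.single w (Poly_Mapping.lookup t (v, w) * h (cls D (Poly_Mapping.single v 1))))
       ` (Z \<inter> corner2_reps) + rel_ideal D"

text \<open>Functionals on the corner are extensional functions, so that equality is equality on the corner.\<close>

definition linear_functional ::
  "(nat \<Rightarrow> partition set) \<Rightarrow> ('n::finite falg set \<Rightarrow> complex) \<Rightarrow> bool" where
  "linear_functional D h \<longleftrightarrow> h \<in> extensional (corner D) \<and>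
     (\<forall>a\<in>corner D. \<forall>b\<in>corner D. h (a + b) = h a + h b) \<and>
     (\<forall>c. \<forall>a\<in>corner D. h (alg_scale D c a) = c * h a)"

definition haar_functional ::
  "(nat \<Rightarrow> partition set) \<Rightarrow> ('n::finite falg set \<Rightarrow> complex) \<Rightarrow> bool" where
  "haar_functional D h \<longleftrightarrow> linear_functional D h \<and>
     (\<forall>a\<in>corner D. id_tensor D h (coproduct D a) = alg_scale D (h a) (cls D pgen) \<and>
                   tensor_id D h (coproduct D a) = alg_scale D (h a) (cls D pgen))"

definition unital_functional ::
  "(nat \<Rightarrow> partition set) \<Rightarrow> ('n::finite falg set \<Rightarrow> complex) \<Rightarrow> bool" where
  "unital_functional D h \<longleftrightarrow> h (cls D pgen) = 1"


section \<open>Tensor powers of \<open>l\<^sup>2\<^sub>n\<close>\<close>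

text \<open>
  The \<open>k\<close>-th tensor power of \<open>l\<^sup>2\<^sub>n\<close> has the orthonormal basis \<open>e\<^sub>j = basis_vec j\<close>, where \<open>j\<close>
  ranges over the lists of length \<open>k\<close>.
\<close>

definition tensor_power :: "nat \<Rightarrow> ('n list \<Rightarrow>\<^sub>0 complex) set" where
  "tensor_power k = {\<xi>. \<forall>j\<in>Poly_Mapping.keys \<xi>. length j = k}"

abbreviation basis_vec :: "'n list \<Rightarrow> ('n list \<Rightarrow>\<^sub>0 complex)" where
  "basis_vec j \<equiv> Poly_Mapping.single j 1"

definition inner_prod :: "('n list \<Rightarrow>\<^sub>0 complex) \<Rightarrow> ('n list \<Rightarrow>\<^sub>0 complex) \<Rightarrow> complex" where
  "inner_prod \<xi> \<eta> = (\<Sum>j\<in>Poly_Mapping.keys \<xi>. cnj (Poly_Mapping.lookup \<xi> j) * Poly_Mapping.lookup \<eta> j)"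

definition kernel :: "'n list \<Rightarrow> partition" where
  "kernel j = {1..length j} //
     {(r, s). r \<in> {1..length j} \<and> s \<in> {1..length j} \<and> j ! (r - 1) = j ! (s - 1)}"

definition part_vec :: "nat \<Rightarrow> partition \<Rightarrow> ('n::finite list \<Rightarrow>\<^sub>0 complex)" where
  "part_vec k \<pi> = (\<Sum>j | length j = k \<and> refines {1..k} \<pi> (kernel j). basis_vec j)"

definition part_span :: "(nat \<Rightarrow> partition set) \<Rightarrow> nat \<Rightarrow> ('n::finite list \<Rightarrow>\<^sub>0 complex) set" where
  "part_span D k = pm.span (part_vec k ` D k)"

definition orth_proj ::
  "('n list \<Rightarrow>\<^sub>0 complex) set \<Rightarrow> ('n list \<Rightarrow>\<^sub>0 complex) \<Rightarrow> ('n list \<Rightarrow>\<^sub>0 complex)" where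
  "orth_proj W \<xi> = (THE \<eta>. \<eta> \<in> W \<and> (\<forall>\<zeta>\<in>W. inner_prod \<zeta> (\<xi> - \<eta>) = 0))"

definition proj_entry :: "(nat \<Rightarrow> partition set) \<Rightarrow> nat \<Rightarrow> 'n::finite list \<Rightarrow> 'n list \<Rightarrow> complex" where
  "proj_entry D k i j = inner_prod (basis_vec i) (orth_proj (part_span D k) (basis_vec j))"

text \<open>
  The coaction takes values in the tensor product of \<open>tensor_power k\<close> with \<open>coeff_space D\<close>,
  regarded as a subspace of the tensor product of \<open>tensor_power k\<close> with \<open>alg D\<close>.
\<close>

definition mixed_null ::
  "(nat \<Rightarrow> partition set) \<Rightarrow> nat \<Rightarrow> ('n::finite list \<times> 'n gen list \<Rightarrow>\<^sub>0 complex) set" where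
  "mixed_null D k = tensor_null (tensor_power k) {0} free_alg (rel_ideal D)"

definition coaction ::
  "(nat \<Rightarrow> partition set) \<Rightarrow> nat \<Rightarrow> ('n::finite list \<Rightarrow>\<^sub>0 complex) \<Rightarrow>
   ('n list \<times> 'n gen list \<Rightarrow>\<^sub>0 complex) set" where
  "coaction D k \<xi> =
     (\<Sum>j\<in>Poly_Mapping.keys \<xi>. scale (Poly_Mapping.lookup \<xi> j)
        (\<Sum>i | length i = k. tens (basis_vec i) (pgen * uprod i j * pgen))) +o mixed_null D k"

definition fixed_vectors :: "(nat \<Rightarrow> partition set) \<Rightarrow> nat \<Rightarrow> ('n::finite list \<Rightarrow>\<^sub>0 complex) set" where
  "fixed_vectors D k =
     {\<xi> \<in> tensor_power k. coaction D k \<xi> = tens \<xi> pgen +o mixed_null D k}"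

end

theory Submission
  imports Defs
begin

text \<open>
  A blockwise category consists of all interval partitions whose block lengths lie in
  \<open>L = block_lengths D\<close>: blocks of members have lengths in \<open>L\<close> by definition, and conversely such a
  partition is a concatenation of one-block partitions. The remaining axioms say that \<open>L\<close> is closed
  under cutting: if \<open>k\<close> points, \<open>k \<in> L\<close>, are removed from the right end of such a partition and
  the cut goes through a block, what is left of that block again has length in \<open>L\<close>
  (\<open>interval_closed_L\<close>).

  The vector \<open>T\<^sub>\<pi>\<close> of an interval partition is the product, in the free algebra on \<open>[n]\<close>, of the vectors
  \<open>T\<^sub>m\<close> (\<open>const_sum m\<close>) of its blocks. Closure under cutting says that the adjoint of
  \<open>\<xi> \<mapsto> \<xi> \<otimes> T\<^sub>k\<close> preserves the spans of the \<open>T\<^sub>\<pi>\<close>, and so the projections satisfy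
  \<open>H (\<xi> \<otimes> T\<^sub>k) = H \<xi> \<otimes> T\<^sub>k\<close> for \<open>k \<in> L\<close> (\<open>proj_mult_const\<close>). Read in coordinates, this is a version
  of the defining relations for the entries of \<open>H\<close>, next to any further indices.

  Cut a word in the generators at the letters \<open>p\<close> and let \<open>phi\<close> multiply the entries of \<open>H\<close> that belong
  to the resulting segments. Then \<open>phi\<close> vanishes on the relations (\<open>lin_phi_rel_ideal\<close>) and
  \<open>phi (x p y) = phi x \<cdot> phi y\<close>, so it induces a functional \<open>haar\<close> on the corner that has the prescribed
  values and is multiplicative.

  For the Haar property, the slice of the coproduct of \<open>p u p\<close>, \<open>u\<close> a word in the \<open>u\<^sub>i\<^sub>j\<close>, is the sum of the
  \<open>p u\<^sub>i\<^sub>l p\<close> with coefficients \<open>H\<^sub>l\<^sub>j\<close>; a column of \<open>H\<close> lies in the span of the \<open>T\<^sub>\<pi>\<close>, and for vectors \<open>v\<close>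
  of this span the relations, applied block by block, give \<open>\<Sum>\<^sub>l u\<^sub>i\<^sub>l v\<^sub>l p = v\<^sub>i p\<close>
  (\<open>eqv_lext_comp_span\<close>). The same identity shows that the vectors of the span are fixed. Applying
  \<open>phi\<close> to the equations for a fixed vector \<open>\<xi>\<close> gives \<open>H \<xi> = \<xi>\<close>, the reverse inclusion. Uniqueness is the
  usual argument: \<open>(haar \<otimes> h) \<Delta> a\<close> equals both \<open>haar a\<close> and \<open>h a\<close> for a unital Haar functional \<open>h\<close>.
\<close>

section \<open>Linear algebra in free vector spaces\<close>

abbreviation coef :: "('a \<Rightarrow>\<^sub>0 complex) \<Rightarrow> 'a \<Rightarrow> complex" where
  "coef \<equiv> Poly_Mapping.lookup"

abbreviation sg :: "'a \<Rightarrow> complex \<Rightarrow> ('a \<Rightarrow>\<^sub>0 complex)" where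
  "sg \<equiv> Poly_Mapping.single"

lemma poly_mapping_induct [case_names single add]:
  fixes x :: "'a \<Rightarrow>\<^sub>0 complex"
  assumes single: "\<And>w c. Q (sg w c)" and add: "\<And>x y. Q x \<Longrightarrow> Q y \<Longrightarrow> Q (x + y)"
  shows "Q x"
proof (induction x rule: update_induct)
  case const
  then show ?case using single[of _ 0] by simp
next
  case (update f a b)
  have "Poly_Mapping.update a b f = f + sg a b"
    using update by (intro poly_mapping_eqI)
      (auto simp: lookup_update lookup_add lookup_single in_keys_iff when_def)
  then show ?case using update add single by simp
qed

lemma lookup_sg: "coef (sg v c) w = (if v = w then c else 0)"
  by (simp add: lookup_single when_def)

lemma scale_sg [simp]: "scale c (sg w d) = sg w (c * d)"
  by (rule poly_mapping_eqI) (simp add: lookup_sg)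

lemma sg_mult: "sg v c * sg w d = sg (v @ w) (c * d)"
  by (simp add: mult_single plus_list_def)

text \<open>
  The linear extension of a function on the basis, here with scalar values and below, as \<open>lext\<close>, with
  values in a free vector space.
\<close>
definition lin :: "('a \<Rightarrow> complex) \<Rightarrow> ('a \<Rightarrow>\<^sub>0 complex) \<Rightarrow> complex" where
  "lin g x = (\<Sum>w\<in>Poly_Mapping.keys x. coef x w * g w)"

lemma lin_superset:
  assumes "finite S" "Poly_Mapping.keys x \<subseteq> S"
  shows "lin g x = (\<Sum>w\<in>S. coef x w * g w)"
  unfolding lin_def by (rule sum.mono_neutral_left) (use assms in \<open>auto simp: in_keys_iff\<close>)

lemma lin_add [simp]: "lin g (x + y) = lin g x + lin g y"
proof -
  let ?S = "Poly_Mapping.keys x \<union> Poly_Mapping.keys y"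
  have "Poly_Mapping.keys (x + y) \<subseteq> ?S" by (rule keys_add)
  then show ?thesis
    by (simp add: lin_superset[of ?S] lookup_add distrib_right sum.distrib)
qed

lemma lin_single [simp]: "lin g (sg w c) = c * g w"
  by (simp add: lin_superset[of "{w}"])

lemma lin_zero [simp]: "lin g 0 = 0"
  by (simp add: lin_def)

lemma lin_scale [simp]: "lin g (scale c x) = c * lin g x"
  by (induction x rule: poly_mapping_induct) (simp_all add: pm.scale_right_distrib distrib_left)

lemma lin_uminus [simp]: "lin g (- x) = - lin g x"
  using lin_add[of g x "-x"] by (simp add: eq_neg_iff_add_eq_0 add.commute)

lemma lin_diff [simp]: "lin g (x - y) = lin g x - lin g y"
  using lin_add[of g x "-y"] by simp

lemma lin_sum: "lin g (\<Sum>i\<in>S. x i) = (\<Sum>i\<in>S. lin g (x i))"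
  by (induction S rule: infinite_finite_induct) auto

lemma lin_span_zero:
  assumes "x \<in> pm.span S" "\<And>y. y \<in> S \<Longrightarrow> lin g y = 0"
  shows "lin g x = 0"
  using assms(1) by (induction rule: pm.span_induct_alt) (auto simp: assms(2))

definition lext :: "('a \<Rightarrow> ('b \<Rightarrow>\<^sub>0 complex)) \<Rightarrow> ('a \<Rightarrow>\<^sub>0 complex) \<Rightarrow> ('b \<Rightarrow>\<^sub>0 complex)" where
  "lext f x = (\<Sum>w\<in>Poly_Mapping.keys x. scale (coef x w) (f w))"

lemma lookup_lext: "coef (lext f x) v = lin (\<lambda>w. coef (f w) v) x"
  by (simp add: lext_def lin_def lookup_sum)

lemma lext_add [simp]: "lext f (x + y) = lext f x + lext f y"
  by (rule poly_mapping_eqI) (simp add: lookup_lext lookup_add)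

lemma lext_single [simp]: "lext f (sg w c) = scale c (f w)"
  by (rule poly_mapping_eqI) (simp add: lookup_lext)

lemma lext_zero [simp]: "lext f 0 = 0"
  by (simp add: lext_def)

lemma lext_scale [simp]: "lext f (scale c x) = scale c (lext f x)"
  by (rule poly_mapping_eqI) (simp add: lookup_lext)

lemma lext_diff [simp]: "lext f (x - y) = lext f x - lext f y"
  by (rule poly_mapping_eqI) (simp add: lookup_lext lookup_minus)

lemma lext_sum: "lext f (\<Sum>i\<in>S. x i) = (\<Sum>i\<in>S. lext f (x i))"
  by (induction S rule: infinite_finite_induct) auto

lemma lext_superset:
  assumes "finite S" "Poly_Mapping.keys x \<subseteq> S"
  shows "lext f x = (\<Sum>w\<in>S. scale (coef x w) (f w))"
  unfolding lext_def by (rule sum.mono_neutral_left) (use assms in \<open>auto simp: in_keys_iff\<close>)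

lemma scale_mult_left: "scale c x * y = scale c (x * y)" for x :: "'a::monoid_add \<Rightarrow>\<^sub>0 complex"
  by (simp add: scale_def mult_map_scale_conv_mult mult.assoc)

lemma scale_mult_right: "x * scale c y = scale c (x * y)" for x :: "'a::monoid_add \<Rightarrow>\<^sub>0 complex"
proof (induction x rule: poly_mapping_induct)
  case (single w d)
  show ?case
    by (induction y rule: poly_mapping_induct)
      (simp_all add: mult_single distrib_left pm.scale_right_distrib mult_ac)
qed (simp add: distrib_right pm.scale_right_distrib)

lemma lookup_tens: "coef (tens x y) (v, w) = coef x v * coef y w"
proof -
  have *: "coef (sg (v', w') d) (v, w) = (if v' = v then if w' = w then d else 0 else 0)" for v' w' d
    by (simp add: lookup_sg)
  have inner: "(\<Sum>w'\<in>Poly_Mapping.keys y. if v' = v then if w' = w then coef x v' * coef y w' else 0 else 0) =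
      (if v' = v then coef x v * coef y w else 0)" for v'
    by (cases "v' = v") (auto simp: sum.delta in_keys_iff)
  show ?thesis
    unfolding tens_def lookup_sum * inner
    by (auto simp: sum.delta in_keys_iff)
qed

lemma tens_add_left: "tens (x + x') y = tens x y + tens x' y"
  and tens_add_right: "tens x (y + y') = tens x y + tens x y'"
  and tens_diff_left: "tens (x - x') y = tens x y - tens x' y"
  and tens_diff_right: "tens x (y - y') = tens x y - tens x y'"
  and tens_scale_left: "tens (scale c x) y = scale c (tens x y)"
  and tens_scale_right: "tens x (scale c y) = scale c (tens x y)"
  and tens_zero_left [simp]: "tens 0 y = 0"
  and tens_zero_right [simp]: "tens x 0 = 0"
  and tens_single: "tens (sg v c) (sg w d) = sg (v, w) (c * d)"
  by (rule poly_mapping_eqI,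
      auto simp: lookup_tens lookup_add lookup_minus lookup_sg algebra_simps split: if_splits)+

lemma tens_sum_left: "tens (\<Sum>i\<in>S. x i) y = (\<Sum>i\<in>S. tens (x i) y)"
  by (induction S rule: infinite_finite_induct) (auto simp: tens_add_left)

lemma tens_sum_right: "tens x (\<Sum>i\<in>S. y i) = (\<Sum>i\<in>S. tens x (y i))"
  by (induction S rule: infinite_finite_induct) (auto simp: tens_add_right)

lemma tens_mult:
  fixes x x' :: "'a::monoid_add \<Rightarrow>\<^sub>0 complex" and y y' :: "'b::monoid_add \<Rightarrow>\<^sub>0 complex"
  shows "tens x y * tens x' y' = tens (x * x') (y * y')"
proof (induction x rule: poly_mapping_induct)
  case (single v c)
  show ?case
  proof (induction y rule: poly_mapping_induct)
    case (single w d)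
    show ?case
    proof (induction x' rule: poly_mapping_induct)
      case (single v' c')
      show ?case
        by (induction y' rule: poly_mapping_induct)
          (simp_all add: tens_single mult_single tens_add_right distrib_left mult_ac)
    qed (simp add: tens_add_left distrib_left)
  qed (simp add: tens_add_right distrib_right)
qed (simp add: tens_add_left distrib_right)

section \<open>Orthogonal projections\<close>

lemma inner_prod_superset:
  assumes "finite S" "Poly_Mapping.keys x \<subseteq> S"
  shows "inner_prod x y = (\<Sum>w\<in>S. cnj (coef x w) * coef y w)"
  unfolding inner_prod_def by (rule sum.mono_neutral_left) (use assms in \<open>auto simp: in_keys_iff\<close>)

lemma inner_prod_add_right: "inner_prod x (y + z) = inner_prod x y + inner_prod x z"
  by (simp add: inner_prod_def lookup_add distrib_left sum.distrib)

lemma inner_prod_scale_right: "inner_prod x (scale c y) = c * inner_prod x y"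
  by (simp add: inner_prod_def sum_distrib_left mult_ac)

lemma inner_prod_diff_right: "inner_prod x (y - z) = inner_prod x y - inner_prod x z"
  by (simp add: inner_prod_def lookup_minus right_diff_distrib sum_subtractf)

lemma inner_prod_commute: "inner_prod x y = cnj (inner_prod y x)"
proof -
  let ?S = "Poly_Mapping.keys x \<union> Poly_Mapping.keys y"
  show ?thesis
    by (simp add: inner_prod_superset[of ?S] mult.commute)
qed

lemma inner_prod_add_left: "inner_prod (x + y) z = inner_prod x z + inner_prod y z"
  using inner_prod_commute[of "x + y" z] inner_prod_commute[of x z] inner_prod_commute[of y z]
  by (simp add: inner_prod_add_right)

lemma inner_prod_scale_left: "inner_prod (scale c x) z = cnj c * inner_prod x z"
  using inner_prod_commute[of "scale c x" z] inner_prod_commute[of x z]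
  by (simp add: inner_prod_scale_right)

lemma inner_prod_zero_left: "inner_prod 0 z = 0"
  by (simp add: inner_prod_def)

lemma inner_prod_self_eq_0:
  assumes "inner_prod x x = 0"
  shows "x = 0"
proof -
  have "complex_of_real (\<Sum>w\<in>Poly_Mapping.keys x. (cmod (coef x w))\<^sup>2) = inner_prod x x"
    unfolding inner_prod_def of_real_sum
    by (intro sum.cong refl) (simp add: complex_norm_square mult.commute del: of_real_power)
  then have "(\<Sum>w\<in>Poly_Mapping.keys x. (cmod (coef x w))\<^sup>2) = 0"
    using assms by (metis of_real_eq_0_iff)
  then have "\<forall>w\<in>Poly_Mapping.keys x. coef x w = 0"
    by (simp add: sum_nonneg_eq_0_iff)
  then show ?thesis by (metis in_keys_iff lookup_zero poly_mapping_eqI)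
qed

lemma inner_prod_span_zero:
  assumes "x \<in> pm.span S" "\<And>y. y \<in> S \<Longrightarrow> inner_prod y z = 0"
  shows "inner_prod x z = 0"
  using assms(1)
  by (induction rule: pm.span_induct_alt)
    (simp_all add: assms(2) inner_prod_add_left inner_prod_scale_left inner_prod_zero_left)

text \<open>
  A Gram-Schmidt step: the part \<open>e\<close> of the new vector that is orthogonal to the old span is added with
  the coefficient that makes the remainder orthogonal to \<open>e\<close>.
\<close>
lemma orthogonal_decomposition:
  assumes "finite S"
  shows "\<exists>y\<in>pm.span S. \<forall>z\<in>pm.span S. inner_prod z (x - y) = 0"
  using assms
proof (induction S arbitrary: x rule: finite_induct)
  case empty
  then show ?case by (auto simp: inner_prod_def)
next
  case (insert v S)
  obtain v' where v': "v' \<in> pm.span S" "\<And>z. z \<in> pm.span S \<Longrightarrow> inner_prod z (v - v') = 0"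
    using insert.IH by blast
  obtain y where y: "y \<in> pm.span S" "\<And>z. z \<in> pm.span S \<Longrightarrow> inner_prod z (x - y) = 0"
    using insert.IH by blast
  define e where "e = v - v'"
  define t where "t = inner_prod e (x - y) / inner_prod e e"
  have sub: "pm.span S \<subseteq> pm.span (insert v S)" by (rule pm.span_mono) auto
  have e: "e \<in> pm.span (insert v S)"
    unfolding e_def using v'(1) sub by (intro pm.span_diff) (auto intro: pm.span_base)
  have S0: "inner_prod z (x - (y + scale t e)) = 0" if "z \<in> pm.span S" for z
    using v'(2)[OF that] y(2)[OF that]
    by (simp add: e_def diff_diff_eq[symmetric] inner_prod_diff_right[of _ "x - y"] inner_prod_scale_right)
  have e0: "inner_prod e (x - (y + scale t e)) = 0"
  proof (cases "inner_prod e e = 0")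
    case True
    then have "e = 0" by (rule inner_prod_self_eq_0)
    then show ?thesis by (simp add: inner_prod_def)
  next
    case False
    then show ?thesis
      by (simp add: t_def diff_diff_eq[symmetric] inner_prod_diff_right[of _ "x - y"] inner_prod_scale_right)
  qed
  have "v = e + v'" by (simp add: e_def)
  then have v0: "inner_prod v (x - (y + scale t e)) = 0"
    by (simp only: inner_prod_add_left e0 S0[OF v'(1)] add_0)
  have "\<forall>z\<in>pm.span (insert v S). inner_prod z (x - (y + scale t e)) = 0"
    by (auto elim!: inner_prod_span_zero simp: v0 intro: S0 pm.span_base)
  moreover have "y + scale t e \<in> pm.span (insert v S)"
    using y(1) sub e by (auto intro!: pm.span_add pm.span_scale)
  ultimately show ?case by blast
qed

text \<open>
  The bilinear pairing agrees with the inner product when the first vector is real. The spans in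
  question have real spanning vectors, so orthogonality to them can be tested by a pairing without
  conjugation, for which the projections are symmetric matrices.
\<close>
definition bil :: "('a \<Rightarrow>\<^sub>0 complex) \<Rightarrow> ('a \<Rightarrow>\<^sub>0 complex) \<Rightarrow> complex" where
  "bil x y = lin (coef y) x"

definition conj_vec :: "('a \<Rightarrow>\<^sub>0 complex) \<Rightarrow> ('a \<Rightarrow>\<^sub>0 complex)" where
  "conj_vec x = Poly_Mapping.map cnj x"

lemma lookup_conj_vec [simp]: "coef (conj_vec x) w = cnj (coef x w)"
  by (simp add: conj_vec_def Poly_Mapping.map.rep_eq when_def)

lemma conj_vec_add [simp]: "conj_vec (x + y) = conj_vec x + conj_vec y"
  and conj_vec_single [simp]: "conj_vec (sg w c) = sg w (cnj c)"
  and conj_vec_zero [simp]: "conj_vec 0 = 0"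
  by (rule poly_mapping_eqI, auto simp: lookup_add lookup_sg)+

lemma conj_vec_sum: "conj_vec (\<Sum>i\<in>S. x i) = (\<Sum>i\<in>S. conj_vec (x i))"
  by (induction S rule: infinite_finite_induct) auto

lemma conj_vec_mult: "conj_vec (x * y) = conj_vec x * conj_vec y"
  for x :: "'a::monoid_add \<Rightarrow>\<^sub>0 complex"
proof (induction x rule: poly_mapping_induct)
  case (single w d)
  show ?case by (induction y rule: poly_mapping_induct) (simp_all add: mult_single distrib_left)
qed (simp add: distrib_right)

lemma bil_add_left [simp]: "bil (x + y) z = bil x z + bil y z"
  and bil_scale_left [simp]: "bil (scale c x) z = c * bil x z"
  and bil_single [simp]: "bil (sg w c) z = c * coef z w"
  and bil_zero_left [simp]: "bil 0 z = 0"
  by (simp_all add: bil_def)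

lemma bil_commute: "bil x y = bil y x"
proof -
  let ?S = "Poly_Mapping.keys x \<union> Poly_Mapping.keys y"
  show ?thesis
    by (simp add: bil_def lin_superset[of ?S] mult.commute)
qed

lemma bil_diff_right: "bil x (y - z) = bil x y - bil x z"
  and bil_add_right: "bil x (y + z) = bil x y + bil x z"
  by (simp_all add: bil_commute[of x]) (simp add: bil_def)

lemma bil_eq_inner_prod: "conj_vec x = x \<Longrightarrow> bil x y = inner_prod x y"
  unfolding bil_def lin_def inner_prod_def by (metis lookup_conj_vec)

lemma bil_span_zero:
  assumes "x \<in> pm.span S" "\<And>y. y \<in> S \<Longrightarrow> bil y z = 0"
  shows "bil x z = 0"
  using assms(1) by (induction rule: pm.span_induct_alt) (auto simp: assms(2))

text \<open>
  Orthogonality to a real spanning set is the same for the pairing and for the inner product, since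
  both are additive and homogeneous up to conjugation in the first argument.
\<close>
lemma orth_proj_spec:
  assumes "finite S" "\<And>z. z \<in> S \<Longrightarrow> conj_vec z = z"
  shows "orth_proj (pm.span S) x \<in> pm.span S" "\<And>z. z \<in> pm.span S \<Longrightarrow> bil z (x - orth_proj (pm.span S) x) = 0"
    and orth_proj_unique: "\<And>y. y \<in> pm.span S \<Longrightarrow> (\<And>z. z \<in> S \<Longrightarrow> bil z (x - y) = 0) \<Longrightarrow> orth_proj (pm.span S) x = y"
proof -
  let ?Q = "\<lambda>y. y \<in> pm.span S \<and> (\<forall>z\<in>pm.span S. inner_prod z (x - y) = 0)"
  have uniq: "y = y'" if y: "?Q y" and y': "?Q y'" for y y'
  proof -
    have "y - y' \<in> pm.span S" using y y' by (auto intro: pm.span_diff)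
    then have "inner_prod (y - y') (x - y') - inner_prod (y - y') (x - y) = 0" using y y' by simp
    then have "inner_prod (y - y') (y - y') = 0" by (simp add: inner_prod_diff_right)
    then show ?thesis using inner_prod_self_eq_0 by fastforce
  qed
  obtain y where y: "?Q y" using orthogonal_decomposition[OF assms(1)] by blast
  have Q: "?Q (orth_proj (pm.span S) x)"
    unfolding orth_proj_def by (rule theI[of ?Q, OF y]) (use uniq y in blast)
  then show "orth_proj (pm.span S) x \<in> pm.span S" by simp
  have "bil z (x - orth_proj (pm.span S) x) = 0" if "z \<in> S" for z
    using Q bil_eq_inner_prod[OF assms(2)[OF that]] pm.span_base[OF that] by simp
  then show "bil z (x - orth_proj (pm.span S) x) = 0" if "z \<in> pm.span S" for z
    using that bil_span_zero by blast
  fix y' assume y': "y' \<in> pm.span S" "\<And>z. z \<in> S \<Longrightarrow> bil z (x - y') = 0"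
  have "?Q y'"
    using y' bil_eq_inner_prod[OF assms(2)] by (metis inner_prod_span_zero)
  then show "orth_proj (pm.span S) x = y'" using uniq Q by blast
qed

section \<open>Vectors of interval partitions\<close>

definition const_sum :: "nat \<Rightarrow> ('n::finite list \<Rightarrow>\<^sub>0 complex)" where
  "const_sum m = (\<Sum>i\<in>UNIV. sg (replicate m i) 1)"

text \<open>
  The vector of the interval partition whose blocks have the lengths \<open>c\<close> from left to right.
  Concatenation of words makes the sum of all tensor powers an algebra, in which the tensor product
  of vectors is their product.
\<close>
definition comp_vec :: "nat list \<Rightarrow> ('n::finite list \<Rightarrow>\<^sub>0 complex)" where
  "comp_vec c = prod_list (map const_sum c)"

definition comps :: "nat set \<Rightarrow> nat \<Rightarrow> nat list set" where
  "comps L k = {c. set c \<subseteq> L \<and> sum_list c = k}"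

definition comp_span :: "nat set \<Rightarrow> nat \<Rightarrow> ('n::finite list \<Rightarrow>\<^sub>0 complex) set" where
  "comp_span L k = pm.span (comp_vec ` comps L k)"

lemma comp_vec_Nil [simp]: "comp_vec [] = 1"
  and comp_vec_Cons [simp]: "comp_vec (m # c) = const_sum m * comp_vec c"
  and comp_vec_append [simp]: "comp_vec (c @ d) = comp_vec c * comp_vec d"
  by (simp_all add: comp_vec_def)

lemma list_one: "1 = sg [] (1::complex)"
  by (metis single_one zero_list_def)

lemma conj_vec_comp_vec: "conj_vec (comp_vec c) = comp_vec c"
  by (induction c) (simp_all add: conj_vec_mult const_sum_def conj_vec_sum, simp add: list_one)

lemma finite_comps:
  assumes "0 \<notin> L"
  shows "finite (comps L k)"
proof (rule finite_subset)
  have "length c \<le> sum_list c \<and> (\<forall>m\<in>set c. m \<le> sum_list c)" if "set c \<subseteq> L" for c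
    using that
  proof (induction c)
    case (Cons m c)
    then have "0 < m" using assms by (intro gr0I) auto
    then show ?case using Cons by auto
  qed simp
  then show "comps L k \<subseteq> {c. set c \<subseteq> {..k} \<and> length c \<le> k}" by (auto simp: comps_def)
  show "finite {c. set c \<subseteq> {..k} \<and> length c \<le> k}" by (rule finite_lists_length_le) simp
qed

text \<open>
  Removing \<open>k\<close> points from the right end of a composition removes some whole blocks \<open>d\<close> and possibly
  the last \<open>r\<close> points of a block of length \<open>m\<close>. The condition says that the rest of this block is
  admissible whenever \<open>k\<close> is.
\<close>
definition interval_closed :: "nat set \<Rightarrow> bool" where
  "interval_closed L \<longleftrightarrow> 0 \<notin> L \<and>
     (\<forall>k\<in>L. \<forall>m\<in>L. \<forall>d r. set d \<subseteq> L \<longrightarrow> k = sum_list d + r \<longrightarrow> 0 < r \<longrightarrow> r < m \<longrightarrow> m - r \<in> L)"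

definition is_const :: "'n list \<Rightarrow> bool" where
  "is_const s \<longleftrightarrow> (\<exists>a. s = replicate (length s) a)"

lemma is_const_replicate [simp]: "is_const (replicate m a)"
  by (auto simp: is_const_def)

lemma replicate_eq_sum:
  fixes s :: "'n::finite list"
  assumes "s \<noteq> []"
  shows "(\<Sum>i\<in>UNIV. if s = replicate (length s) i then c else (0::complex)) = (if is_const s then c else 0)"
proof (cases "is_const s")
  case True
  then obtain a where a: "s = replicate (length s) a" unfolding is_const_def by (elim exE)
  then have eq: "(s = replicate (length s) i) = (i = a)" for i
    using assms by (metis length_0_conv replicate_eq_replicate)
  show ?thesis using True unfolding eq by simp
next
  case False
  then have "s \<noteq> replicate (length s) i" for i unfolding is_const_def by metis
  then show ?thesis using False by simp
qed

lemma lookup_mult_single_right: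
  fixes x :: "'n list \<Rightarrow>\<^sub>0 complex"
  assumes "length s = length t"
  shows "coef (x * sg t d) (a @ s) = (if s = t then d * coef x a else 0)"
  by (induction x rule: poly_mapping_induct)
    (use assms in \<open>auto simp: sg_mult lookup_sg lookup_add distrib_left distrib_right\<close>)

lemma lookup_mult_single_left:
  fixes x :: "'n list \<Rightarrow>\<^sub>0 complex"
  assumes "length s = length t"
  shows "coef (sg t d * x) (s @ a) = (if s = t then d * coef x a else 0)"
  by (induction x rule: poly_mapping_induct)
    (use assms in \<open>auto simp: sg_mult lookup_sg lookup_add distrib_left distrib_right\<close>)

lemma lookup_mult_const_right:
  fixes x :: "'n::finite list \<Rightarrow>\<^sub>0 complex"
  assumes "s \<noteq> []"
  shows "coef (x * const_sum (length s)) (a @ s) = (if is_const s then coef x a else 0)"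
  using replicate_eq_sum[OF assms, of "1 * coef x a"]
  by (simp add: const_sum_def sum_distrib_left lookup_sum lookup_mult_single_right)

lemma lookup_mult_const_left:
  fixes x :: "'n::finite list \<Rightarrow>\<^sub>0 complex"
  assumes "s \<noteq> []"
  shows "coef (const_sum (length s) * x) (s @ a) = (if is_const s then coef x a else 0)"
  using replicate_eq_sum[OF assms, of "1 * coef x a"]
  by (simp add: const_sum_def sum_distrib_right lookup_sum lookup_mult_single_left)

text \<open>
  The adjoint of right multiplication by \<open>const_sum k\<close>, see \<open>contract_adjoint\<close>.
\<close>
definition contract :: "nat \<Rightarrow> ('n::finite list \<Rightarrow>\<^sub>0 complex) \<Rightarrow> ('n list \<Rightarrow>\<^sub>0 complex)" where
  "contract k x = (\<Sum>i\<in>UNIV. Poly_Mapping.map_key (\<lambda>a. a @ replicate k i) x)"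

lemma lookup_contract: "coef (contract k x) a = (\<Sum>i\<in>UNIV. coef x (a @ replicate k i))"
  by (simp add: contract_def lookup_sum Poly_Mapping.map_key.rep_eq inj_def)

lemma contract_adjoint: "bil (x * const_sum k) y = bil x (contract k y)"
proof (induction x rule: poly_mapping_induct)
  case (single w c)
  show ?case
    by (simp add: bil_def const_sum_def sum_distrib_left lin_sum sg_mult lookup_contract)
qed (simp add: distrib_right)

lemma contract_less:
  assumes "0 < m" "m < k"
  shows "contract k (x * const_sum m) = contract (k - m) x"
proof (rule poly_mapping_eqI)
  fix a
  have "replicate k i = replicate (k - m) i @ replicate m i" for i :: 'a
    using assms by (simp flip: replicate_add)
  then have "coef (x * const_sum m) (a @ replicate k i) = coef x (a @ replicate (k - m) i)" for i
    using lookup_mult_const_right[of "replicate m i" x "a @ replicate (k - m) i"] assms by auto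
  then show "coef (contract k (x * const_sum m)) a = coef (contract (k - m) x) a"
    by (simp add: lookup_contract)
qed

lemma contract_same:
  fixes x :: "'n::finite list \<Rightarrow>\<^sub>0 complex"
  assumes "0 < k"
  shows "contract k (x * const_sum k) = scale (of_nat (card (UNIV :: 'n set))) x"
proof (rule poly_mapping_eqI)
  fix a
  have "coef (x * const_sum k) (a @ replicate k i) = coef x a" for i
    using lookup_mult_const_right[of "replicate k i" x a] assms by auto
  then show "coef (contract k (x * const_sum k)) a = coef (scale (of_nat (card (UNIV :: 'n set))) x) a"
    by (simp add: lookup_contract)
qed

lemma contract_greater:
  fixes x :: "'n::finite list \<Rightarrow>\<^sub>0 complex"
  assumes "0 < k" "k < m"
  shows "contract k (x * const_sum m) = x * const_sum (m - k)"
proof (rule poly_mapping_eqI)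
  fix a
  have m: "replicate m i = replicate (m - k) i @ replicate k i" for i :: 'n
    using assms by (simp flip: replicate_add)
  have T: "x * const_sum m = (\<Sum>i'\<in>UNIV. x * sg (replicate (m - k) i') 1 * sg (replicate k i') 1)"
    by (simp add: const_sum_def sum_distrib_left mult.assoc sg_mult flip: m)
  have "coef (x * const_sum m) (a @ replicate k i) = coef (x * sg (replicate (m - k) i) 1) a" for i
    using assms by (simp add: T lookup_sum lookup_mult_single_right)
  then show "coef (contract k (x * const_sum m)) a = coef (x * const_sum (m - k)) a"
    by (simp add: lookup_contract const_sum_def sum_distrib_left lookup_sum)
qed

text \<open>
  Contraction cuts \<open>k\<close> points off the right end of the partition. Blocks shorter than the cut are
  absorbed one after the other, until the cut ends with a block, which gives a factor \<open>n\<close>, or inside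
  a block, which is shortened.
\<close>
lemma contract_comp_vec:
  assumes L: "interval_closed L" and "k \<in> L" "c \<in> comps L (l + k)"
  shows "(contract k (comp_vec c) :: 'n::finite list \<Rightarrow>\<^sub>0 complex) \<in> comp_span L l"
proof -
  have pos: "0 \<notin> L" using L by (simp add: interval_closed_def)
  \<comment> \<open>\<open>r\<close> is the number of points still to be removed, \<open>d\<close> lists the blocks already absorbed.\<close>
  have "(contract r (comp_vec c) :: 'n list \<Rightarrow>\<^sub>0 complex) \<in> comp_span L l"
    if "0 < r" "k = r + sum_list d" "set d \<subseteq> L" "set c \<subseteq> L" "sum_list c = l + r" for r c d
    using that
  proof (induction c arbitrary: r d rule: rev_induct)
    case Nil
    then show ?case by simp
  next
    case (snoc m c)
    have m: "0 < m" "m \<in> L" using snoc.prems pos by (auto intro: ccontr)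
    consider "m < r" | "m = r" | "r < m" by linarith
    then show ?case
    proof cases
      case 1
      have "(contract (r - m) (comp_vec c) :: 'n list \<Rightarrow>\<^sub>0 complex) \<in> comp_span L l"
        by (rule snoc.IH[where d = "m # d"]) (use snoc.prems 1 m in auto)
      then show ?thesis using 1 m by (simp add: contract_less)
    next
      case 2
      have "(comp_vec c :: 'n list \<Rightarrow>\<^sub>0 complex) \<in> comp_span L l"
        unfolding comp_span_def by (rule pm.span_base) (use snoc.prems 2 in \<open>auto simp: comps_def\<close>)
      then show ?thesis using 2 m by (simp add: contract_same comp_span_def pm.span_scale)
    next
      case 3
      have "m - r \<in> L"
        using L \<open>k \<in> L\<close> m(2) snoc.prems 3 unfolding interval_closed_def by (metis add.commute)
      then have "c @ [m - r] \<in> comps L l"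
        using snoc.prems 3 by (auto simp: comps_def)
      then have "(comp_vec (c @ [m - r]) :: 'n list \<Rightarrow>\<^sub>0 complex) \<in> comp_span L l"
        unfolding comp_span_def by (intro pm.span_base imageI)
      then show ?thesis using 3 snoc.prems by (simp add: contract_greater)
    qed
  qed
  from this[of k "[]" c] show ?thesis
    using assms pos by (auto simp: comps_def intro: ccontr)
qed

section \<open>The projections\<close>

definition proj :: "nat set \<Rightarrow> nat \<Rightarrow> ('n::finite list \<Rightarrow>\<^sub>0 complex) \<Rightarrow> ('n list \<Rightarrow>\<^sub>0 complex)" where
  "proj L k = orth_proj (comp_span L k)"

definition entry :: "nat set \<Rightarrow> 'n::finite list \<Rightarrow> 'n list \<Rightarrow> complex" where
  "entry L i j = coef (proj L (length j) (basis_vec j)) i"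

lemma
  fixes x :: "'n::finite list \<Rightarrow>\<^sub>0 complex"
  assumes "0 \<notin> L"
  shows proj_mem: "proj L k x \<in> comp_span L k"
    and proj_orth: "z \<in> comp_span L k \<Longrightarrow> bil z (x - proj L k x) = 0"
    and proj_unique: "y \<in> comp_span L k \<Longrightarrow> (\<And>c. c \<in> comps L k \<Longrightarrow> bil (comp_vec c) (x - y) = 0) \<Longrightarrow> proj L k x = y"
proof -
  note spec = orth_proj_spec[of "comp_vec ` comps L k", folded comp_span_def, folded proj_def]
  have fin: "finite (comp_vec ` comps L k :: ('n list \<Rightarrow>\<^sub>0 complex) set)"
    using finite_comps[OF assms] by blast
  show "proj L k x \<in> comp_span L k"
    "z \<in> comp_span L k \<Longrightarrow> bil z (x - proj L k x) = 0"
    "y \<in> comp_span L k \<Longrightarrow> (\<And>c. c \<in> comps L k \<Longrightarrow> bil (comp_vec c) (x - y) = 0) \<Longrightarrow> proj L k x = y"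
    using spec[OF fin] conj_vec_comp_vec by blast+
qed

lemma proj_zero: "0 \<notin> L \<Longrightarrow> proj L k 0 = 0"
  by (rule proj_unique) (auto simp: comp_span_def pm.span_zero bil_commute)

lemma proj_add: 
  assumes "0 \<notin> L"
  shows "proj L k (x + y) = proj L k x + proj L k y"
proof (rule proj_unique[OF assms])
  show "proj L k x + proj L k y \<in> comp_span L k"
    using proj_mem[OF assms] by (auto simp: comp_span_def intro: pm.span_add)
  fix c assume "c \<in> comps L k"
  then have c: "comp_vec c \<in> comp_span L k" unfolding comp_span_def by (intro pm.span_base imageI)
  show "bil (comp_vec c) (x + y - (proj L k x + proj L k y)) = 0"
    using proj_orth[OF assms c, of x] proj_orth[OF assms c, of y]
    by (simp add: add_diff_add bil_add_right)
qed

lemma proj_sum: "0 \<notin> L \<Longrightarrow> proj L k (\<Sum>i\<in>S. x i) = (\<Sum>i\<in>S. proj L k (x i))"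
  by (induction S rule: infinite_finite_induct) (auto simp: proj_zero proj_add)

text \<open>
  For \<open>y\<close> in the range, \<open>y \<otimes> T\<^sub>k\<close> is in the range by concatenation. For \<open>y\<close> orthogonal to the range,
  \<open>y \<otimes> T\<^sub>k\<close> is orthogonal to the range, because the adjoint operation \<open>contract k\<close> preserves it.
\<close>
lemma proj_mult_const:
  assumes L: "interval_closed L" and k: "k \<in> L"
  shows "proj L (l + k) (x * const_sum k) = proj L l x * const_sum k"
proof -
  have pos: "0 \<notin> L" using L by (simp add: interval_closed_def)
  show ?thesis
  proof (rule proj_unique[OF pos])
    have "y * const_sum k \<in> comp_span L (l + k)" if "y \<in> comp_span L l" for y
      using that unfolding comp_span_def
    proof (induction rule: pm.span_induct_alt)
      case base
      then show ?case by (simp add: pm.span_zero)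
    next
      case (step c x y)
      then obtain d where d: "d \<in> comps L l" "x = comp_vec d" by blast
      then have "d @ [k] \<in> comps L (l + k)" using k by (auto simp: comps_def)
      then have "comp_vec (d @ [k]) \<in> pm.span (comp_vec ` comps L (l + k))"
        by (intro pm.span_base imageI)
      then show ?case using step d
        by (auto simp: distrib_right scale_mult_left intro!: pm.span_add pm.span_scale)
    qed
    then show "proj L l x * const_sum k \<in> comp_span L (l + k)" using proj_mem[OF pos] by blast
    fix c assume "c \<in> comps L (l + k)"
    then have "bil (contract k (comp_vec c)) (x - proj L l x) = 0"
      by (intro proj_orth[OF pos] contract_comp_vec[OF L k])
    then show "bil (comp_vec c) (x * const_sum k - proj L l x * const_sum k) = 0"
      by (metis bil_commute contract_adjoint left_diff_distrib)
  qed
qed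

lemma entry_Nil [simp]:
  assumes "0 \<notin> L"
  shows "entry L [] [] = 1"
proof -
  have "proj L 0 (1 :: 'a list \<Rightarrow>\<^sub>0 complex) = 1"
  proof (rule proj_unique[OF assms])
    have "[] \<in> comps L 0" by (simp add: comps_def)
    then have "comp_vec [] \<in> comp_span L 0" unfolding comp_span_def by (intro pm.span_base imageI)
    then show "(1 :: 'a list \<Rightarrow>\<^sub>0 complex) \<in> comp_span L 0" by simp
  qed (simp add: bil_commute)
  then show ?thesis by (simp add: entry_def list_one)
qed

lemma entry_sym:
  assumes "0 \<notin> L" "length i = length j"
  shows "entry L i j = entry L j i"
proof -
  let ?P = "\<lambda>i. proj L (length j) (basis_vec i)"
  have "bil (?P j) (basis_vec i) = bil (?P j) (?P i)"
    using proj_orth[OF assms(1) proj_mem[OF assms(1)], of "length j" "basis_vec j" "basis_vec i"]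
    by (simp add: bil_diff_right)
  moreover have "bil (?P i) (basis_vec j) = bil (?P i) (?P j)"
    using proj_orth[OF assms(1) proj_mem[OF assms(1)], of "length j" "basis_vec i" "basis_vec j"]
    by (simp add: bil_diff_right)
  ultimately have "bil (basis_vec i) (?P j) = bil (basis_vec j) (?P i)" by (simp only: bil_commute)
  then show ?thesis using assms(2) by (simp add: entry_def)
qed

text \<open>
  The identity \<open>H (e\<^sub>b \<otimes> T\<^sub>k) = H e\<^sub>b \<otimes> T\<^sub>k\<close> at the coordinate \<open>a @ s\<close>.
\<close>
lemma entry_right_row:
  fixes a b s :: "'n::finite list"
  assumes L: "interval_closed L" and "length s \<in> L"
  shows "(\<Sum>i\<in>UNIV. entry L (a @ s) (b @ replicate (length s) i)) = (if is_const s then entry L a b else 0)"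
proof -
  let ?k = "length s"
  have pos: "0 \<notin> L" using L by (simp add: interval_closed_def)
  then have s: "s \<noteq> []" using assms(2) by auto
  have "basis_vec b * const_sum ?k = (\<Sum>i\<in>UNIV. basis_vec (b @ replicate ?k i))"
    by (simp add: const_sum_def sum_distrib_left sg_mult)
  then have "(\<Sum>i\<in>UNIV. proj L (length b + ?k) (basis_vec (b @ replicate ?k i))) = proj L (length b) (basis_vec b) * const_sum ?k"
    using proj_mult_const[OF assms, of "length b" "basis_vec b"] by (simp add: proj_sum[OF pos])
  then have "coef (\<Sum>i\<in>UNIV. proj L (length b + ?k) (basis_vec (b @ replicate ?k i))) (a @ s)
     = coef (proj L (length b) (basis_vec b) * const_sum ?k) (a @ s)" by simp
  then show ?thesis
    using lookup_mult_const_right[OF s] by (simp add: lookup_sum entry_def)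
qed

text \<open>
  Reversal of words permutes the spanning vectors, so it commutes with the projections. It turns the
  statements on right ends of words into those on left ends.
\<close>
definition rev_vec :: "('n list \<Rightarrow>\<^sub>0 complex) \<Rightarrow> ('n list \<Rightarrow>\<^sub>0 complex)" where
  "rev_vec x = Poly_Mapping.map_key rev x"

lemma lookup_rev_vec [simp]: "coef (rev_vec x) w = coef x (rev w)"
  by (simp add: rev_vec_def Poly_Mapping.map_key.rep_eq)

lemma rev_vec_single [simp]: "rev_vec (sg w c) = sg (rev w) c"
  and rev_vec_add [simp]: "rev_vec (x + y) = rev_vec x + rev_vec y"
  and rev_vec_diff [simp]: "rev_vec (x - y) = rev_vec x - rev_vec y"
  and rev_vec_zero [simp]: "rev_vec 0 = 0"
  and rev_vec_scale [simp]: "rev_vec (scale c x) = scale c (rev_vec x)"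
  by (rule poly_mapping_eqI, auto simp: lookup_sg lookup_add lookup_minus)+

lemma rev_vec_sum: "rev_vec (\<Sum>i\<in>S. x i) = (\<Sum>i\<in>S. rev_vec (x i))"
  by (induction S rule: infinite_finite_induct) auto

lemma rev_vec_mult: "rev_vec (x * y) = rev_vec y * rev_vec x"
proof (induction x rule: poly_mapping_induct)
  case (single w d)
  show ?case by (induction y rule: poly_mapping_induct) (simp_all add: sg_mult distrib_left distrib_right mult.commute)
qed (simp add: distrib_left distrib_right)

lemma rev_vec_comp_vec: "rev_vec (comp_vec c) = comp_vec (rev c)"
  by (induction c) (simp_all add: rev_vec_mult const_sum_def rev_vec_sum, simp add: list_one)

lemma bil_rev_vec: "bil x (rev_vec y) = bil (rev_vec x) y"
  by (induction x rule: poly_mapping_induct) simp_all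

lemma entry_rev:
  assumes "0 \<notin> L"
  shows "entry L (rev i) (rev j) = entry L i j"
proof -
  let ?k = "length j"
  have rev_comps: "rev c \<in> comps L ?k" if "c \<in> comps L ?k" for c
    using that by (simp add: comps_def)
  have "proj L ?k (basis_vec (rev j)) = rev_vec (proj L ?k (basis_vec j))"
  proof (rule proj_unique[OF assms])
    have "rev_vec y \<in> comp_span L ?k" if "y \<in> comp_span L ?k" for y
      using that unfolding comp_span_def
    proof (induction rule: pm.span_induct_alt)
      case (step c x y)
      then obtain d where "x = comp_vec d" "d \<in> comps L ?k" by blast
      then have "rev_vec x \<in> pm.span (comp_vec ` comps L ?k)"
        by (simp add: rev_vec_comp_vec pm.span_base rev_comps)
      then show ?case using step by (simp add: pm.span_add pm.span_scale)
    qed (simp add: pm.span_zero)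
    then show "rev_vec (proj L ?k (basis_vec j)) \<in> comp_span L ?k" using proj_mem[OF assms] by blast
    fix c assume "c \<in> comps L ?k"
    then have "comp_vec (rev c) \<in> comp_span L ?k"
      unfolding comp_span_def by (intro pm.span_base imageI rev_comps)
    from proj_orth[OF assms this, of "basis_vec j"]
    have "bil (comp_vec c) (rev_vec (basis_vec j - proj L ?k (basis_vec j))) = 0"
      by (simp only: bil_rev_vec rev_vec_comp_vec)
    then show "bil (comp_vec c) (basis_vec (rev j) - rev_vec (proj L ?k (basis_vec j))) = 0"
      by simp
  qed
  then show ?thesis by (simp add: entry_def)
qed

lemma entry_right_col:
  fixes a b s :: "'n::finite list"
  assumes L: "interval_closed L" and "length s \<in> L" "length a = length b"
  shows "(\<Sum>i\<in>UNIV. entry L (a @ replicate (length s) i) (b @ s)) = (if is_const s then entry L a b else 0)"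
proof -
  have pos: "0 \<notin> L" using L by (simp add: interval_closed_def)
  show ?thesis
    using entry_right_row[OF L assms(2), of b a]
    by (simp add: assms entry_sym[OF pos, of a b] entry_sym[OF pos, of "a @ _" "b @ _"])
qed

lemma is_const_rev: "is_const (rev s) = is_const s"
  unfolding is_const_def by (metis length_rev rev_replicate rev_rev_ident)

lemma entry_left_row:
  fixes a b s :: "'n::finite list"
  assumes L: "interval_closed L" and "length s \<in> L"
  shows "(\<Sum>i\<in>UNIV. entry L (s @ a) (replicate (length s) i @ b)) = (if is_const s then entry L a b else 0)"
proof -
  have pos: "0 \<notin> L" using L by (simp add: interval_closed_def)
  have *: "entry L (s @ a) (replicate (length s) i @ b) = entry L (rev a @ rev s) (rev b @ replicate (length (rev s)) i)" for i
    using entry_rev[OF pos, of "s @ a" "replicate (length s) i @ b"] by simp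
  show ?thesis
    unfolding * using entry_right_row[OF L, of "rev s" "rev a" "rev b"] assms(2) is_const_rev[of s]
    by (simp add: entry_rev[OF pos])
qed

lemma entry_left_col:
  fixes a b s :: "'n::finite list"
  assumes L: "interval_closed L" and "length s \<in> L" "length a = length b"
  shows "(\<Sum>i\<in>UNIV. entry L (replicate (length s) i @ a) (s @ b)) = (if is_const s then entry L a b else 0)"
proof -
  have pos: "0 \<notin> L" using L by (simp add: interval_closed_def)
  show ?thesis
    using entry_left_row[OF L assms(2), of b a]
    by (simp add: assms entry_sym[OF pos, of a b] entry_sym[OF pos, of "_ @ a" "_ @ b"])
qed

section \<open>Interval partitions and blockwise categories\<close>

lemma atLeastAtMost_concat: "{1..k + l} = {1..k} \<union> (\<lambda>r. k + r) ` {1..l::nat}"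
proof -
  have "(\<lambda>r. k + r) ` {1..l} = {k + 1..k + l}" by (simp add: image_add_atLeastAtMost)
  then show ?thesis by auto
qed

lemma partition_on_pconcat:
  assumes "partition_on {1..k} \<pi>" "partition_on {1..l} \<sigma>"
  shows "partition_on {1..k + l} (pconcat k \<pi> \<sigma>)"
proof -
  let ?f = "\<lambda>r. k + r"
  have "partition_on (?f ` {1..l}) ((`) ?f ` \<sigma> - {{}})"
    by (rule partition_on_inj_image[OF assms(2)]) simp
  then have shifted: "partition_on (?f ` {1..l}) ((`) ?f ` \<sigma>)"
    using partition_onD3[OF assms(2)] by (subst (asm) Diff_triv) auto
  have unions: "\<Union>\<pi> = {1..k}" "\<Union>((`) ?f ` \<sigma>) = ?f ` {1..l}"
    using partition_onD1[OF assms(1)] partition_onD1[OF shifted] by simp_all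
  have "\<Union>\<pi> \<inter> \<Union>((`) ?f ` \<sigma>) = {}"
    unfolding unions by auto
  then have "disjoint (\<pi> \<union> (`) ?f ` \<sigma>)"
    by (intro disjoint_union partition_onD2[OF assms(1)] partition_onD2[OF shifted])
  moreover have "\<Union>(\<pi> \<union> (`) ?f ` \<sigma>) = {1..k + l}"
    by (simp only: Union_Un_distrib unions atLeastAtMost_concat)
  moreover have "{} \<notin> \<pi> \<union> (`) ?f ` \<sigma>"
    using partition_onD3[OF assms(1)] partition_onD3[OF shifted] by (simp only: Un_iff simp_thms)
  ultimately show ?thesis
    unfolding pconcat_def partition_on_def by simp
qed

text \<open>
  The interval partition whose blocks have the lengths \<open>c\<close> from left to right.
\<close>
definition comp_part :: "nat list \<Rightarrow> partition" where
  "comp_part c = foldr (\<lambda>m. pconcat m (one_block m)) c {}"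

lemma comp_part_Nil [simp]: "comp_part [] = {}"
  and comp_part_Cons [simp]: "comp_part (m # c) = pconcat m (one_block m) (comp_part c)"
  by (simp_all add: comp_part_def)

lemma pconcat_empty [simp]: "pconcat k \<pi> {} = \<pi>" "pconcat 0 {} \<pi> = \<pi>"
  by (simp_all add: pconcat_def)

lemma pconcat_assoc: "pconcat k \<pi> (pconcat l \<sigma> \<tau>) = pconcat (k + l) (pconcat k \<pi> \<sigma>) \<tau>"
  unfolding pconcat_def image_Un image_image add.assoc Un_assoc ..

lemma comp_part_append: "comp_part (c @ d) = pconcat (sum_list c) (comp_part c) (comp_part d)"
  by (induction c) (simp_all add: pconcat_assoc)

lemma partition_on_one_block: "0 < k \<Longrightarrow> partition_on {1..k} (one_block k)"
  by (auto simp: one_block_def intro!: partition_on_space)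

lemma interval_partitions_one_block: "0 < k \<Longrightarrow> one_block k \<in> interval_partitions k"
  unfolding interval_partitions_def
  by (intro CollectI conjI ballI partition_on_one_block) (auto simp only: one_block_def singleton_iff)

lemma interval_partitions_pconcat:
  assumes "\<pi> \<in> interval_partitions k" "\<sigma> \<in> interval_partitions l"
  shows "pconcat k \<pi> \<sigma> \<in> interval_partitions (k + l)"
proof -
  have int: "\<exists>a b. V = {a..b}" if "\<tau> \<in> interval_partitions m" "V \<in> \<tau>" for \<tau> m V
    using that by (simp only: interval_partitions_def mem_Collect_eq)
  have "\<exists>a b. V = {a..b}" if "V \<in> pconcat k \<pi> \<sigma>" for V
    using that unfolding pconcat_def
  proof (elim UnE imageE)
    fix W assume W: "V = (\<lambda>r. k + r) ` W" "W \<in> \<sigma>"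
    obtain a b where "W = {a..b}" using int[OF assms(2) W(2)] by (elim exE)
    then have "V = {k + a..k + b}" unfolding W(1) by simp
    then show ?thesis by (intro exI)
  qed (rule int[OF assms(1)])
  moreover have "partition_on {1..k + l} (pconcat k \<pi> \<sigma>)"
    using assms by (simp only: partition_on_pconcat interval_partitions_def mem_Collect_eq)
  ultimately show ?thesis
    unfolding interval_partitions_def by (intro CollectI conjI ballI)
qed

text \<open>
  The block of the last point \<open>k\<close> is an interval that ends in \<open>k\<close>; induction applies to the points
  before it.
\<close>
lemma interval_partition_is_comp_part:
  "\<pi> \<in> interval_partitions k \<Longrightarrow> \<exists>c. 0 \<notin> set c \<and> sum_list c = k \<and> \<pi> = comp_part c"
proof (induction k arbitrary: \<pi> rule: less_induct)
  case (less k)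
  have part: "partition_on {1..k} \<pi>" and int: "\<And>V. V \<in> \<pi> \<Longrightarrow> \<exists>a b. V = {a..b}"
    using less.prems by (auto simp: interval_partitions_def)
  show ?case
  proof (cases "k = 0")
    case True
    then have "\<pi> = {}" using part by (auto simp: partition_on_def)
    then show ?thesis using True by (intro exI[of _ "[]"]) simp
  next
    case False
    then have "k \<in> \<Union>\<pi>" using part by (auto simp: partition_on_def)
    then obtain V where V: "V \<in> \<pi>" "k \<in> V" by blast
    then obtain a b where ab: "V = {a..b}" using int by blast
    have sub: "V \<subseteq> {1..k}" using part V by (auto simp: partition_on_def)
    then have b: "b = k" and a: "1 \<le> a" "a \<le> k" using V ab by auto
    have a_less: "a - 1 < k" using a by simp
    have rest: "{1..k} - V = {1..a - 1}" using ab b a by auto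
    have "{1..k} = V \<union> {1..a - 1}" "V \<inter> {1..a - 1} = {}" using ab b a by auto
    have "partition_on {1..a - 1} (\<pi> - {V})"
      using part V(1) partition_on_insert[of V "\<pi> - {V}" "{1..k}"] rest
      by (auto simp: insert_absorb disjnt_def dest: partition_onD2 disjointD)
    then have "\<pi> - {V} \<in> interval_partitions (a - 1)"
      unfolding interval_partitions_def by (intro CollectI conjI ballI int) (auto simp only: Diff_iff)
    then obtain c where c: "0 \<notin> set c" "sum_list c = a - 1" "\<pi> - {V} = comp_part c"
      using less.IH[OF a_less, of "\<pi> - {V}"] by metis
    have "(\<lambda>r. a - 1 + r) ` {1..k - (a - 1)} = V"
      unfolding image_add_atLeastAtMost using ab b a by simp
    then have "\<pi> = comp_part (c @ [k - (a - 1)])"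
      using c V(1) by (auto simp: comp_part_append pconcat_def one_block_def)
    then show ?thesis using c a by (intro exI[of _ "c @ [k - (a - 1)]"]) auto
  qed
qed

lemma interval_partitions_comp_part:
  "0 \<notin> set c \<Longrightarrow> comp_part c \<in> interval_partitions (sum_list c)"
proof (induction c)
  case Nil
  then show ?case by (simp add: interval_partitions_def partition_on_empty)
next
  case (Cons m c)
  then show ?case using interval_partitions_pconcat[OF interval_partitions_one_block] by simp
qed

lemma card_blocks_comp_part: "card ` comp_part c = set c"
  by (induction c)
    (auto simp: pconcat_def one_block_def image_image card_image image_Un)

lemma equiv_kernel:
  "equiv {1..length j} {(r, s). r \<in> {1..length j} \<and> s \<in> {1..length j} \<and> j ! (r - 1) = j ! (s - 1)}"
  by (auto simp: equiv_def refl_on_def sym_def trans_def)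

lemma partition_on_kernel: "partition_on {1..length j} (kernel j)"
  unfolding kernel_def by (rule partition_on_quotient[OF equiv_kernel])

text \<open>
  A word lies in the support of \<open>T\<^sub>\<pi>\<close> iff it is constant on the blocks of \<open>\<pi>\<close>.
\<close>
lemma refines_kernel_iff:
  assumes "partition_on {1..k} \<pi>" "length j = k"
  shows "refines {1..k} \<pi> (kernel j) \<longleftrightarrow> (\<forall>V\<in>\<pi>. \<forall>r\<in>V. \<forall>s\<in>V. j ! (r - 1) = j ! (s - 1))"
    (is "?l \<longleftrightarrow> ?r")
proof
  assume ?l
  show ?r
  proof (intro ballI)
    fix V r s assume V: "V \<in> \<pi>" "r \<in> V" "s \<in> V"
    then obtain K where K: "K \<in> kernel j" "V \<subseteq> K" using \<open>?l\<close> unfolding refines_def by metis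
    have "K \<in> {1..length j} // {(r, s). r \<in> {1..length j} \<and> s \<in> {1..length j} \<and> j ! (r - 1) = j ! (s - 1)}"
      using \<open>K \<in> kernel j\<close> by (simp only: kernel_def)
    moreover have "{r, s} \<subseteq> K" using V \<open>V \<subseteq> K\<close> by blast
    ultimately have "(r, s) \<in> {(r, s). r \<in> {1..length j} \<and> s \<in> {1..length j} \<and> j ! (r - 1) = j ! (s - 1)}"
      by (rule in_quotient_imp_in_rel[OF equiv_kernel])
    then show "j ! (r - 1) = j ! (s - 1)" by simp
  qed
next
  assume const: ?r
  have part: "partition_on {1..k} (kernel j)"
    using partition_on_kernel[of j] assms(2) by (rule back_subst[of "\<lambda>k. partition_on {1..k} (kernel j)"])
  have "\<exists>K\<in>kernel j. V \<subseteq> K" if V: "V \<in> \<pi>" for V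
  proof -
    let ?E = "{(r, s). r \<in> {1..length j} \<and> s \<in> {1..length j} \<and> j ! (r - 1) = j ! (s - 1)}"
    have sub: "V \<subseteq> {1..length j}"
      unfolding assms(2) partition_onD1[OF assms(1)] by (rule Union_upper[OF V])
    obtain r where r: "r \<in> V" using V partition_onD3[OF assms(1)] by (metis ex_in_conv)
    have "?E `` {r} \<in> kernel j"
      unfolding kernel_def by (rule quotientI) (use r sub in blast)
    moreover have "V \<subseteq> ?E `` {r}"
    proof
      fix s assume s: "s \<in> V"
      have "j ! (r - 1) = j ! (s - 1)" by (rule const[rule_format, OF V r s])
      moreover have "r \<in> {1..length j}" "s \<in> {1..length j}" using r s sub by blast+
      ultimately show "s \<in> ?E `` {r}" by (intro ImageI[of r] CollectI case_prodI conjI singletonI)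
    qed
    ultimately show ?thesis by (rule bexI[rotated])
  qed
  then show ?l
    unfolding refines_def by (intro conjI ballI assms(1) part)
qed

lemma refines_kernel_pconcat:
  assumes "partition_on {1..k} \<pi>" "partition_on {1..l} \<sigma>" "length i = k" "length j = l"
  shows "refines {1..k + l} (pconcat k \<pi> \<sigma>) (kernel (i @ j)) \<longleftrightarrow>
    refines {1..k} \<pi> (kernel i) \<and> refines {1..l} \<sigma> (kernel j)"
proof -
  have left: "(i @ j) ! (r - 1) = i ! (r - 1)" if "V \<in> \<pi>" "r \<in> V" for V r
  proof -
    have "r \<in> {1..k}" using that assms(1) by (auto simp: partition_on_def)
    then show ?thesis using assms by (auto simp: nth_append)
  qed
  have right: "(i @ j) ! (k + r - 1) = j ! (r - 1)" if "V \<in> \<sigma>" "r \<in> V" for V r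
  proof -
    have "r \<in> {1..l}" using that assms(2) by (auto simp: partition_on_def)
    then show ?thesis using assms by (auto simp: nth_append)
  qed
  have block_left: "(\<forall>r\<in>V. \<forall>s\<in>V. (i @ j) ! (r - 1) = (i @ j) ! (s - 1)) =
      (\<forall>r\<in>V. \<forall>s\<in>V. i ! (r - 1) = i ! (s - 1))" if "V \<in> \<pi>" for V
    by (intro ball_cong refl) (simp only: left[OF that])
  have block_right: "(\<forall>r\<in>V. \<forall>s\<in>V. (i @ j) ! (k + r - 1) = (i @ j) ! (k + s - 1)) =
      (\<forall>r\<in>V. \<forall>s\<in>V. j ! (r - 1) = j ! (s - 1))" if "V \<in> \<sigma>" for V
    by (intro ball_cong refl) (simp only: right[OF that])
  have len: "length (i @ j) = k + l" using assms by simp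
  show ?thesis
    unfolding refines_kernel_iff[OF partition_on_pconcat[OF assms(1,2)] len]
      refines_kernel_iff[OF assms(1,3)] refines_kernel_iff[OF assms(2,4)]
    unfolding pconcat_def ball_Un ball_simps
    by (intro arg_cong2[where f = "(\<and>)"] ball_cong refl block_left block_right)
qed

lemma finite_lists: "finite {j :: 'n::finite list. length j = k}"
  using finite_lists_length_eq[of "UNIV :: 'n set" k] by simp

lemma lookup_part_vec:
  "coef (part_vec k \<pi> :: 'n::finite list \<Rightarrow>\<^sub>0 complex) j = (if length j = k \<and> refines {1..k} \<pi> (kernel j) then 1 else 0)"
proof -
  have "finite {j :: 'n list. length j = k \<and> refines {1..k} \<pi> (kernel j)}"
    by (rule finite_subset[OF _ finite_lists[of k]]) auto
  then show ?thesis
    by (simp add: part_vec_def lookup_sum lookup_sg sum.delta)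
qed

lemma refines_one_block:
  assumes "0 < k" "length j = k"
  shows "refines {1..k} (one_block k) (kernel j) \<longleftrightarrow> is_const j"
proof -
  have "(\<forall>r\<in>{1..k}. \<forall>s\<in>{1..k}. j ! (r - 1) = j ! (s - 1)) \<longleftrightarrow> is_const j" (is "?l \<longleftrightarrow> ?r")
  proof
    assume ?l
    have "j = replicate (length j) (j ! 0)"
    proof (rule nth_equalityI)
      fix r assume "r < length j"
      then have "Suc r \<in> {1..k}" "1 \<in> {1..k}" using assms by auto
      then have "j ! (Suc r - 1) = j ! (1 - 1)" by (rule \<open>?l\<close>[rule_format])
      then show "j ! r = replicate (length j) (j ! 0) ! r" using \<open>r < length j\<close> by simp
    qed simp
    then show ?r unfolding is_const_def by (rule exI)
  next
    assume ?r
    then obtain a where a: "j = replicate (length j) a" unfolding is_const_def by (elim exE)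
    have "j ! (r - 1) = a" if "r \<in> {1..k}" for r
      using that assms by (subst a) auto
    then show ?l by metis
  qed
  then show ?thesis
    using refines_kernel_iff[OF partition_on_one_block[OF assms(1)] assms(2)]
    by (simp add: one_block_def)
qed

lemma keys_comp_vec: "coef (comp_vec c) j \<noteq> 0 \<Longrightarrow> length j = sum_list c"
proof (induction c arbitrary: j)
  case Nil
  then show ?case by (auto simp: list_one lookup_sg split: if_splits)
next
  case (Cons m c)
  have "j \<in> Poly_Mapping.keys (comp_vec (m # c))" using Cons.prems by (simp add: in_keys_iff)
  then obtain a b where ab: "j = a @ b" "coef (const_sum m) a \<noteq> 0" "coef (comp_vec c) b \<noteq> 0"
    using keys_mult[of "const_sum m" "comp_vec c"] by (auto simp: in_keys_iff plus_list_def)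
  obtain i where "coef (sg (replicate m i) 1) a \<noteq> 0"
    using ab(2) unfolding const_sum_def lookup_sum by (rule sum.not_neutral_contains_not_neutral)
  then have "length a = m" by (auto simp: lookup_sg split: if_splits)
  then show ?case using ab Cons.IH by auto
qed

lemma part_vec_comp_part:
  "0 \<notin> set c \<Longrightarrow> part_vec (sum_list c) (comp_part c) = comp_vec c"
proof (induction c)
  case Nil
  have "refines {} {} (kernel [])" by (simp add: refines_def kernel_def partition_on_def)
  then show ?case
    by (intro poly_mapping_eqI) (auto simp: lookup_part_vec list_one lookup_sg)
next
  case (Cons m c)
  show ?case
  proof (rule poly_mapping_eqI)
    fix j :: "'a list"
    show "coef (part_vec (sum_list (m # c)) (comp_part (m # c))) j = coef (comp_vec (m # c)) j"
    proof (cases "length j = m + sum_list c")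
      case False
      then show ?thesis using keys_comp_vec[of "m # c" j] by (auto simp: lookup_part_vec)
    next
      case True
      define a b where "a = take m j" and "b = drop m j"
      have j: "j = a @ b" and len: "length a = m" "length b = sum_list c"
        using True by (auto simp: a_def b_def)
      have m: "0 < m" "a \<noteq> []" using Cons.prems len by auto
      have part: "partition_on {1..sum_list c} (comp_part c)"
        using interval_partitions_comp_part[of c] Cons.prems by (simp add: interval_partitions_def)
      have IH: "coef (comp_vec c) b = (if refines {1..sum_list c} (comp_part c) (kernel b) then 1 else 0)"
        using Cons len by (simp add: lookup_part_vec flip: Cons.IH)
      have "refines {1..m + sum_list c} (pconcat m (one_block m) (comp_part c)) (kernel (a @ b)) \<longleftrightarrow>
          is_const a \<and> refines {1..sum_list c} (comp_part c) (kernel b)"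
        unfolding refines_kernel_pconcat[OF partition_on_one_block[OF m(1)] part len] refines_one_block[OF m(1) len(1)] ..
      then have "coef (part_vec (m + sum_list c) (pconcat m (one_block m) (comp_part c))) j =
          (if is_const a then coef (comp_vec c) b else 0)"
        using True by (simp add: lookup_part_vec IH j del: One_nat_def)
      then show ?thesis
        using lookup_mult_const_left[OF m(2), of "comp_vec c" b] len(1) by (simp add: j)
    qed
  qed
qed

lemma refines_pconcat:
  assumes "refines {1..k} \<pi> \<pi>'" "refines {1..l} \<sigma> \<sigma>'"
  shows "refines {1..k + l} (pconcat k \<pi> \<sigma>) (pconcat k \<pi>' \<sigma>')"
  unfolding refines_def
proof (intro conjI ballI)
  show "partition_on {1..k + l} (pconcat k \<pi> \<sigma>)" "partition_on {1..k + l} (pconcat k \<pi>' \<sigma>')"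
    using assms by (simp_all only: refines_def partition_on_pconcat)
  fix X assume "X \<in> pconcat k \<pi> \<sigma>"
  then show "\<exists>Y\<in>pconcat k \<pi>' \<sigma>'. X \<subseteq> Y"
    unfolding pconcat_def
  proof (elim UnE imageE)
    assume "X \<in> \<pi>"
    then obtain Y where "Y \<in> \<pi>'" "X \<subseteq> Y" using assms(1) unfolding refines_def by metis
    then show "\<exists>Y\<in>\<pi>' \<union> (\<lambda>V. (\<lambda>r. k + r) ` V) ` \<sigma>'. X \<subseteq> Y" by (intro bexI[of _ Y] UnI1)
  next
    fix V assume V: "X = (\<lambda>r. k + r) ` V" "V \<in> \<sigma>"
    then obtain Y where "Y \<in> \<sigma>'" "V \<subseteq> Y" using assms(2) unfolding refines_def by metis
    then show "\<exists>Y\<in>\<pi>' \<union> (\<lambda>V. (\<lambda>r. k + r) ` V) ` \<sigma>'. X \<subseteq> Y"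
      unfolding V(1) by (intro bexI[of _ "(\<lambda>r. k + r) ` Y"] UnI2 imageI image_mono)
  qed
qed

lemma refines_to_one_block:
  assumes "partition_on {1..k} \<pi>" "0 < k"
  shows "refines {1..k} \<pi> (one_block k)"
  unfolding refines_def
proof (intro conjI ballI assms partition_on_one_block)
  fix V assume "V \<in> \<pi>"
  then have "V \<subseteq> {1..k}" unfolding partition_onD1[OF assms(1)] by (rule Union_upper)
  then show "\<exists>Y\<in>one_block k. V \<subseteq> Y" unfolding one_block_def by (intro bexI[of _ "{1..k}"] singletonI)
qed

lemma nonempty_of_mem: "x \<in> A \<Longrightarrow> A \<noteq> {}"
  by auto

locale blockwise_category =
  fixes D :: "nat \<Rightarrow> partition set"
  assumes blockwise: "blockwise D"
begin

abbreviation L :: "nat set" where "L \<equiv> block_lengths D"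

lemma L_pos: "0 \<notin> L"
  by (simp add: block_lengths_def)

lemma one_block_mem: "k \<in> L \<Longrightarrow> one_block k \<in> D k"
  by (simp only: block_lengths_def mem_Collect_eq)

lemma interval_category: "interval_category D"
  using blockwise unfolding blockwise_def by (elim conjE)

lemma D_interval: "1 \<le> k \<Longrightarrow> \<pi> \<in> D k \<Longrightarrow> \<pi> \<in> interval_partitions k"
  using interval_category unfolding interval_category_def by (elim conjE) (metis subsetD)

lemma D_pconcat: "1 \<le> k \<Longrightarrow> 1 \<le> l \<Longrightarrow> \<pi> \<in> D k \<Longrightarrow> \<sigma> \<in> D l \<Longrightarrow> pconcat k \<pi> \<sigma> \<in> D (k + l)"
  using interval_category unfolding interval_category_def by (elim conjE) metis

lemma D_blocks: "1 \<le> k \<Longrightarrow> \<pi> \<in> D k \<Longrightarrow> V \<in> \<pi> \<Longrightarrow> one_block (card V) \<in> D (card V)"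
  using blockwise unfolding blockwise_def by (elim conjE) metis

lemma D_between:
  assumes "1 \<le> k" "\<rho> \<in> D k" "\<sigma> \<in> D k" "\<pi> \<in> interval_partitions k"
    "refines {1..k} \<rho> \<pi>" "refines {1..k} \<pi> \<sigma>"
  shows "\<pi> \<in> D k"
  using blockwise assms unfolding blockwise_def by (elim conjE) metis

lemma D_cancel: "1 \<le> l \<Longrightarrow> k \<in> L \<Longrightarrow> D (k + l) \<noteq> {} \<Longrightarrow> D l \<noteq> {}"
  using blockwise unfolding blockwise_def by (elim conjE) metis

lemma comp_part_mem:
  assumes "set c \<subseteq> L" "c \<noteq> []"
  shows "comp_part c \<in> D (sum_list c)"
  using assms
proof (induction c)
  case (Cons m c)
  have m: "1 \<le> m" "one_block m \<in> D m" using Cons.prems by (auto simp: block_lengths_def)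
  show ?case
  proof (cases "c = []")
    case False
    then have "comp_part c \<in> D (sum_list c)" using Cons by auto
    moreover obtain m' c' where "c = m' # c'" using False by (cases c) auto
    then have "1 \<le> sum_list c" using Cons.prems by (auto simp: block_lengths_def)
    ultimately show ?thesis using D_pconcat[OF m(1)] m by simp
  qed (use m in simp)
qed simp

lemma D_comp_part:
  assumes "1 \<le> k" "\<pi> \<in> D k"
  obtains c where "c \<in> comps L k" "\<pi> = comp_part c"
proof -
  obtain c where c: "0 \<notin> set c" "sum_list c = k" "\<pi> = comp_part c"
    using interval_partition_is_comp_part[OF D_interval[OF assms]] by (elim exE conjE)
  have "m \<in> L" if "m \<in> set c" for m
  proof -
    have "m \<in> card ` \<pi>" using that unfolding c(3) card_blocks_comp_part .
    then obtain V where V: "m = card V" "V \<in> \<pi>" by (elim imageE)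
    have "one_block m \<in> D m" unfolding V(1) by (rule D_blocks[OF assms V(2)])
    moreover have "1 \<le> m" using that c(1) by (intro Suc_leI[of 0, folded One_nat_def] gr0I) auto
    ultimately show ?thesis by (simp only: block_lengths_def mem_Collect_eq)
  qed
  then have "c \<in> comps L k" unfolding comps_def using c(2) by (intro CollectI conjI subsetI)
  then show ?thesis using c(3) by (rule that)
qed

lemma D_nonempty_cancel:
  assumes "set d \<subseteq> L" "1 \<le> r" "D (sum_list d + r) \<noteq> {}"
  shows "D r \<noteq> {}"
  using assms
proof (induction d)
  case (Cons k d)
  have "D (sum_list d + r) \<noteq> {}"
    by (rule D_cancel[of _ k]) (use Cons.prems in \<open>auto simp: add.assoc\<close>)
  then show ?case using Cons.prems by (intro Cons.IH) simp_all
qed simp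

text \<open>
  Let \<open>k = sum_list d + r\<close> and \<open>m\<close> be in \<open>L\<close>, with \<open>0 < r < m\<close>. Cancelling the blocks \<open>d\<close> from \<open>k\<close> gives a
  partition \<open>\<tau>\<close> in \<open>D r\<close>, and cancelling the blocks of \<open>\<tau>\<close> from \<open>m\<close> gives a partition \<open>\<tau>'\<close> in \<open>D (m - r)\<close>.
  The partition that consists of one block of \<open>m - r\<close> points followed by \<open>\<tau>\<close> lies between the
  concatenation of \<open>\<tau>'\<close> and \<open>\<tau>\<close> and the one-block partition, so it belongs to \<open>D m\<close>, and its first block
  has a length in \<open>L\<close>.
\<close>
lemma interval_closed_L: "interval_closed L"
  unfolding interval_closed_def
proof (intro conjI ballI allI impI L_pos)
  fix k m d r
  assume *: "k \<in> L" "m \<in> L" "set d \<subseteq> L" "k = sum_list d + r" "0 < r" "r < m"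
  have r1: "1 \<le> r" "1 \<le> m - r" "0 < m - r" "1 \<le> m" and m: "m - r + r = m"
    using *(5,6) by simp_all
  have "D (sum_list d + r) \<noteq> {}"
    using one_block_mem[OF *(1)] unfolding *(4) by (rule nonempty_of_mem)
  then have "D r \<noteq> {}" by (rule D_nonempty_cancel[OF *(3) r1(1)])
  then obtain \<tau> where \<tau>: "\<tau> \<in> D r" unfolding ex_in_conv[symmetric] by (elim exE)
  obtain e where e: "e \<in> comps L r" by (rule D_comp_part[OF r1(1) \<tau>])
  then have e': "set e \<subseteq> L" "sum_list e = r" unfolding comps_def by simp_all
  have m': "sum_list e + (m - r) = m" using e'(2) *(6) by simp
  have "D (sum_list e + (m - r)) \<noteq> {}"
    unfolding m' using one_block_mem[OF *(2)] by (rule nonempty_of_mem)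
  then have "D (m - r) \<noteq> {}" by (rule D_nonempty_cancel[OF e'(1) r1(2)])
  then obtain \<tau>' where \<tau>': "\<tau>' \<in> D (m - r)" unfolding ex_in_conv[symmetric] by (elim exE)
  have part: "partition_on {1..k} \<pi>" if "\<pi> \<in> interval_partitions k" for k \<pi>
    using that by (simp only: interval_partitions_def mem_Collect_eq)
  let ?\<pi> = "pconcat (m - r) (one_block (m - r)) \<tau>"
  note \<tau>_int = D_interval[OF r1(1) \<tau>] and \<tau>'_int = D_interval[OF r1(2) \<tau>']
  have pi: "?\<pi> \<in> interval_partitions m"
    using interval_partitions_pconcat[OF interval_partitions_one_block[OF r1(3)] \<tau>_int] unfolding m .
  have lower: "pconcat (m - r) \<tau>' \<tau> \<in> D m"
    using D_pconcat[OF r1(2,1) \<tau>' \<tau>] unfolding m .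
  have lower_le: "refines {1..m} (pconcat (m - r) \<tau>' \<tau>) ?\<pi>"
    using refines_pconcat[OF refines_to_one_block[OF part[OF \<tau>'_int] r1(3)] refines_refl[OF part[OF \<tau>_int]]]
    unfolding m .
  have "refines {1..m} ?\<pi> (one_block m)"
    by (rule refines_to_one_block[OF part[OF pi]]) (use r1(4) in simp)
  then have "?\<pi> \<in> D m"
    by (rule D_between[OF r1(4) lower one_block_mem[OF *(2)] pi lower_le])
  moreover have "{1..m - r} \<in> ?\<pi>" unfolding pconcat_def one_block_def by (intro UnI1 singletonI)
  ultimately have "one_block (card {1..m - r}) \<in> D (card {1..m - r})"
    by (rule D_blocks[OF r1(4)])
  then show "m - r \<in> L" using r1(2) by (simp add: block_lengths_def)
qed

lemma part_span_eq_comp_span: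
  assumes "1 \<le> k"
  shows "(pm.span (part_vec k ` D k) :: ('n::finite list \<Rightarrow>\<^sub>0 complex) set) = comp_span L k"
proof -
  have "(part_vec k ` D k :: ('n list \<Rightarrow>\<^sub>0 complex) set) = comp_vec ` comps L k"
  proof (intro equalityI subsetI)
    fix x assume "x \<in> part_vec k ` D k"
    then obtain \<pi> where "\<pi> \<in> D k" and x: "x = part_vec k \<pi>" by blast
    obtain c where c: "c \<in> comps L k" "\<pi> = comp_part c" by (rule D_comp_part[OF assms \<open>\<pi> \<in> D k\<close>])
    have "0 \<notin> set c" "sum_list c = k" using c(1) L_pos by (auto simp: comps_def)
    then have "x = comp_vec c" unfolding x c(2) by (metis part_vec_comp_part)
    then show "x \<in> comp_vec ` comps L k" using c by blast
  next
    fix x assume "x \<in> comp_vec ` comps L k"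
    then obtain c where c: "c \<in> comps L k" and x: "x = comp_vec c" by blast
    have "c \<noteq> []" using c assms by (auto simp: comps_def)
    then have "comp_part c \<in> D k" using comp_part_mem c by (auto simp: comps_def)
    moreover have "0 \<notin> set c" "sum_list c = k" using c(1) L_pos by (auto simp: comps_def)
    then have "x = part_vec k (comp_part c)" unfolding x by (metis part_vec_comp_part)
    ultimately show "x \<in> part_vec k ` D k" by blast
  qed
  then show ?thesis by (simp add: comp_span_def)
qed

lemma proj_entry_eq_entry:
  assumes "1 \<le> k" "length j = k"
  shows "proj_entry D k i j = entry L i j"
  using assms
  by (simp add: proj_entry_def entry_def proj_def part_span_def part_span_eq_comp_span inner_prod_def)

end

section \<open>The ideal of relations\<close>

definition delta :: "'n list \<Rightarrow> 'n falg" where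
  "delta s = (if is_const s then pgen else 0)"

definition col_sum :: "'n::finite list \<Rightarrow> 'n falg" where
  "col_sum s = (\<Sum>i\<in>UNIV. uprod (replicate (length s) i) s)"

definition row_sum :: "'n::finite list \<Rightarrow> 'n falg" where
  "row_sum s = (\<Sum>j\<in>UNIV. uprod s (replicate (length s) j))"

lemma uprod_single: "uprod i j = sg (map2 U i j) 1"
  by (induction i j rule: list_induct2') (simp_all add: uprod_def ugen_def sg_mult list_one)

lemma uprod_Nil: "uprod [] [] = 1"
  by (simp add: uprod_def)

lemma pgen_single: "pgen = sg [P] 1"
  by (simp add: pgen_def)

lemma uprod_append: "length i = length j \<Longrightarrow> uprod (i @ i') (j @ j') = uprod i j * uprod i' j'"
  by (simp add: uprod_single sg_mult)

lemma map2_rev: "length i = length j \<Longrightarrow> rev (map2 f i j) = map2 f (rev i) (rev j)"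
  by (simp add: rev_map zip_rev)

lemma lookup_star: "coef (star x) w = cnj (coef x (rev w))"
proof -
  have "coef (star x) w = (\<Sum>v\<in>Poly_Mapping.keys x. if v = rev w then cnj (coef x v) else 0)"
    unfolding star_def lookup_sum by (intro sum.cong refl) (auto simp: lookup_sg)
  then show ?thesis by (simp add: sum.delta in_keys_iff)
qed

lemma star_single: "star (sg w c) = sg (rev w) (cnj c)"
  and star_add: "star (x + y) = star x + star y"
  and star_diff: "star (x - y) = star x - star y"
  and star_zero: "star 0 = 0"
  by (rule poly_mapping_eqI, auto simp: lookup_star lookup_sg lookup_add lookup_minus)+

lemma star_sum: "star (\<Sum>i\<in>S. x i) = (\<Sum>i\<in>S. star (x i))"
  by (induction S rule: infinite_finite_induct) (auto simp: star_zero star_add)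

lemma star_mult: "star (x * y) = star y * star x"
proof (induction x rule: poly_mapping_induct)
  case (single w d)
  show ?case
    by (induction y rule: poly_mapping_induct)
      (simp_all add: sg_mult star_single star_add distrib_left distrib_right mult.commute)
qed (simp add: distrib_left distrib_right star_add)

lemma star_pgen: "star pgen = pgen"
  by (simp add: pgen_single star_single)

lemma star_uprod: "length i = length j \<Longrightarrow> star (uprod i j) = uprod (rev i) (rev j)"
  by (simp add: uprod_single star_single map2_rev)

lemma star_col_sum: "star (col_sum s) = col_sum (rev s)"
  by (simp add: col_sum_def star_sum star_uprod)

lemma star_row_sum: "star (row_sum s) = row_sum (rev s)"
  by (simp add: row_sum_def star_sum star_uprod)

lemma star_delta: "star (delta s) = delta (rev s)"
  using is_const_rev[of s] by (simp add: delta_def star_pgen star_zero)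

text \<open>
  The relators together with their adjoints. All but the first have the form \<open>a * s * b - delta\<close> with \<open>a\<close> and \<open>b\<close> among
  \<open>1\<close> and \<open>p\<close>, which are both group-like; this is why the factors \<open>1\<close> are written out.
\<close>
inductive relation :: "(nat \<Rightarrow> partition set) \<Rightarrow> 'n::finite falg \<Rightarrow> bool" for D where
  proj: "relation D (pgen * pgen - pgen)"
| col: "length s \<in> block_lengths D \<Longrightarrow> relation D (1 * col_sum s * pgen - delta s)"
| row: "length s \<in> block_lengths D \<Longrightarrow> relation D (1 * row_sum s * pgen - delta s)"
| col_star: "length s \<in> block_lengths D \<Longrightarrow> relation D (pgen * col_sum s * 1 - delta s)"
| row_star: "length s \<in> block_lengths D \<Longrightarrow> relation D (pgen * row_sum s * 1 - delta s)"

lemma relators_cases: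
  "relators D = {pgen * pgen - pgen} \<union> {col_sum s * pgen - delta s | s. length s \<in> block_lengths D}
     \<union> {row_sum s * pgen - delta s | s. length s \<in> block_lengths D}"
  unfolding relators_def col_sum_def row_sum_def delta_def is_const_def
  by (intro arg_cong2[where f = "(\<union>)"] refl) (intro Collect_cong; metis)+

lemma relators_star_eq: "relators D \<union> star ` relators D = Collect (relation D)"
proof (intro equalityI subsetI)
  fix r :: "'a falg" assume "r \<in> relators D \<union> star ` relators D"
  then obtain r' where "r' \<in> relators D" and r: "r = r' \<or> r = star r'" by (elim UnE imageE) simp_all
  then consider "r' = pgen * pgen - pgen"
    | s where "length s \<in> block_lengths D" "r' = col_sum s * pgen - delta s"
    | s where "length s \<in> block_lengths D" "r' = row_sum s * pgen - delta s"
    unfolding relators_cases by (elim UnE CollectE exE conjE singletonE) simp_all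
  then have "relation D r' \<and> relation D (star r')"
  proof cases
    case 1
    then show ?thesis using relation.proj[of D] by (simp add: star_diff star_mult star_pgen)
  next
    case 2
    then show ?thesis using relation.col[of s D] relation.col_star[of "rev s" D]
      by (simp add: star_diff star_mult star_pgen star_col_sum star_delta)
  next
    case 3
    then show ?thesis using relation.row[of s D] relation.row_star[of "rev s" D]
      by (simp add: star_diff star_mult star_pgen star_row_sum star_delta)
  qed
  then show "r \<in> Collect (relation D)" using r by (elim disjE) simp_all
next
  fix r :: "'a falg" assume "r \<in> Collect (relation D)"
  then have "relation D r" by simp
  then show "r \<in> relators D \<union> star ` relators D"
  proof cases
    case proj
    then show ?thesis by (simp add: relators_cases)
  next
    case (col s)
    then show ?thesis by (intro UnI1) (auto simp: relators_cases)
  next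
    case (row s)
    then show ?thesis by (intro UnI1) (auto simp: relators_cases)
  next
    case (col_star s)
    then have "r = star (col_sum (rev s) * pgen - delta (rev s))"
      by (simp add: star_diff star_mult star_pgen star_col_sum star_delta)
    moreover have "col_sum (rev s) * pgen - delta (rev s) \<in> relators D"
      unfolding relators_cases by (intro UnI1 UnI2 CollectI exI[of _ "rev s"]) (simp add: col_star)
    ultimately show ?thesis by (intro UnI2) (rule image_eqI)
  next
    case (row_star s)
    then have "r = star (row_sum (rev s) * pgen - delta (rev s))"
      by (simp add: star_diff star_mult star_pgen star_row_sum star_delta)
    moreover have "row_sum (rev s) * pgen - delta (rev s) \<in> relators D"
      unfolding relators_cases by (intro UnI2 CollectI exI[of _ "rev s"]) (simp add: row_star)
    ultimately show ?thesis by (intro UnI2) (rule image_eqI)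
  qed
qed

lemma rel_ideal_eq: "rel_ideal D = pm.span {x * r * y | x r y. relation D r}"
  unfolding rel_ideal_def relators_star_eq by simp

lemma rel_ideal_0 [simp]: "0 \<in> rel_ideal D"
  and rel_ideal_add: "x \<in> rel_ideal D \<Longrightarrow> y \<in> rel_ideal D \<Longrightarrow> x + y \<in> rel_ideal D"
  and rel_ideal_scale: "x \<in> rel_ideal D \<Longrightarrow> scale c x \<in> rel_ideal D"
  by (simp_all add: rel_ideal_def pm.span_zero pm.span_add pm.span_scale)

lemma rel_ideal_relation: "relation D r \<Longrightarrow> r \<in> rel_ideal D"
proof -
  assume "relation D r"
  then have "1 * r * 1 \<in> pm.span {x * r * y | x r y. relation D r}"
    by (blast intro: pm.span_base)
  then show ?thesis by (simp add: rel_ideal_eq)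
qed

lemma rel_ideal_mult: 
  assumes "x \<in> rel_ideal D"
  shows "a * x * b \<in> rel_ideal D"
  using assms unfolding rel_ideal_eq
proof (induction rule: pm.span_induct_alt)
  case (step c z y)
  then obtain x r y' where z: "z = x * r * y'" "relation D r" by (elim CollectE exE conjE)
  have "(a * x) * r * (y' * b) \<in> pm.span {x * r * y | x r y. relation D r}"
    using z(2) by (intro pm.span_base CollectI exI conjI) auto
  then have "a * z * b \<in> pm.span {x * r * y | x r y. relation D r}" by (simp add: z(1) mult.assoc)
  then show ?case using step
    by (simp add: distrib_left distrib_right scale_mult_left scale_mult_right pm.span_add pm.span_scale)
qed (simp add: pm.span_zero)

lemma rel_ideal_mult_left: "x \<in> rel_ideal D \<Longrightarrow> a * x \<in> rel_ideal D"
  using rel_ideal_mult[of x D a 1] by simp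

lemma rel_ideal_mult_right: "x \<in> rel_ideal D \<Longrightarrow> x * b \<in> rel_ideal D"
  using rel_ideal_mult[of x D 1 b] by simp

lemma lookup_mult_Nil: "coef (x * y) [] = coef x [] * coef y []"
proof (induction x rule: poly_mapping_induct)
  case (single w d)
  show ?case by (induction y rule: poly_mapping_induct) (auto simp: sg_mult lookup_sg lookup_add distrib_left)
qed (simp add: lookup_add distrib_right)

lemma free_alg_iff: "x \<in> free_alg \<longleftrightarrow> coef x [] = 0"
  by (simp add: free_alg_def in_keys_iff)

lemma lookup_pgen_Nil [simp]: "coef pgen [] = 0"
  by (simp add: pgen_single lookup_sg)

lemma relation_free_alg: 
  assumes "relation D r"
  shows "coef r [] = 0"
proof -
  have "coef (delta s) [] = 0" for s :: "'a list" by (simp add: delta_def)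
  with assms show ?thesis by cases (simp_all add: lookup_minus lookup_mult_Nil)
qed

lemma rel_ideal_free_alg: "rel_ideal D \<subseteq> free_alg"
proof
  fix x :: "'a falg" assume "x \<in> rel_ideal D"
  then have "coef x [] = 0" unfolding rel_ideal_eq
    by (induction rule: pm.span_induct_alt)
      (auto simp: lookup_add lookup_mult_Nil relation_free_alg)
  then show "x \<in> free_alg" by (simp add: free_alg_iff)
qed

definition eqv :: "(nat \<Rightarrow> partition set) \<Rightarrow> 'n::finite falg \<Rightarrow> 'n falg \<Rightarrow> bool" where
  "eqv D x y \<longleftrightarrow> x - y \<in> rel_ideal D"

lemma eqv_refl [simp]: "eqv D x x"
  by (simp add: eqv_def)

lemma eqv_sym: "eqv D x y \<Longrightarrow> eqv D y x"
  using rel_ideal_scale[of "x - y" D "-1"] by (simp add: eqv_def)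

lemma eqv_trans [trans]: "eqv D x y \<Longrightarrow> eqv D y z \<Longrightarrow> eqv D x z"
  using rel_ideal_add[of "x - y" D "y - z"] by (simp add: eqv_def)

lemma eqv_add: "eqv D x y \<Longrightarrow> eqv D x' y' \<Longrightarrow> eqv D (x + x') (y + y')"
  using rel_ideal_add[of "x - y" D "x' - y'"] by (simp add: eqv_def algebra_simps)

lemma eqv_scale: "eqv D x y \<Longrightarrow> eqv D (scale c x) (scale c y)"
  using rel_ideal_scale[of "x - y" D c] by (simp add: eqv_def pm.scale_right_diff_distrib)

lemma eqv_mult: "eqv D x y \<Longrightarrow> eqv D x' y' \<Longrightarrow> eqv D (x * x') (y * y')"
proof -
  assume "eqv D x y" "eqv D x' y'"
  then have "(x - y) * x' + y * (x' - y') \<in> rel_ideal D"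
    by (intro rel_ideal_add rel_ideal_mult_left rel_ideal_mult_right) (simp_all add: eqv_def)
  then show ?thesis by (simp add: eqv_def algebra_simps)
qed

lemma eqv_pgen: "eqv D (pgen * pgen) pgen"
  unfolding eqv_def by (intro rel_ideal_relation relation.proj)

lemma eqv_scale_pgen_mult: "eqv D x (scale c pgen) \<Longrightarrow> eqv D (pgen * x) (scale c pgen)"
proof -
  assume "eqv D x (scale c pgen)"
  then have "eqv D (pgen * x) (pgen * scale c pgen)" by (intro eqv_mult eqv_refl)
  also have "pgen * scale c pgen = scale c (pgen * pgen)" by (simp add: scale_mult_right)
  also have "eqv D (scale c (pgen * pgen)) (scale c pgen)" by (intro eqv_scale eqv_pgen)
  finally show ?thesis .
qed

lemma eqv_col: "length s \<in> block_lengths D \<Longrightarrow> eqv D (col_sum s * pgen) (delta s)"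
  using rel_ideal_relation[OF relation.col, of s D] by (simp add: eqv_def)

lemma eqv_row: "length s \<in> block_lengths D \<Longrightarrow> eqv D (row_sum s * pgen) (delta s)"
  using rel_ideal_relation[OF relation.row, of s D] by (simp add: eqv_def)

text \<open>
  Summing \<open>q i j\<close> against the vector of a partition splits into one sum per block, and the relation for
  the last block turns \<open>p\<close> into a multiple of \<open>p\<close>, so that the relation for the block before it applies.
  The function \<open>q\<close> is \<open>uprod\<close> or its transpose, so that the lemma serves both families of relations.
\<close>
lemma eqv_lext_comp_span:
  fixes q :: "'n::finite list \<Rightarrow> 'n list \<Rightarrow> 'n falg"
  assumes app: "\<And>i j i' j'. length i = length j \<Longrightarrow> q (i @ i') (j @ j') = q i j * q i' j'"
    and Nil: "q [] [] = 1"
    and sums: "\<And>i. length i \<in> block_lengths D \<Longrightarrow>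
      eqv D ((\<Sum>a\<in>UNIV. q i (replicate (length i) a)) * pgen) (delta i)"
    and v: "v \<in> comp_span (block_lengths D) k" and i: "length i = k"
  shows "eqv D (lext (q i) v * pgen) (scale (coef v i) pgen)"
proof -
  have comp: "eqv D (lext (q i) (comp_vec c) * pgen) (scale (coef (comp_vec c) i) pgen)"
    if "set c \<subseteq> block_lengths D" "length i = sum_list c" for c i
    using that
  proof (induction c arbitrary: i)
    case Nil
    have "lext (q []) 1 = q [] []" "coef (1 :: 'n list \<Rightarrow>\<^sub>0 complex) [] = 1" by (simp_all add: list_one)
    then show ?case using Nil assms(2) by simp
  next
    case (Cons m c)
    define a b where "a = take m i" and "b = drop m i"
    have i: "i = a @ b" and a: "length a = m" and b: "length b = sum_list c"
      using Cons.prems by (auto simp: a_def b_def)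
    have m: "length a \<in> block_lengths D" using Cons.prems a by simp
    then have "a \<noteq> []" by (auto simp: block_lengths_def)
    have split: "lext (q (a @ b)) (const_sum m * x) = (\<Sum>j\<in>UNIV. q a (replicate m j)) * lext (q b) x" for x
    proof (induction x rule: poly_mapping_induct)
      case (single w d)
      show ?case
        using a by (simp add: const_sum_def sum_distrib_right sg_mult lext_sum app scale_mult_right pm.scale_sum_right)
    qed (simp add: distrib_left)
    have "eqv D ((\<Sum>j\<in>UNIV. q a (replicate m j)) * (lext (q b) (comp_vec c) * pgen))
        ((\<Sum>j\<in>UNIV. q a (replicate m j)) * scale (coef (comp_vec c) b) pgen)"
      using Cons.IH[of b] Cons.prems b by (intro eqv_mult eqv_refl) simp
    also have "(\<Sum>j\<in>UNIV. q a (replicate m j)) * scale (coef (comp_vec c) b) pgen =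
        scale (coef (comp_vec c) b) ((\<Sum>j\<in>UNIV. q a (replicate m j)) * pgen)"
      by (rule scale_mult_right)
    also have "eqv D \<dots> (scale (coef (comp_vec c) b) (delta a))"
      using sums[OF m] unfolding a by (rule eqv_scale)
    also have "scale (coef (comp_vec c) b) (delta a) = scale (coef (comp_vec (m # c)) i) pgen"
      using lookup_mult_const_left[OF \<open>a \<noteq> []\<close>, of "comp_vec c" b] by (simp add: delta_def a i)
    finally show ?case by (simp add: i split mult.assoc)
  qed
  show ?thesis using v unfolding comp_span_def
  proof (induction rule: pm.span_induct_alt)
    case (step r x y)
    then obtain c where c: "c \<in> comps (block_lengths D) k" "x = comp_vec c" by (elim imageE)
    have "eqv D (scale r (lext (q i) x * pgen) + lext (q i) y * pgen) (scale r (scale (coef x i) pgen) + scale (coef y i) pgen)"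
      unfolding c(2) using c(1) i step(2) by (intro eqv_add eqv_scale comp) (auto simp: comps_def)
    then show ?case by (simp add: lookup_add distrib_right scale_mult_left pm.scale_left_distrib)
  qed simp
qed

lemma eqv_lext_uprod:
  assumes "v \<in> comp_span (block_lengths D) k" "length i = k"
  shows "eqv D (lext (uprod i) v * pgen) (scale (coef v i) pgen)"
  by (rule eqv_lext_comp_span[OF _ _ _ assms])
    (simp_all add: uprod_append uprod_Nil eqv_row[unfolded row_sum_def])

lemma eqv_lext_uprod_transpose:
  assumes "v \<in> comp_span (block_lengths D) k" "length i = k"
  shows "eqv D (lext (\<lambda>j. uprod j i) v * pgen) (scale (coef v i) pgen)"
  by (rule eqv_lext_comp_span[of "\<lambda>i j. uprod j i", OF _ _ _ assms])
    (simp_all add: uprod_append uprod_Nil eqv_col[unfolded col_sum_def])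

section \<open>The functional on words\<close>

text \<open>
  The lists \<open>a\<close> and \<open>b\<close> collect the row and column indices of the segment that is being read; the
  letter \<open>P\<close> closes it.
\<close>
fun segment_product :: "('n list \<Rightarrow> 'n list \<Rightarrow> complex) \<Rightarrow> 'n list \<Rightarrow> 'n list \<Rightarrow> 'n gen list \<Rightarrow> complex" where
  "segment_product H a b [] = H a b"
| "segment_product H a b (U i j # w) = segment_product H (a @ [i]) (b @ [j]) w"
| "segment_product H a b (P # w) = H a b * segment_product H [] [] w"

lemma segment_product_P: "segment_product H a b (x @ P # y) = segment_product H a b x * segment_product H [] [] y"
  by (induction H a b x rule: segment_product.induct) simp_all

lemma segment_product_U: "length i = length j \<Longrightarrow> segment_product H a b (map2 U i j @ w) = segment_product H (a @ i) (b @ j) w"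
  by (induction i j arbitrary: a b rule: list_induct2) simp_all

lemma word_split_last:
  obtains i j where "length i = length j" "w = map2 U i j"
  | i j x where "length i = length j" "w = x @ P # map2 U i j"
proof -
  have "(\<exists>i j. length i = length j \<and> w = map2 U i j) \<or> (\<exists>i j x. length i = length j \<and> w = x @ P # map2 U i j)"
  proof (induction w)
    case (Cons g w)
    show ?case
      using Cons
    proof (elim disjE exE conjE)
      fix i j :: "'a list" assume ij: "length i = length j" "w = map2 U i j"
      show ?thesis
      proof (cases g)
        case (U a b)
        then have "g # w = map2 U (a # i) (b # j)" "length (a # i) = length (b # j)" using ij by simp_all
        then show ?thesis by metis
      next
        case P
        then have "g # w = [] @ P # map2 U i j" using ij by simp
        then show ?thesis using ij(1) by metis
      qed
    next
      fix i j x assume ij: "length i = length j" "w = x @ P # map2 U i j"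
      then have "g # w = (g # x) @ P # map2 U i j" by simp
      then show ?thesis using ij(1) by metis
    qed
  qed (intro disjI1 exI[of _ "[]"]; simp)
  then show ?thesis using that by metis
qed

lemma word_split_first:
  obtains i j where "length i = length j" "w = map2 U i j"
  | i j x where "length i = length j" "w = map2 U i j @ P # x"
proof -
  have "(\<exists>i j. length i = length j \<and> w = map2 U i j) \<or> (\<exists>i j x. length i = length j \<and> w = map2 U i j @ P # x)"
  proof (induction w)
    case (Cons g w)
    show ?case
    proof (cases g)
      case (U a b)
      show ?thesis
        using Cons
      proof (elim disjE exE conjE)
        fix i j :: "'a list" assume ij: "length i = length j" "w = map2 U i j"
        then have "g # w = map2 U (a # i) (b # j)" "length (a # i) = length (b # j)" using U by simp_all
        then show ?thesis by metis
      next
        fix i j x assume ij: "length i = length j" "w = map2 U i j @ P # x"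
        then have "g # w = map2 U (a # i) (b # j) @ P # x" "length (a # i) = length (b # j)" using U by simp_all
        then show ?thesis by metis
      qed
    next
      case P
      then have "g # w = map2 U [] [] @ P # w" "length [] = length []" by simp_all
      then show ?thesis by metis
    qed
  qed (intro disjI1 exI[of _ "[]"]; simp)
  then show ?thesis using that by metis
qed

context blockwise_category
begin

text \<open>
  The value at the empty segment is \<open>1\<close>, since the projection on words of length \<open>0\<close> is the identity.
\<close>
definition phi :: "'n::finite gen list \<Rightarrow> complex" where
  "phi w = segment_product (entry L) [] [] w"

lemma phi_P: "phi (x @ P # y) = phi x * phi y"
  by (simp add: phi_def segment_product_P)

lemma phi_P_append: "phi (x @ z @ P # y) = phi (x @ z) * phi y"
  using phi_P[of "x @ z" y] by simp

lemma phi_Nil [simp]: "phi [] = 1"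
  by (simp add: phi_def L_pos)

lemma phi_P_left [simp]: "phi (P # y) = phi y" 
  using phi_P[of "[]" y] by simp

lemma phi_P_right [simp]: "phi (x @ [P]) = phi x"
  using phi_P[of x "[]"] by simp

lemma phi_U: "length i = length j \<Longrightarrow> phi (map2 U i j) = entry L i j"
  using segment_product_U[of i j "entry L" "[]" "[]" "[]"] by (simp add: phi_def)

text \<open>
  A segment appended to \<open>x\<close> extends the last segment of \<open>x\<close>, so only the factor of \<open>phi\<close> that belongs
  to this segment is affected by the summation.
\<close>
lemma phi_sum_right:
  assumes "\<And>i. length (p i) = length (q i)"
    and "\<And>a b. length a = length b \<Longrightarrow> (\<Sum>i\<in>S. entry L (a @ p i) (b @ q i)) = c * entry L a b"
  shows "(\<Sum>i\<in>S. phi (x @ map2 U (p i) (q i))) = c * phi x"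
proof (cases x rule: word_split_last)
  case (1 a b)
  then have "x @ map2 U (p i) (q i) = map2 U (a @ p i) (b @ q i)" for i by simp
  then show ?thesis using assms(2)[OF 1(1)] by (simp only: phi_U 1 assms(1) length_append)
next
  case (2 a b y)
  then have "x @ map2 U (p i) (q i) = y @ P # map2 U (a @ p i) (b @ q i)" for i by simp
  then show ?thesis using assms(2)[OF 2(1)]
    by (simp only: phi_U phi_P 2 assms(1) length_append sum_distrib_left[symmetric]) simp
qed

lemma phi_sum_left:
  assumes "\<And>i. length (p i) = length (q i)"
    and "\<And>a b. length a = length b \<Longrightarrow> (\<Sum>i\<in>S. entry L (p i @ a) (q i @ b)) = c * entry L a b"
  shows "(\<Sum>i\<in>S. phi (map2 U (p i) (q i) @ x)) = c * phi x"
proof (cases x rule: word_split_first)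
  case (1 a b)
  then have "map2 U (p i) (q i) @ x = map2 U (p i @ a) (q i @ b)" for i using assms(1) by simp
  then show ?thesis using assms(2)[OF 1(1)] by (simp only: phi_U 1 assms(1) length_append)
next
  case (2 a b y)
  then have "map2 U (p i) (q i) @ x = map2 U (p i @ a) (q i @ b) @ P # y" for i using assms(1) by simp
  then show ?thesis using assms(2)[OF 2(1)]
    by (simp only: phi_U phi_P 2 assms(1) length_append sum_distrib_right[symmetric]) simp
qed

abbreviation const_indicator :: "'n list \<Rightarrow> complex" where
  "const_indicator s \<equiv> if is_const s then 1 else 0"

lemma phi_col_right: "length s \<in> L \<Longrightarrow> (\<Sum>i\<in>UNIV. phi (x @ map2 U (replicate (length s) i) s)) = const_indicator s * phi x"
  by (rule phi_sum_right) (simp_all add: entry_right_col[OF interval_closed_L])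

lemma phi_row_right: "length s \<in> L \<Longrightarrow> (\<Sum>i\<in>UNIV. phi (x @ map2 U s (replicate (length s) i))) = const_indicator s * phi x"
  by (rule phi_sum_right) (simp_all add: entry_right_row[OF interval_closed_L])

lemma phi_col_left: "length s \<in> L \<Longrightarrow> (\<Sum>i\<in>UNIV. phi (map2 U (replicate (length s) i) s @ x)) = const_indicator s * phi x"
  by (rule phi_sum_left) (simp_all add: entry_left_col[OF interval_closed_L])

lemma phi_row_left: "length s \<in> L \<Longrightarrow> (\<Sum>i\<in>UNIV. phi (map2 U s (replicate (length s) i) @ x)) = const_indicator s * phi x"
  by (rule phi_sum_left) (simp_all add: entry_left_row[OF interval_closed_L])

lemma lin_phi_delta: "lin phi (sg x 1 * delta s * sg y 1) = const_indicator s * (phi x * phi y)"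
  by (simp add: delta_def pgen_single sg_mult phi_P)

text \<open>
  The letter \<open>p\<close> in a relator separates \<open>x\<close> from \<open>y\<close>. What remains is a sum over entries of the projections,
  which the invariance of the projections evaluates.
\<close>
lemma lin_phi_relation:
  assumes "relation D r"
  shows "lin phi (sg x 1 * r * sg y 1) = 0"
  using assms
proof cases
  case proj
  then show ?thesis
    by (simp add: left_diff_distrib right_diff_distrib pgen_single sg_mult phi_P)
next
  case (col s)
  have "lin phi (sg x 1 * (1 * col_sum s * pgen) * sg y 1) = (\<Sum>i\<in>UNIV. phi (x @ map2 U (replicate (length s) i) s)) * phi y"
    by (simp add: col_sum_def sum_distrib_left sum_distrib_right lin_sum uprod_single pgen_single sg_mult phi_P_append)
  then show ?thesis using phi_col_right[OF col(2)]
    by (simp add: col(1) left_diff_distrib right_diff_distrib lin_phi_delta)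
next
  case (row s)
  have "lin phi (sg x 1 * (1 * row_sum s * pgen) * sg y 1) = (\<Sum>i\<in>UNIV. phi (x @ map2 U s (replicate (length s) i))) * phi y"
    by (simp add: row_sum_def sum_distrib_left sum_distrib_right lin_sum uprod_single pgen_single sg_mult phi_P_append)
  then show ?thesis using phi_row_right[OF row(2)]
    by (simp add: row(1) left_diff_distrib right_diff_distrib lin_phi_delta)
next
  case (col_star s)
  have "lin phi (sg x 1 * (pgen * col_sum s * 1) * sg y 1) = phi x * (\<Sum>i\<in>UNIV. phi (map2 U (replicate (length s) i) s @ y))"
    by (simp add: col_sum_def sum_distrib_left sum_distrib_right lin_sum uprod_single pgen_single sg_mult phi_P)
  then show ?thesis using phi_col_left[OF col_star(2)]
    by (simp add: col_star(1) left_diff_distrib right_diff_distrib lin_phi_delta)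
next
  case (row_star s)
  have "lin phi (sg x 1 * (pgen * row_sum s * 1) * sg y 1) = phi x * (\<Sum>i\<in>UNIV. phi (map2 U s (replicate (length s) i) @ y))"
    by (simp add: row_sum_def sum_distrib_left sum_distrib_right lin_sum uprod_single pgen_single sg_mult phi_P)
  then show ?thesis using phi_row_left[OF row_star(2)]
    by (simp add: row_star(1) left_diff_distrib right_diff_distrib lin_phi_delta)
qed

lemma lin_phi_rel_ideal:
  assumes "x \<in> rel_ideal D"
  shows "lin phi x = 0"
proof -
  have "lin phi (a * r * b) = 0" if r: "relation D r" for a r b
  proof (induction a rule: poly_mapping_induct)
    case (single w c)
    show ?case
    proof (induction b rule: poly_mapping_induct)
      case (single v d)
      have "sg w c * r * sg v d = scale c (sg w 1) * r * scale d (sg v 1)" by simp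
      then show ?case
        by (simp only: scale_mult_left scale_mult_right lin_scale lin_phi_relation[OF r] mult_zero_right)
    qed (simp add: distrib_left)
  qed (simp add: distrib_right)
  note relation_zero = this
  show ?thesis
  proof (rule lin_span_zero[OF assms[unfolded rel_ideal_eq]])
    fix y assume "y \<in> {a * r * b | a r b. relation D r}"
    then show "lin phi y = 0" by (elim CollectE exE conjE) (simp only: relation_zero)
  qed
qed

lemma lin_phi_eqv: "eqv D x y \<Longrightarrow> lin phi x = lin phi y"
  using lin_phi_rel_ideal[of "x - y"] by (simp add: eqv_def)

lemma lin_phi_mult_pgen: "lin phi (x * pgen * y) = lin phi x * lin phi y"
proof (induction x rule: poly_mapping_induct)
  case (single w c)
  show ?case
    by (induction y rule: poly_mapping_induct)
      (simp_all add: pgen_single sg_mult phi_P distrib_left)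
qed (simp add: distrib_right)

lemma lin_phi_one [simp]: "lin phi 1 = 1"
  by (simp add: list_one)

lemma lin_phi_compress: "lin phi (pgen * x * pgen) = lin phi x"
  using lin_phi_mult_pgen[of "pgen * x" 1] lin_phi_mult_pgen[of 1 x] by simp

end

section \<open>The coproduct\<close>

lemma sum_lists_Suc:
  fixes f :: "'n::finite list \<Rightarrow> 'b::comm_monoid_add"
  shows "(\<Sum>l | length l = Suc k. f l) = (\<Sum>a\<in>UNIV. \<Sum>l | length l = k. f (a # l))"
proof -
  have "(\<Sum>l | length l = Suc k. f l) = (\<Sum>(a, l)\<in>UNIV \<times> {l. length l = k}. f (a # l))"
    by (rule sum.reindex_bij_witness[of _ "\<lambda>(a, l). a # l" "\<lambda>l. (hd l, tl l)"])
      (auto simp: length_Suc_conv)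
  then show ?thesis by (simp add: sum.cartesian_product)
qed

text \<open>
  The constant words of length \<open>k > 0\<close> correspond to the letters.
\<close>
lemma sum_const_lists:
  fixes f :: "'n::finite list \<Rightarrow> 'b::comm_monoid_add"
  assumes "0 < k"
  shows "(\<Sum>l | length l = k. if is_const l then f l else 0) = (\<Sum>i\<in>UNIV. f (replicate k i))"
proof -
  have "(\<Sum>l | length l = k. if is_const l then f l else 0) = (\<Sum>l\<in>{l. length l = k \<and> is_const l}. f l)"
    using sum.inter_filter[OF finite_lists[of k], of f is_const] by simp
  also have "\<dots> = (\<Sum>i\<in>UNIV. f (replicate k i))"
  proof (rule sum.reindex_bij_witness[of _ "replicate k" hd])
    fix l :: "'n list" assume "l \<in> {l. length l = k \<and> is_const l}"
    then obtain a where "length l = k" "l = replicate k a" unfolding is_const_def by auto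
    then show "replicate k (hd l) = l" "f (replicate k (hd l)) = f l" using assms by simp_all
  qed (use assms in simp_all)
  finally show ?thesis .
qed

lemma free_comult_lext: "free_comult = lext (\<lambda>w. prod_list (map comult_gen w))"
  by (rule ext) (simp add: free_comult_def lext_def)

lemma free_comult_add [simp]: "free_comult (x + y) = free_comult x + free_comult y"
  and free_comult_diff [simp]: "free_comult (x - y) = free_comult x - free_comult y"
  and free_comult_scale [simp]: "free_comult (scale c x) = scale c (free_comult x)"
  and free_comult_zero [simp]: "free_comult 0 = 0"
  and free_comult_single: "free_comult (sg w c) = scale c (prod_list (map comult_gen w))"
  by (simp_all add: free_comult_lext)

lemma free_comult_sum: "free_comult (\<Sum>i\<in>S. x i) = (\<Sum>i\<in>S. free_comult (x i))"
  by (simp add: free_comult_lext lext_sum)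

lemma free_comult_mult: "free_comult (x * y) = free_comult x * free_comult y"
proof (induction x rule: poly_mapping_induct)
  case (single w c)
  show ?case
    by (induction y rule: poly_mapping_induct)
      (simp_all add: sg_mult free_comult_single scale_mult_left scale_mult_right distrib_left mult.commute)
qed (simp add: distrib_right)

lemma tens_one: "tens 1 1 = (1 :: 'n gen list \<times> 'n gen list \<Rightarrow>\<^sub>0 complex)"
  by (simp add: list_one tens_single) (metis single_one zero_list_def zero_prod_def)

lemma free_comult_one: "free_comult 1 = tens 1 1"
  by (simp add: list_one free_comult_single) (simp add: tens_one flip: list_one)

lemma free_comult_pgen: "free_comult pgen = tens pgen pgen"
  by (simp add: pgen_single free_comult_single)

lemma free_comult_uprod:
  fixes i j :: "'n::finite list"
  assumes "length i = length j"
  shows "free_comult (uprod i j) = (\<Sum>l | length l = length i. tens (uprod i l) (uprod l j))"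
  using assms
proof (induction i j rule: list_induct2)
  case Nil
  then show ?case by (simp add: uprod_Nil free_comult_one)
next
  case (Cons a i b j)
  have uc: "uprod (a # i) (b # j) = ugen a b * uprod i j" for a b and i j :: "'n list"
    by (simp add: uprod_def)
  have "free_comult (ugen a b) = (\<Sum>c\<in>UNIV. tens (ugen a c) (ugen c b))"
    by (simp add: ugen_def free_comult_single)
  then show ?case
    by (simp add: uc free_comult_mult Cons.IH sum_lists_Suc sum_product tens_mult)
qed

lemma alg2_null_0 [simp]: "0 \<in> alg2_null D"
  and alg2_null_add: "s \<in> alg2_null D \<Longrightarrow> t \<in> alg2_null D \<Longrightarrow> s + t \<in> alg2_null D"
  and alg2_null_scale: "s \<in> alg2_null D \<Longrightarrow> scale c s \<in> alg2_null D"
  and alg2_null_sum: "(\<And>i. i \<in> S \<Longrightarrow> f i \<in> alg2_null D) \<Longrightarrow> (\<Sum>i\<in>S. f i) \<in> alg2_null D"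
  by (simp_all add: alg2_null_def tensor_null_def pm.span_zero pm.span_add pm.span_scale pm.span_sum)

lemma alg2_null_left: "x \<in> rel_ideal D \<Longrightarrow> y \<in> free_alg \<Longrightarrow> tens x y \<in> alg2_null D"
  and alg2_null_right: "x \<in> free_alg \<Longrightarrow> y \<in> rel_ideal D \<Longrightarrow> tens x y \<in> alg2_null D"
  unfolding alg2_null_def tensor_null_def by (blast intro: pm.span_base)+

lemma alg2_null_induct [consumes 1, case_names zero left right]:
  assumes "t \<in> alg2_null D"
    and "Q 0"
    and "\<And>c x y t. x \<in> rel_ideal D \<Longrightarrow> y \<in> free_alg \<Longrightarrow> Q t \<Longrightarrow> Q (scale c (tens x y) + t)"
    and "\<And>c x y t. x \<in> free_alg \<Longrightarrow> y \<in> rel_ideal D \<Longrightarrow> Q t \<Longrightarrow> Q (scale c (tens x y) + t)"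
  shows "Q t"
  using assms(1) unfolding alg2_null_def tensor_null_def
proof (induction rule: pm.span_induct_alt)
  case base
  then show ?case by (rule assms(2))
next
  case (step c x y)
  then show ?case
    by (elim UnE CollectE exE conjE) (simp_all add: assms(3,4))
qed

lemma free_alg_mult: "x \<in> free_alg \<Longrightarrow> a * x * b \<in> free_alg"
  by (simp add: free_alg_iff lookup_mult_Nil)

text \<open>
  Every basis vector is a product tensor, so multiplication by it acts on the two legs separately.
\<close>
lemma sg_pair: "sg (v, w) c = tens (sg v c) (sg w 1)"
  by (simp add: tens_single)

lemma alg2_null_mult:
  assumes "t \<in> alg2_null D"
  shows "a * t * b \<in> alg2_null D"
proof -
  have elem: "sg (v, w) c * t * sg (v', w') c' \<in> alg2_null D" for v w c v' w' c'
    using assms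
  proof (induction rule: alg2_null_induct)
    case zero
    then show ?case by simp
  next
    case (left d x y t)
    have "sg (v, w) c * tens x y * sg (v', w') c' = tens (sg v c * x * sg v' c') (sg w 1 * y * sg w' 1)"
      unfolding sg_pair[of v w c] sg_pair[of v' w' c'] by (simp only: tens_mult)
    moreover have "tens (sg v c * x * sg v' c') (sg w 1 * y * sg w' 1) \<in> alg2_null D"
      using left by (intro alg2_null_left rel_ideal_mult free_alg_mult)
    ultimately show ?case using left(3)
      by (simp add: distrib_left distrib_right scale_mult_left scale_mult_right alg2_null_add alg2_null_scale)
  next
    case (right d x y t)
    have "sg (v, w) c * tens x y * sg (v', w') c' = tens (sg v c * x * sg v' c') (sg w 1 * y * sg w' 1)"
      unfolding sg_pair[of v w c] sg_pair[of v' w' c'] by (simp only: tens_mult)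
    moreover have "tens (sg v c * x * sg v' c') (sg w 1 * y * sg w' 1) \<in> alg2_null D"
      using right by (intro alg2_null_right rel_ideal_mult free_alg_mult)
    ultimately show ?case using right(3)
      by (simp add: distrib_left distrib_right scale_mult_left scale_mult_right alg2_null_add alg2_null_scale)
  qed
  show ?thesis
  proof (induction a rule: poly_mapping_induct)
    case (single w c)
    show ?case
    proof (induction b rule: poly_mapping_induct)
      case (single w' c')
      show ?case using elem[of "fst w" "snd w" c "fst w'" "snd w'" c'] by simp
    qed (simp add: distrib_left alg2_null_add)
  qed (simp add: distrib_right alg2_null_add)
qed

lemma uprod_free_alg: "i \<noteq> [] \<Longrightarrow> j \<noteq> [] \<Longrightarrow> uprod i j \<in> free_alg"
  by (cases i; cases j) (simp_all add: free_alg_iff uprod_single lookup_sg)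

text \<open>
  Modulo the null space, the relation in the left leg turns the coproduct
  \<open>\<Sum>\<^sub>l (a * col_sum l * b) \<otimes> (a * uprod l s * b)\<close> into the sum over constant \<open>l\<close>, which is
  \<open>p \<otimes> (a * col_sum s * b)\<close>; then the relation is used once more in the right leg.
\<close>
lemma free_comult_col_sum:
  fixes s :: "'n::finite list"
  assumes a: "free_comult a = tens a a" and b: "free_comult b = tens b b"
    and k: "length s = k" "0 < k"
    and rel: "\<And>s. length s = k \<Longrightarrow> a * col_sum s * b - delta s \<in> rel_ideal D"
  shows "free_comult (a * col_sum s * b - delta s) \<in> alg2_null D"
proof -
  let ?W = "{l :: 'n list. length l = k}"
  have "free_comult (col_sum s) = (\<Sum>i\<in>UNIV. \<Sum>l\<in>?W. tens (uprod (replicate k i) l) (uprod l s))"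
    by (simp add: col_sum_def free_comult_sum free_comult_uprod k)
  also have "\<dots> = (\<Sum>l\<in>?W. tens (col_sum l) (uprod l s))"
    by (subst sum.swap) (simp add: col_sum_def tens_sum_left)
  finally have D1: "free_comult (a * col_sum s * b) = (\<Sum>l\<in>?W. tens (a * col_sum l * b) (a * uprod l s * b))"
    by (simp add: free_comult_mult a b sum_distrib_left sum_distrib_right tens_mult)
  have "(\<Sum>l\<in>?W. tens (delta l) (a * uprod l s * b)) = (\<Sum>l\<in>?W. if is_const l then tens pgen (a * uprod l s * b) else 0)"
    by (rule sum.cong) (simp_all add: delta_def)
  also have "\<dots> = (\<Sum>i\<in>UNIV. tens pgen (a * uprod (replicate k i) s * b))"
    by (rule sum_const_lists[OF k(2)])
  also have "\<dots> = tens pgen (a * col_sum s * b)"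
    by (simp add: col_sum_def k tens_sum_right sum_distrib_left sum_distrib_right)
  finally have D2: "(\<Sum>l\<in>?W. tens (delta l) (a * uprod l s * b)) = tens pgen (a * col_sum s * b)" .
  have D3: "free_comult (delta s) = tens pgen (delta s)"
    by (simp add: delta_def free_comult_pgen)
  have eq: "free_comult (a * col_sum s * b - delta s) =
      (\<Sum>l\<in>?W. tens (a * col_sum l * b - delta l) (a * uprod l s * b)) + tens pgen (a * col_sum s * b - delta s)"
    by (simp add: D1 D3 tens_diff_left tens_diff_right sum_subtractf D2)
  have m1: "tens (a * col_sum l * b - delta l) (a * uprod l s * b) \<in> alg2_null D" if "l \<in> ?W" for l
    using that k by (intro alg2_null_left free_alg_mult uprod_free_alg rel) auto
  have m2: "tens pgen (a * col_sum s * b - delta s) \<in> alg2_null D"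
    by (intro alg2_null_right rel k) (simp add: free_alg_iff)
  show ?thesis unfolding eq by (intro alg2_null_add alg2_null_sum m1 m2)
qed

lemma free_comult_row_sum:
  fixes s :: "'n::finite list"
  assumes a: "free_comult a = tens a a" and b: "free_comult b = tens b b"
    and k: "length s = k" "0 < k"
    and rel: "\<And>s. length s = k \<Longrightarrow> a * row_sum s * b - delta s \<in> rel_ideal D"
  shows "free_comult (a * row_sum s * b - delta s) \<in> alg2_null D"
proof -
  let ?W = "{l :: 'n list. length l = k}"
  have "free_comult (row_sum s) = (\<Sum>i\<in>UNIV. \<Sum>l\<in>?W. tens (uprod s l) (uprod l (replicate k i)))"
    by (simp add: row_sum_def free_comult_sum free_comult_uprod k)
  also have "\<dots> = (\<Sum>l\<in>?W. tens (uprod s l) (row_sum l))"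
    by (subst sum.swap) (simp add: row_sum_def tens_sum_right)
  finally have D1: "free_comult (a * row_sum s * b) = (\<Sum>l\<in>?W. tens (a * uprod s l * b) (a * row_sum l * b))"
    by (simp add: free_comult_mult a b sum_distrib_left sum_distrib_right tens_mult)
  have "(\<Sum>l\<in>?W. tens (a * uprod s l * b) (delta l)) = (\<Sum>l\<in>?W. if is_const l then tens (a * uprod s l * b) pgen else 0)"
    by (rule sum.cong) (simp_all add: delta_def)
  also have "\<dots> = (\<Sum>i\<in>UNIV. tens (a * uprod s (replicate k i) * b) pgen)"
    by (rule sum_const_lists[OF k(2)])
  also have "\<dots> = tens (a * row_sum s * b) pgen"
    by (simp add: row_sum_def k tens_sum_left sum_distrib_left sum_distrib_right)
  finally have D2: "(\<Sum>l\<in>?W. tens (a * uprod s l * b) (delta l)) = tens (a * row_sum s * b) pgen" .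
  have D3: "free_comult (delta s) = tens (delta s) pgen"
    by (simp add: delta_def free_comult_pgen)
  have eq: "free_comult (a * row_sum s * b - delta s) =
      (\<Sum>l\<in>?W. tens (a * uprod s l * b) (a * row_sum l * b - delta l)) + tens (a * row_sum s * b - delta s) pgen"
    by (simp add: D1 D3 tens_diff_left tens_diff_right sum_subtractf D2)
  have m1: "tens (a * uprod s l * b) (a * row_sum l * b - delta l) \<in> alg2_null D" if "l \<in> ?W" for l
    using that k by (intro alg2_null_right free_alg_mult uprod_free_alg rel) auto
  have m2: "tens (a * row_sum s * b - delta s) pgen \<in> alg2_null D"
    by (intro alg2_null_left rel k) (simp add: free_alg_iff)
  show ?thesis unfolding eq by (intro alg2_null_add alg2_null_sum m1 m2)
qed

lemma free_comult_relation:
  assumes "relation D r"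
  shows "free_comult r \<in> alg2_null D"
  using assms
proof cases
  case proj
  have "free_comult r = tens (pgen * pgen - pgen) (pgen * pgen) + tens pgen (pgen * pgen - pgen)"
    by (simp add: proj free_comult_mult free_comult_pgen tens_mult tens_diff_left tens_diff_right)
  then show ?thesis
    by (simp only:) (intro alg2_null_add alg2_null_left alg2_null_right rel_ideal_relation relation.proj;
      simp add: free_alg_iff lookup_mult_Nil)
next
  case (col s)
  then show ?thesis unfolding col(1)
    by (intro free_comult_col_sum[OF free_comult_one free_comult_pgen refl] rel_ideal_relation relation.col)
      (auto simp: block_lengths_def)
next
  case (row s)
  then show ?thesis unfolding row(1)
    by (intro free_comult_row_sum[OF free_comult_one free_comult_pgen refl] rel_ideal_relation relation.row)
      (auto simp: block_lengths_def)
next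
  case (col_star s)
  then show ?thesis unfolding col_star(1)
    by (intro free_comult_col_sum[OF free_comult_pgen free_comult_one refl] rel_ideal_relation relation.col_star)
      (auto simp: block_lengths_def)
next
  case (row_star s)
  then show ?thesis unfolding row_star(1)
    by (intro free_comult_row_sum[OF free_comult_pgen free_comult_one refl] rel_ideal_relation relation.row_star)
      (auto simp: block_lengths_def)
qed

lemma free_comult_rel_ideal:
  assumes "x \<in> rel_ideal D"
  shows "free_comult x \<in> alg2_null D"
  using assms unfolding rel_ideal_eq
proof (induction rule: pm.span_induct_alt)
  case (step c z y)
  then obtain a r b where z: "z = a * r * b" "relation D r" by (elim CollectE exE conjE)
  have "free_comult z \<in> alg2_null D"
    unfolding z(1) free_comult_mult by (intro alg2_null_mult free_comult_relation z(2))
  then show ?case using step(2) by (simp add: alg2_null_add alg2_null_scale)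
qed simp

section \<open>Cosets\<close>

lemma mem_cls: "y \<in> cls D x \<longleftrightarrow> eqv D y x"
  unfolding cls_def eqv_def by (rule set_minus_plus[symmetric])

lemma cls_eq_iff: "cls D x = cls D y \<longleftrightarrow> eqv D x y"
proof
  assume "cls D x = cls D y"
  then show "eqv D x y" using mem_cls[of x D x] mem_cls[of x D y] by simp
next
  assume "eqv D x y"
  then have "eqv D z x \<longleftrightarrow> eqv D z y" for z using eqv_sym eqv_trans by metis
  then show "cls D x = cls D y" by (intro set_eqI) (simp only: mem_cls)
qed

lemma rel_ideal_plus: "rel_ideal D + rel_ideal D = rel_ideal D"
proof (intro equalityI subsetI)
  fix x :: "'a falg" assume "x \<in> rel_ideal D + rel_ideal D"
  then show "x \<in> rel_ideal D" by (elim set_plus_elim) (simp add: rel_ideal_add)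
next
  fix x :: "'a falg" assume "x \<in> rel_ideal D"
  then have "x + 0 \<in> rel_ideal D + rel_ideal D" by (intro set_plus_intro) simp_all
  then show "x \<in> rel_ideal D + rel_ideal D" by simp
qed

lemma cls_add: "cls D x + cls D y = cls D (x + y)"
  by (simp add: cls_def set_plus_rearrange rel_ideal_plus)

text \<open>
  An operation on representatives that respects congruence maps a coset, after saturation, onto the
  coset of the value at any representative.
\<close>
lemma image_plus_rel_ideal:
  assumes "x \<in> S" "\<And>y. y \<in> S \<Longrightarrow> eqv D (f y) (f x)"
  shows "f ` S + rel_ideal D = cls D (f x)"
proof (intro equalityI subsetI)
  fix z assume "z \<in> f ` S + rel_ideal D"
  then obtain y i where z: "z = f y + i" "y \<in> S" "i \<in> rel_ideal D" by (elim set_plus_elim imageE) simp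
  have "f y - f x + i \<in> rel_ideal D" using assms(2)[OF z(2)] z(3) by (simp add: eqv_def rel_ideal_add)
  then show "z \<in> cls D (f x)" by (simp add: mem_cls eqv_def z(1) algebra_simps)
next
  fix z assume "z \<in> cls D (f x)"
  then have "f x + (z - f x) \<in> f ` S + rel_ideal D"
    by (intro set_plus_intro imageI assms(1)) (simp add: mem_cls eqv_def)
  then show "z \<in> f ` S + rel_ideal D" by simp
qed

lemma alg_scale_cls: "alg_scale D c (cls D x) = cls D (scale c x)"
  unfolding alg_scale_def by (rule image_plus_rel_ideal) (simp_all add: mem_cls eqv_scale)

lemma alg_mult_cls: "alg_mult D (cls D x) (cls D y) = cls D (x * y)"
proof -
  have "(\<lambda>(a, b). a * b) ` (cls D x \<times> cls D y) + rel_ideal D = cls D ((\<lambda>(a, b). a * b) (x, y))"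
    by (rule image_plus_rel_ideal) (auto simp: mem_cls eqv_mult)
  then show ?thesis by (simp add: alg_mult_def set_times_image)
qed

lemma corner_eq: "corner D = {cls D (pgen * x * pgen) | x. x \<in> free_alg}"
proof -
  have "corner D = (\<lambda>x. alg_mult D (alg_mult D (cls D pgen) (cls D x)) (cls D pgen)) ` free_alg"
    unfolding corner_def alg_def by (simp only: Setcompr_eq_image image_image)
  then show ?thesis by (simp only: alg_mult_cls Setcompr_eq_image)
qed

lemma coproduct_cls: "t \<in> coproduct D (cls D x) \<longleftrightarrow> t - free_comult x \<in> alg2_null D"
proof
  assume "t \<in> coproduct D (cls D x)"
  then obtain y i where t: "t = free_comult y + i" "y \<in> cls D x" "i \<in> alg2_null D"
    unfolding coproduct_def by (elim set_plus_elim imageE) simp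
  have "free_comult (y - x) \<in> alg2_null D"
    using t(2) by (intro free_comult_rel_ideal) (simp add: mem_cls eqv_def)
  then have "free_comult (y - x) + i \<in> alg2_null D" using t(3) by (rule alg2_null_add)
  then show "t - free_comult x \<in> alg2_null D" by (simp add: t(1) algebra_simps)
next
  assume "t - free_comult x \<in> alg2_null D"
  then have "free_comult x + (t - free_comult x) \<in> coproduct D (cls D x)"
    unfolding coproduct_def by (intro set_plus_intro imageI) (simp_all add: mem_cls)
  then show "t \<in> coproduct D (cls D x)" by simp
qed

section \<open>Slices of the tensor square\<close>

text \<open>
  The maps \<open>id \<otimes> g\<close> and \<open>g \<otimes> id\<close> for a functional \<open>g\<close> that is given by its values on words.
\<close>
definition slice1 :: "('b \<Rightarrow> complex) \<Rightarrow> ('a \<times> 'b \<Rightarrow>\<^sub>0 complex) \<Rightarrow> ('a \<Rightarrow>\<^sub>0 complex)" where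
  "slice1 g = lext (\<lambda>(v, w). sg v (g w))"

definition slice2 :: "('a \<Rightarrow> complex) \<Rightarrow> ('a \<times> 'b \<Rightarrow>\<^sub>0 complex) \<Rightarrow> ('b \<Rightarrow>\<^sub>0 complex)" where
  "slice2 g = lext (\<lambda>(v, w). sg w (g v))"

lemma slice1_simps [simp]: "slice1 g (s + t) = slice1 g s + slice1 g t" "slice1 g (s - t) = slice1 g s - slice1 g t"
    "slice1 g (scale c t) = scale c (slice1 g t)" "slice1 g 0 = 0" "slice1 g (sg (v, w) c) = sg v (c * g w)"
  by (simp_all add: slice1_def)

lemma slice2_simps [simp]: "slice2 g (s + t) = slice2 g s + slice2 g t" "slice2 g (s - t) = slice2 g s - slice2 g t"
    "slice2 g (scale c t) = scale c (slice2 g t)" "slice2 g 0 = 0" "slice2 g (sg (v, w) c) = sg w (c * g v)"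
  by (simp_all add: slice2_def)

lemma slice1_tens: "slice1 g (tens x y) = scale (lin g y) x"
proof (induction x rule: poly_mapping_induct)
  case (single w d)
  show ?case
    by (induction y rule: poly_mapping_induct) (simp_all add: tens_single tens_add_right single_add[symmetric] algebra_simps)
qed (simp add: tens_add_left pm.scale_right_distrib)

lemma slice2_tens: "slice2 g (tens x y) = scale (lin g x) y"
proof (induction x rule: poly_mapping_induct)
  case (single w d)
  show ?case
    by (induction y rule: poly_mapping_induct) (simp_all add: tens_single tens_add_right pm.scale_right_distrib algebra_simps)
qed (simp add: tens_add_left pm.scale_left_distrib)

text \<open>
  Both sides are \<open>(f \<otimes> g) t\<close>.
\<close>
lemma lin_slice: "lin f (slice1 g t) = lin g (slice2 f t)"
proof (induction t rule: poly_mapping_induct)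
  case (single w c)
  show ?case by (cases w) simp
qed simp

lemma slice1_alg2_null:
  assumes "\<And>x. x \<in> rel_ideal D \<Longrightarrow> lin g x = 0" "t \<in> alg2_null D"
  shows "slice1 g t \<in> rel_ideal D"
  using assms(2)
  by (induction rule: alg2_null_induct) (simp_all add: slice1_tens assms(1) rel_ideal_add rel_ideal_scale)

lemma slice2_alg2_null:
  assumes "\<And>x. x \<in> rel_ideal D \<Longrightarrow> lin g x = 0" "t \<in> alg2_null D"
  shows "slice2 g t \<in> rel_ideal D"
  using assms(2)
  by (induction rule: alg2_null_induct) (simp_all add: slice2_tens assms(1) rel_ideal_add rel_ideal_scale)

section \<open>Representatives in the corner\<close>

lemma keys_compress:
  assumes "w \<in> Poly_Mapping.keys (pgen * x * pgen)"
  shows "\<exists>v. w = P # v @ [P]"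
proof -
  obtain a where a: "a \<in> Poly_Mapping.keys (pgen * x)" "w = a @ [P]"
    using assms keys_mult[of "pgen * x" pgen] by (auto simp: pgen_single plus_list_def)
  then obtain b where "a = P # b"
    using keys_mult[of pgen x] by (auto simp: pgen_single plus_list_def)
  then show ?thesis using a by simp
qed

text \<open>
  Representatives in the corner only involve words that begin and end with \<open>p\<close>, where a functional on
  the corner can be evaluated.
\<close>
lemma keys_corner2:
  assumes "t \<in> corner2_reps" "(v, w) \<in> Poly_Mapping.keys t"
  shows "(\<exists>v'. v = P # v' @ [P]) \<and> (\<exists>w'. w = P # w' @ [P])"
proof -
  have "\<forall>v w. coef t (v, w) \<noteq> 0 \<longrightarrow> (\<exists>v'. v = P # v' @ [P]) \<and> (\<exists>w'. w = P # w' @ [P])"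
    using assms(1) unfolding corner2_reps_def
  proof (induction rule: pm.span_induct_alt)
    case (step c s t)
    then obtain x y where s: "s = tens (pgen * x * pgen) (pgen * y * pgen)" by (elim CollectE exE conjE)
    show ?case
    proof (intro allI impI)
      fix v w assume "coef (scale c s + t) (v, w) \<noteq> 0"
      then consider "coef s (v, w) \<noteq> 0" | "coef t (v, w) \<noteq> 0"
        by (cases "coef s (v, w) = 0") (simp_all add: lookup_add)
      then show "(\<exists>v'. v = P # v' @ [P]) \<and> (\<exists>w'. w = P # w' @ [P])"
      proof cases
        case 1
        then have "v \<in> Poly_Mapping.keys (pgen * x * pgen)" "w \<in> Poly_Mapping.keys (pgen * y * pgen)"
          by (simp_all add: s lookup_tens in_keys_iff)
        then show ?thesis using keys_compress by metis
      qed (use step in metis)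
    qed
  qed simp
  then show ?thesis using assms(2) by (simp only: in_keys_iff simp_thms)
qed

text \<open>
  The tensor square of the non-unital free algebra, in which the coproduct takes its values.
\<close>
definition free2 :: "('n gen list \<times> 'n gen list \<Rightarrow>\<^sub>0 complex) set" where
  "free2 = pm.span {tens x y | x y. x \<in> free_alg \<and> y \<in> free_alg}"

lemma free2_tens: "x \<in> free_alg \<Longrightarrow> y \<in> free_alg \<Longrightarrow> tens x y \<in> free2"
  unfolding free2_def by (blast intro: pm.span_base)

lemma free2_mult:
  assumes "s \<in> free2" "t \<in> free2"
  shows "s * t \<in> free2"
proof -
  have one: "tens x y * t \<in> free2" if xy: "x \<in> free_alg" "y \<in> free_alg" for x y
    using assms(2) unfolding free2_def
  proof (induction rule: pm.span_induct_alt)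
    case (step c u t)
    then obtain x' y' where u: "u = tens x' y'" "x' \<in> free_alg" "y' \<in> free_alg" by (elim CollectE exE conjE)
    have "tens x y * u \<in> free2"
      unfolding u(1) tens_mult using xy u by (intro free2_tens) (simp_all add: free_alg_iff lookup_mult_Nil)
    then show ?case using step(2)
      by (simp add: free2_def distrib_left scale_mult_right pm.span_add pm.span_scale)
  qed (simp add: pm.span_zero)
  show ?thesis using assms(1) unfolding free2_def
  proof (induction rule: pm.span_induct_alt)
    case (step c u s)
    then obtain x y where u: "u = tens x y" "x \<in> free_alg" "y \<in> free_alg" by (elim CollectE exE conjE)
    then have "u * t \<in> free2" using one by simp
    then show ?case using step(2)
      by (simp add: free2_def distrib_right scale_mult_left pm.span_add pm.span_scale)
  qed (simp add: pm.span_zero)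
qed

lemma free2_comult_gen: "comult_gen g \<in> free2"
proof (cases g)
  case (U i j)
  have "ugen i j \<in> free_alg" for i j :: 'a by (simp add: free_alg_iff ugen_def lookup_sg)
  then show ?thesis unfolding U comult_gen.simps free2_def
    by (intro pm.span_sum free2_tens[unfolded free2_def])
next
  case P
  show ?thesis unfolding P comult_gen.simps by (intro free2_tens) (simp_all add: free_alg_iff)
qed

lemma free2_comult:
  assumes "x \<in> free_alg"
  shows "free_comult x \<in> free2"
proof -
  have word: "prod_list (map comult_gen w) \<in> free2" if "w \<noteq> []" for w :: "'a gen list"
    using that
    by (induction w rule: list_nonempty_induct) (simp_all add: free2_comult_gen free2_mult)
  have "w \<noteq> []" if "w \<in> Poly_Mapping.keys x" for w
    using that assms by (auto simp: free_alg_def)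
  then show ?thesis
    unfolding free_comult_def free2_def by (intro pm.span_sum pm.span_scale word[unfolded free2_def])
qed

lemma corner2_compress:
  assumes "t \<in> free2"
  shows "tens pgen pgen * t * tens pgen pgen \<in> corner2_reps"
  using assms unfolding free2_def
proof (induction rule: pm.span_induct_alt)
  case (step c u t)
  then obtain x y where u: "u = tens x y" "x \<in> free_alg" "y \<in> free_alg" by (elim CollectE exE conjE)
  have "tens pgen pgen * u * tens pgen pgen = tens (pgen * x * pgen) (pgen * y * pgen)"
    by (simp add: u(1) tens_mult)
  then have "tens pgen pgen * u * tens pgen pgen \<in> corner2_reps"
    unfolding corner2_reps_def using u(2,3) by (intro pm.span_base) blast
  then show ?case using step(2)
    by (simp add: corner2_reps_def distrib_left distrib_right scale_mult_left scale_mult_right pm.span_add pm.span_scale)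
qed (simp add: corner2_reps_def pm.span_zero)

lemma free_comult_compress: "free_comult (pgen * x * pgen) = tens pgen pgen * free_comult x * tens pgen pgen"
  by (simp add: free_comult_mult free_comult_pgen)

lemma corner2_comult: "x \<in> free_alg \<Longrightarrow> free_comult (pgen * x * pgen) \<in> corner2_reps"
  unfolding free_comult_compress by (intro corner2_compress free2_comult)

section \<open>Functionals on the corner\<close>

text \<open>
  The compression \<open>w \<mapsto> p w p\<close> extends a functional from the corner to all words. The extension vanishes
  on the ideal, and it agrees with the functional on words that are already compressed.
\<close>
definition corner_word :: "(nat \<Rightarrow> partition set) \<Rightarrow> ('n::finite falg set \<Rightarrow> complex) \<Rightarrow> 'n gen list \<Rightarrow> complex" where
  "corner_word D h w = h (cls D (sg (P # w @ [P]) 1))"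

lemma single_compress: "sg (P # w @ [P]) c = pgen * sg w c * pgen"
  by (simp add: pgen_single sg_mult)

text \<open>
  The representatives of elements of the corner: \<open>p\<close> acts on them as a unit from both sides.
\<close>
definition cornered :: "(nat \<Rightarrow> partition set) \<Rightarrow> 'n::finite falg \<Rightarrow> bool" where
  "cornered D x \<longleftrightarrow> x \<in> free_alg \<and> eqv D (pgen * x) x \<and> eqv D (x * pgen) x"

lemma cornered_compress_eqv: "cornered D x \<Longrightarrow> eqv D (pgen * x * pgen) x"
  unfolding cornered_def by (metis eqv_mult eqv_refl eqv_trans)

lemma cornered_mem_corner: "cornered D x \<Longrightarrow> cls D x \<in> corner D"
  using cornered_compress_eqv[of D x] unfolding corner_eq
  by (intro CollectI exI[of _ x]) (simp add: cls_eq_iff eqv_sym cornered_def)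

lemma cornered_compress: "pgen * x * pgen \<in> free_alg \<Longrightarrow> cornered D (pgen * x * pgen)"
  unfolding cornered_def
  using eqv_mult[OF eqv_pgen eqv_refl[of D "x * pgen"]] eqv_mult[OF eqv_refl[of D "pgen * x"] eqv_pgen]
  by (simp add: mult.assoc)

lemma cornered_pgen: "cornered D pgen"
  by (simp add: cornered_def eqv_pgen free_alg_iff)

lemma cornered_mult: "cornered D x \<Longrightarrow> cornered D y \<Longrightarrow> cornered D (x * y)"
  unfolding cornered_def
  using eqv_mult[of D "pgen * x" x y y] eqv_mult[of D x x "y * pgen" y]
  by (simp add: mult.assoc free_alg_iff lookup_mult_Nil)

lemma cornered_add: "cornered D x \<Longrightarrow> cornered D y \<Longrightarrow> cornered D (x + y)"
  unfolding cornered_def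
  by (simp add: free_alg_iff lookup_add distrib_left distrib_right eqv_add)

lemma cornered_scale: "cornered D x \<Longrightarrow> cornered D (scale c x)"
  unfolding cornered_def
  by (simp add: free_alg_iff scale_mult_left scale_mult_right eqv_scale)

lemma cornered_zero: "cornered D 0"
  by (simp add: cornered_def free_alg_iff)

lemma corner_cases:
  assumes "a \<in> corner D"
  obtains x where "x \<in> free_alg" "a = cls D (pgen * x * pgen)"
  using assms unfolding corner_eq by (elim CollectE exE conjE)

lemma single_sum: "x = (\<Sum>w\<in>Poly_Mapping.keys x. sg w (coef x w))"
  by (rule poly_mapping_eqI) (simp add: lookup_sum lookup_sg sum.delta in_keys_iff)

lemma linear_functional_cls:
  assumes h: "linear_functional D h"
  shows "cornered D x \<Longrightarrow> cornered D y \<Longrightarrow> h (cls D (x + y)) = h (cls D x) + h (cls D y)"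
    and "cornered D x \<Longrightarrow> h (cls D (scale c x)) = c * h (cls D x)"
    and "h (cls D 0) = 0"
proof -
  show "h (cls D (x + y)) = h (cls D x) + h (cls D y)" if "cornered D x" "cornered D y"
    using h that cornered_mem_corner unfolding linear_functional_def by (metis cls_add)
  show scale: "h (cls D (scale c x)) = c * h (cls D x)" if "cornered D x" for c x
    using h that cornered_mem_corner unfolding linear_functional_def by (metis alg_scale_cls)
  show "h (cls D 0) = 0" using scale[OF cornered_zero, of 0] by simp
qed

lemma linear_functional_lin:
  fixes x :: "'n::finite falg"
  assumes h: "linear_functional D h" and x: "x \<in> free_alg"
  shows "h (cls D (pgen * x * pgen)) = lin (corner_word D h) x"
proof -
  have word: "cornered D (pgen * sg w c * pgen)" for w :: "'n gen list" and c
    by (intro cornered_compress) (simp add: free_alg_iff lookup_mult_Nil)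
  have "cornered D (pgen * (\<Sum>w\<in>S. sg w (coef x w)) * pgen) \<and>
      h (cls D (pgen * (\<Sum>w\<in>S. sg w (coef x w)) * pgen)) = (\<Sum>w\<in>S. coef x w * corner_word D h w)"
    if "finite S" for S
    using that
  proof (induction S)
    case empty
    then show ?case by (simp add: cornered_zero linear_functional_cls(3)[OF h])
  next
    case (insert v S)
    have "scale (coef x v) (pgen * sg v 1 * pgen) = pgen * scale (coef x v) (sg v 1) * pgen"
      by (simp only: scale_mult_left scale_mult_right)
    then have "h (cls D (pgen * sg v (coef x v) * pgen)) = coef x v * corner_word D h v"
      using linear_functional_cls(2)[OF h word[of v 1], of "coef x v"]
      by (simp add: corner_word_def single_compress)
    then show ?case
      using insert linear_functional_cls(1)[OF h word] cornered_add[OF word]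
      by (simp add: distrib_left distrib_right)
  qed
  from this[of "Poly_Mapping.keys x"] show ?thesis
    unfolding lin_def single_sum[symmetric] by simp
qed

lemma lin_corner_word_rel_ideal:
  assumes h: "linear_functional D h" and x: "x \<in> rel_ideal D"
  shows "lin (corner_word D h) x = 0"
proof -
  have "x \<in> free_alg" using x rel_ideal_free_alg by (rule rev_subsetD)
  then have "lin (corner_word D h) x = h (cls D (pgen * x * pgen))"
    by (simp only: linear_functional_lin[OF h])
  also have "cls D (pgen * x * pgen) = cls D 0"
    by (simp add: cls_eq_iff eqv_def rel_ideal_mult x)
  finally show ?thesis by (simp add: linear_functional_cls(3)[OF h])
qed

lemma corner_word_word:
  assumes "w = P # w' @ [P]"
  shows "corner_word D h w = h (cls D (sg w 1))"
proof -
  have "pgen * sg w' 1 * pgen \<in> free_alg" by (simp add: free_alg_iff lookup_mult_Nil)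
  then have "eqv D (pgen * sg w 1 * pgen) (sg w 1)"
    unfolding assms single_compress by (intro cornered_compress_eqv cornered_compress)
  then show ?thesis unfolding corner_word_def single_compress by (simp only: cls_eq_iff[THEN iffD2])
qed

text \<open>
  The linear functional occurs in \<open>id_tensor\<close> through representatives with both legs in the corner. On
  these \<open>id_tensor\<close> is the slice with \<open>corner_word D h\<close>, which is defined on the whole tensor square and maps
  its null space into the ideal. So one representative, the coproduct of a compressed element,
  determines the result.
\<close>
lemma id_tensor_cls:
  assumes h: "linear_functional D h" and x: "x \<in> free_alg"
  shows "id_tensor D h (coproduct D (cls D (pgen * x * pgen))) =
    cls D (slice1 (corner_word D h) (free_comult (pgen * x * pgen)))"
proof -
  let ?t = "free_comult (pgen * x * pgen)"
  let ?f = "\<lambda>t. \<Sum>(v, w)\<in>Poly_Mapping.keys t. sg v (coef t (v, w) * h (cls D (sg w 1)))"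
  let ?S = "coproduct D (cls D (pgen * x * pgen)) \<inter> corner2_reps"
  have f: "?f t = slice1 (corner_word D h) t" if t_mem: "t \<in> corner2_reps" for t
    unfolding slice1_def lext_def
  proof (rule sum.cong[OF refl])
    fix vw assume vw: "vw \<in> Poly_Mapping.keys t"
    obtain v w where e: "vw = (v, w)" by (cases vw)
    obtain w' where "w = P # w' @ [P]" using keys_corner2[OF t_mem vw[unfolded e]] by (elim conjE exE)
    from corner_word_word[OF this, of D h]
    show "(case vw of (v, w) \<Rightarrow> sg v (coef t (v, w) * h (cls D (sg w 1)))) =
        scale (coef t vw) (case vw of (v, w) \<Rightarrow> sg v (corner_word D h w))"
      by (simp add: e)
  qed
  have t: "?t \<in> ?S" using corner2_comult[OF x] by (simp add: coproduct_cls)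
  have "?f ` ?S + rel_ideal D = cls D (?f ?t)"
  proof (rule image_plus_rel_ideal[OF t])
    fix t assume t': "t \<in> ?S"
    then have "slice1 (corner_word D h) (t - ?t) \<in> rel_ideal D"
      using lin_corner_word_rel_ideal[OF h] by (intro slice1_alg2_null) (simp_all add: coproduct_cls)
    then show "eqv D (?f t) (?f ?t)"
      using f[of t] f[of ?t] t t' by (simp add: eqv_def)
  qed
  then show ?thesis using f[of ?t] t unfolding id_tensor_def by simp
qed

lemma tensor_id_cls:
  assumes h: "linear_functional D h" and x: "x \<in> free_alg"
  shows "tensor_id D h (coproduct D (cls D (pgen * x * pgen))) =
    cls D (slice2 (corner_word D h) (free_comult (pgen * x * pgen)))"
proof -
  let ?t = "free_comult (pgen * x * pgen)"
  let ?f = "\<lambda>t. \<Sum>(v, w)\<in>Poly_Mapping.keys t. sg w (coef t (v, w) * h (cls D (sg v 1)))"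
  let ?S = "coproduct D (cls D (pgen * x * pgen)) \<inter> corner2_reps"
  have f: "?f t = slice2 (corner_word D h) t" if t_mem: "t \<in> corner2_reps" for t
    unfolding slice2_def lext_def
  proof (rule sum.cong[OF refl])
    fix vw assume vw: "vw \<in> Poly_Mapping.keys t"
    obtain v w where e: "vw = (v, w)" by (cases vw)
    obtain v' where "v = P # v' @ [P]" using keys_corner2[OF t_mem vw[unfolded e]] by (elim conjE exE)
    from corner_word_word[OF this, of D h]
    show "(case vw of (v, w) \<Rightarrow> sg w (coef t (v, w) * h (cls D (sg v 1)))) =
        scale (coef t vw) (case vw of (v, w) \<Rightarrow> sg w (corner_word D h v))"
      by (simp add: e)
  qed
  have t: "?t \<in> ?S" using corner2_comult[OF x] by (simp add: coproduct_cls)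
  have "?f ` ?S + rel_ideal D = cls D (?f ?t)"
  proof (rule image_plus_rel_ideal[OF t])
    fix t assume t': "t \<in> ?S"
    then have "slice2 (corner_word D h) (t - ?t) \<in> rel_ideal D"
      using lin_corner_word_rel_ideal[OF h] by (intro slice2_alg2_null) (simp_all add: coproduct_cls)
    then show "eqv D (?f t) (?f ?t)"
      using f[of t] f[of ?t] t t' by (simp add: eqv_def)
  qed
  then show ?thesis using f[of ?t] t unfolding tensor_id_def by simp
qed

lemma span_coset_eq_iff: "t +o pm.span B = s +o pm.span B \<longleftrightarrow> t - s \<in> pm.span B"
proof
  assume "t +o pm.span B = s +o pm.span B"
  moreover have "t + 0 \<in> t +o pm.span B" by (intro set_plus_intro2 pm.span_zero)
  ultimately show "t - s \<in> pm.span B" by (simp add: set_minus_plus)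
next
  assume ts: "t - s \<in> pm.span B"
  have "z - t \<in> pm.span B \<longleftrightarrow> z - s \<in> pm.span B" for z
    using pm.span_add[OF _ ts, of "z - t"] pm.span_diff[OF _ ts, of "z - s"] by auto
  then show "t +o pm.span B = s +o pm.span B"
    by (intro set_eqI) (simp only: set_minus_plus[symmetric])
qed

lemma lin_tens: "lin (\<lambda>(a, w). f a * g w) (tens x y) = lin f x * lin g y"
proof (induction x rule: poly_mapping_induct)
  case (single a c)
  show ?case
    by (induction y rule: poly_mapping_induct) (simp_all add: tens_single tens_add_right algebra_simps)
qed (simp add: tens_add_left algebra_simps)

lemma lookup_comp_span_length:
  assumes "v \<in> comp_span L k" "coef v i \<noteq> 0"
  shows "length i = k"
proof -
  have "\<forall>i. coef v i \<noteq> 0 \<longrightarrow> length i = k"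
    using assms(1) unfolding comp_span_def
  proof (induction rule: pm.span_induct_alt)
    case (step c x y)
    then obtain d where d: "d \<in> comps L k" "x = comp_vec d" by (elim imageE)
    show ?case
    proof (intro allI impI)
      fix i assume i: "coef (scale c x + y) i \<noteq> 0"
      show "length i = k"
      proof (cases "coef y i = 0")
        case True
        then have "coef (comp_vec d) i \<noteq> 0" using i by (simp add: d(2) lookup_add)
        then show ?thesis using keys_comp_vec[of d i] d(1) by (simp add: comps_def)
      qed (use step(2) in metis)
    qed
  qed simp
  then show ?thesis using assms(2) by metis
qed

context blockwise_category
begin

text \<open>
  Multiplicativity of \<open>phi\<close> at the letter \<open>p\<close> makes the slices multiplicative at \<open>p \<otimes> p\<close>.
\<close>
lemma slice1_phi_mult: "slice1 phi (s * tens pgen pgen * t) = slice1 phi s * pgen * slice1 phi t"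
proof (induction s rule: poly_mapping_induct)
  case (single vw c)
  show ?case
  proof (induction t rule: poly_mapping_induct)
    case (single vw' c')
    show ?case
      by (cases vw; cases vw')
        (simp add: pgen_single tens_single mult_single plus_prod_def plus_list_def phi_P mult_ac)
  qed (simp add: distrib_left)
qed (simp add: distrib_right)

lemma slice2_phi_mult: "slice2 phi (s * tens pgen pgen * t) = slice2 phi s * pgen * slice2 phi t"
proof (induction s rule: poly_mapping_induct)
  case (single vw c)
  show ?case
  proof (induction t rule: poly_mapping_induct)
    case (single vw' c')
    show ?case
      by (cases vw; cases vw')
        (simp add: pgen_single tens_single mult_single plus_prod_def plus_list_def phi_P mult_ac)
  qed (simp add: distrib_left)
qed (simp add: distrib_right)

lemma slice1_phi_one [simp]: "slice1 phi (1 :: 'n::finite gen list \<times> 'n gen list \<Rightarrow>\<^sub>0 complex) = 1"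
  and slice2_phi_one [simp]: "slice2 phi (1 :: 'n gen list \<times> 'n gen list \<Rightarrow>\<^sub>0 complex) = 1"
  by (simp_all add: tens_one[symmetric] slice1_tens slice2_tens)

text \<open>
  Here \<open>s\<close> stands for either slice with \<open>phi\<close>. The identity holds on words in the \<open>u\<^sub>i\<^sub>j\<close> by assumption, and
  multiplicativity at \<open>p \<otimes> p\<close> carries it over to words that are cut into segments by \<open>p\<close>.
\<close>
lemma slice_comult_eqv:
  assumes add: "\<And>t t'. s (t + t') = s t + s t'" and scale: "\<And>c t. s (scale c t) = scale c (s t)"
    and mult: "\<And>t t'. s (t * tens pgen pgen * t') = s t * pgen * s t'"
    and uprod: "\<And>i j. length i = length j \<Longrightarrow> eqv D (s (free_comult (uprod i j)) * pgen) (scale (entry L i j) pgen)"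
  shows "eqv D (s (free_comult x) * pgen) (scale (lin phi x) pgen)"
proof (induction x rule: poly_mapping_induct)
  case (single w c)
  have word: "eqv D (s (free_comult (sg w 1)) * pgen) (scale (phi w) pgen)"
  proof (induction w rule: length_induct)
    case (1 w)
    show ?case
    proof (cases w rule: word_split_first)
      case (1 i j)
      then show ?thesis using uprod[OF 1(1)] by (simp add: uprod_single phi_U)
    next
      case (2 i j x)
      have IH: "eqv D (s (free_comult (sg x 1)) * pgen) (scale (phi x) pgen)" using 1 by (simp add: 2)
      have "sg w 1 = uprod i j * pgen * sg x 1" by (simp add: 2 uprod_single pgen_single sg_mult)
      then have "s (free_comult (sg w 1)) * pgen =
          (s (free_comult (uprod i j)) * pgen) * (s (free_comult (sg x 1)) * pgen)"
        by (simp only: free_comult_mult free_comult_pgen mult) (simp only: mult.assoc)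
      also have "eqv D \<dots> (scale (entry L i j) pgen * scale (phi x) pgen)"
        by (intro eqv_mult uprod[OF 2(1)] IH)
      also have "scale (entry L i j) pgen * scale (phi x) pgen = scale (phi w) (pgen * pgen)"
        by (simp add: 2 phi_P phi_U scale_mult_left scale_mult_right mult.commute)
      also have "eqv D \<dots> (scale (phi w) pgen)" by (intro eqv_scale eqv_pgen)
      finally show ?thesis .
    qed
  qed
  have "free_comult (sg w c) = scale c (free_comult (sg w 1))" by (simp add: free_comult_single)
  then show ?case using eqv_scale[OF word, of c] by (simp add: scale scale_mult_left)
next
  case (add x y)
  then show ?case
    using eqv_add[OF add] by (simp add: assms(1) distrib_right pm.scale_left_distrib)
qed

lemma slice_comult_compress:
  assumes s: "\<And>t t'. s (t + t') = s t + s t'" "\<And>c t. s (scale c t) = scale c (s t)"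
    "\<And>t t'. s (t * tens pgen pgen * t') = s t * pgen * s t'"
    and one: "s 1 = 1"
    and "\<And>i j. length i = length j \<Longrightarrow> eqv D (s (free_comult (uprod i j)) * pgen) (scale (entry L i j) pgen)"
  shows "eqv D (s (free_comult (pgen * x * pgen))) (scale (lin phi (pgen * x * pgen)) pgen)"
proof -
  have "s (free_comult (pgen * x * pgen)) = s (1 * tens pgen pgen * (free_comult x * tens pgen pgen * 1))"
    unfolding free_comult_compress by (simp add: mult.assoc)
  also have "\<dots> = pgen * (s (free_comult x) * pgen)"
    unfolding s(3) one by simp
  also have "eqv D \<dots> (scale (lin phi x) pgen)"
    by (intro eqv_scale_pgen_mult slice_comult_eqv assms)
  finally show ?thesis by (simp add: lin_phi_compress)
qed

lemma proj_basis_sum: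
  fixes j :: "'n::finite list"
  shows "lext f (proj L (length j) (basis_vec j)) = (\<Sum>l | length l = length j. scale (entry L l j) (f l))"
proof -
  have "Poly_Mapping.keys (proj L (length j) (basis_vec j)) \<subseteq> {l. length l = length j}"
    using lookup_comp_span_length[OF proj_mem[OF L_pos]] by (intro subsetI CollectI) (simp add: in_keys_iff)
  then show ?thesis by (simp add: lext_superset[OF finite_lists] entry_def)
qed

text \<open>
  The slice sums the \<open>u\<^sub>i\<^sub>l\<close> against a column of the projection. This column is a linear combination of
  vectors of partitions, for which the relations evaluate the sum.
\<close>
lemma slice1_phi_uprod:
  assumes "length i = length j"
  shows "eqv D (slice1 phi (free_comult (uprod i j)) * pgen) (scale (entry L i j) pgen)"
proof -
  have "slice1 phi (free_comult (uprod i j)) = (\<Sum>l | length l = length j. scale (entry L l j) (uprod i l))"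
    unfolding free_comult_uprod[OF assms] slice1_def lext_sum
    unfolding slice1_def[symmetric] using assms
    by (intro sum.cong) (simp_all add: slice1_tens uprod_single phi_U)
  also have "\<dots> = lext (uprod i) (proj L (length j) (basis_vec j))" by (simp add: proj_basis_sum)
  finally show ?thesis
    using eqv_lext_uprod[OF proj_mem[OF L_pos, of "length j" "basis_vec j"], of i] assms by (simp add: entry_def)
qed

text \<open>
  Here it is a row of the projection, which is a column by symmetry.
\<close>
lemma slice2_phi_uprod:
  assumes "length i = length j"
  shows "eqv D (slice2 phi (free_comult (uprod i j)) * pgen) (scale (entry L i j) pgen)"
proof -
  have "slice2 phi (free_comult (uprod i j)) = (\<Sum>l | length l = length i. scale (entry L l i) (uprod l j))"
    unfolding free_comult_uprod[OF assms] slice2_def lext_sum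
    unfolding slice2_def[symmetric] using assms
    by (intro sum.cong) (simp_all add: slice2_tens uprod_single phi_U entry_sym[OF L_pos, of i])
  also have "\<dots> = lext (\<lambda>l. uprod l j) (proj L (length i) (basis_vec i))" by (simp add: proj_basis_sum)
  finally have "slice2 phi (free_comult (uprod i j)) = lext (\<lambda>l. uprod l j) (proj L (length i) (basis_vec i))" .
  moreover have "coef (proj L (length i) (basis_vec i)) j = entry L i j"
    using entry_sym[OF L_pos assms] by (simp add: entry_def)
  ultimately show ?thesis
    using eqv_lext_uprod_transpose[OF proj_mem[OF L_pos, of "length i" "basis_vec i"], of j] assms by simp
qed

lemma slice1_phi_compress: "eqv D (slice1 phi (free_comult (pgen * x * pgen))) (scale (lin phi (pgen * x * pgen)) pgen)"
  by (rule slice_comult_compress[of "slice1 phi"]) (simp_all only: slice1_simps slice1_phi_mult slice1_phi_one slice1_phi_uprod)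

lemma slice2_phi_compress: "eqv D (slice2 phi (free_comult (pgen * x * pgen))) (scale (lin phi (pgen * x * pgen)) pgen)"
  by (rule slice_comult_compress[of "slice2 phi"]) (simp_all only: slice2_simps slice2_phi_mult slice2_phi_one slice2_phi_uprod)

lemma lin_phi_pgen [simp]: "lin phi pgen = 1"
  by (simp add: pgen_single)

section \<open>The Haar functional\<close>

text \<open>
  The chosen representative is immaterial, since \<open>phi\<close> vanishes on the ideal, see \<open>haar_cls\<close>.
\<close>
definition haar :: "'n::finite falg set \<Rightarrow> complex" where
  "haar = restrict (\<lambda>X. lin phi (SOME x. x \<in> X)) (corner D)"

lemma haar_cls: "cornered D x \<Longrightarrow> haar (cls D x) = lin phi x"
proof -
  assume x: "cornered D x"
  have "x \<in> cls D x" by (simp add: mem_cls)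
  then have "(SOME y. y \<in> cls D x) \<in> cls D x" by (rule someI)
  then have "lin phi (SOME y. y \<in> cls D x) = lin phi x" unfolding mem_cls by (rule lin_phi_eqv)
  then show ?thesis using cornered_mem_corner[OF x] by (simp add: haar_def)
qed

lemma cornered_free_compress: "x \<in> free_alg \<Longrightarrow> cornered D (pgen * x * pgen)"
  by (intro cornered_compress free_alg_mult)

lemma haar_linear: "linear_functional D haar"
  unfolding linear_functional_def
proof (intro conjI ballI allI)
  show "haar \<in> extensional (corner D)" by (simp add: haar_def)
next
  fix a b :: "'a falg set" assume "a \<in> corner D" "b \<in> corner D"
  then obtain x y where x: "x \<in> free_alg" "a = cls D (pgen * x * pgen)"
    and y: "y \<in> free_alg" "b = cls D (pgen * y * pgen)" by (elim corner_cases)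
  note c = cornered_free_compress[OF x(1)] cornered_free_compress[OF y(1)]
  show "haar (a + b) = haar a + haar b"
    unfolding x(2) y(2) cls_add by (simp only: haar_cls c cornered_add lin_add)
next
  fix c and a :: "'a falg set" assume "a \<in> corner D"
  then obtain x where x: "x \<in> free_alg" "a = cls D (pgen * x * pgen)" by (elim corner_cases)
  show "haar (alg_scale D c a) = c * haar a"
    unfolding x(2) alg_scale_cls
    by (simp only: haar_cls cornered_free_compress[OF x(1)] cornered_scale lin_scale)
qed

lemma corner_word_haar: "corner_word D haar = phi"
proof
  fix w :: "'a gen list"
  have "cornered D (sg (P # w @ [P]) 1)"
    unfolding single_compress by (rule cornered_compress) (simp add: free_alg_iff lookup_mult_Nil)
  then show "corner_word D haar w = phi w" by (simp add: corner_word_def haar_cls)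
qed

lemma haar_functional_haar: "haar_functional D haar"
  unfolding haar_functional_def
proof (intro conjI ballI haar_linear)
  fix a :: "'a falg set" assume "a \<in> corner D"
  then obtain x where x: "x \<in> free_alg" "a = cls D (pgen * x * pgen)" by (elim corner_cases)
  note h = haar_cls[OF cornered_free_compress[OF x(1)]]
  show "id_tensor D haar (coproduct D a) = alg_scale D (haar a) (cls D pgen)"
    unfolding x(2) id_tensor_cls[OF haar_linear x(1)] corner_word_haar alg_scale_cls cls_eq_iff h
    by (rule slice1_phi_compress)
  show "tensor_id D haar (coproduct D a) = alg_scale D (haar a) (cls D pgen)"
    unfolding x(2) tensor_id_cls[OF haar_linear x(1)] corner_word_haar alg_scale_cls cls_eq_iff h
    by (rule slice2_phi_compress)
qed

lemma haar_pgen: "haar (cls D pgen) = 1"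
  by (simp add: haar_cls cornered_pgen)

text \<open>
  Evaluate \<open>(haar \<otimes> h) \<Delta> a\<close> in both orders: the Haar property of \<open>h\<close> gives \<open>h a \<cdot> haar p\<close>, that of \<open>haar\<close> gives
  \<open>haar a \<cdot> h p\<close>.
\<close>
lemma haar_unique:
  fixes h :: "'n::finite falg set \<Rightarrow> complex"
  assumes "haar_functional D h" "unital_functional D h"
  shows "h = haar"
proof (rule extensionalityI)
  have h: "linear_functional D h" using assms(1) unfolding haar_functional_def by (elim conjE)
  then show "h \<in> extensional (corner D)" unfolding linear_functional_def by (elim conjE)
  show "haar \<in> extensional (corner D)" by (simp add: haar_def)
  fix a :: "'n falg set" assume a: "a \<in> corner D"
  then obtain x where x: "x \<in> free_alg" "a = cls D (pgen * x * pgen)" by (elim corner_cases)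
  let ?g = "corner_word D h" and ?t = "free_comult (pgen * x * pgen)"
  have "id_tensor D h (coproduct D a) = alg_scale D (h a) (cls D pgen)"
    using assms(1) a unfolding haar_functional_def by (elim conjE) (drule (1) bspec, elim conjE)
  then have "eqv D (slice1 ?g ?t) (scale (h a) pgen)"
    unfolding x(2) id_tensor_cls[OF h x(1)] alg_scale_cls cls_eq_iff .
  then have "lin phi (slice1 ?g ?t) = h a"
    by (drule_tac lin_phi_eqv) (simp add: pgen_single)
  moreover have "lin ?g (slice2 phi ?t - scale (lin phi (pgen * x * pgen)) pgen) = 0"
    using slice2_phi_compress[of x] unfolding eqv_def by (rule lin_corner_word_rel_ideal[OF h])
  moreover have "?g [P] = 1"
  proof -
    have "cls D (sg (P # [P] @ [P]) 1) = cls D (pgen :: 'n falg)"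
      unfolding single_compress cls_eq_iff pgen_def[symmetric]
      by (rule cornered_compress_eqv[OF cornered_pgen])
    then show ?thesis using assms(2) by (simp add: corner_word_def unital_functional_def)
  qed
  ultimately have "h a = lin phi (pgen * x * pgen)"
    by (simp add: lin_slice pgen_single)
  then show "h a = haar a" by (simp add: x haar_cls cornered_free_compress)
qed

lemma haar_uprod:
  assumes "1 \<le> k" "length i = k" "length j = k"
  shows "haar (cls D (pgen * uprod i j * pgen)) = proj_entry D k i j"
proof -
  have "i \<noteq> []" "j \<noteq> []" using assms by auto
  then have "haar (cls D (pgen * uprod i j * pgen)) = lin phi (uprod i j)"
    by (simp add: haar_cls cornered_free_compress uprod_free_alg lin_phi_compress)
  also have "\<dots> = entry L i j" using assms by (simp add: uprod_single phi_U)
  finally show ?thesis using assms by (simp add: proj_entry_eq_entry)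
qed

lemma coeff_space_cases:
  assumes "a \<in> coeff_space D"
  obtains z where "cornered D (z * pgen)" "a = cls D (z * pgen)"
proof -
  obtain v where v: "a = cls D v" "v \<in> pm.span ({pgen} \<union> {pgen * uprod i j * pgen | i j. length i = length j \<and> i \<noteq> []})"
    using assms unfolding coeff_space_def by (elim imageE)
  have "\<exists>z. v = z * pgen \<and> cornered D v"
    using v(2)
  proof (induction rule: pm.span_induct_alt)
    case base
    show ?case by (intro exI[of _ 0]) (simp add: cornered_zero)
  next
    case (step c x y)
    have "\<exists>z. x = z * pgen \<and> cornered D x"
      using step(1)
    proof (elim UnE CollectE exE conjE singletonE)
      assume "x = pgen"
      then show ?thesis by (intro exI[of _ 1]) (simp add: cornered_pgen)
    next
      fix i j assume ij: "x = pgen * uprod i j * pgen" "length i = length j" "i \<noteq> []"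
      then have "j \<noteq> []" by auto
      then show ?thesis
        unfolding ij(1) by (intro exI[of _ "pgen * uprod i j"] conjI refl cornered_free_compress uprod_free_alg ij(3))
    qed
    then obtain z where z: "x = z * pgen" "cornered D x" by (elim exE conjE)
    obtain z' where z': "y = z' * pgen" "cornered D y" using step(2) by (elim exE conjE)
    have "scale c x + y = (scale c z + z') * pgen" by (simp add: z(1) z'(1) scale_mult_left distrib_right)
    moreover have "cornered D (scale c x + y)" by (intro cornered_add cornered_scale z z')
    ultimately show ?case by (intro exI conjI)
  qed
  then show ?thesis using that v(1) by (elim exE conjE) simp
qed

text \<open>
  Elements of the coefficient space have the form \<open>z p\<close>, and \<open>phi\<close> is multiplicative at this \<open>p\<close>.
\<close>
lemma haar_prod:
  assumes "set as \<subseteq> coeff_space D"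
  shows "haar (corner_prod D as) = prod_list (map haar as)"
proof -
  have "\<exists>x. cornered D x \<and> corner_prod D as = cls D x \<and> lin phi x = prod_list (map haar as)"
    using assms
  proof (induction as)
    case Nil
    show ?case
      by (intro exI[of _ pgen]) (simp add: cornered_pgen corner_prod_def)
  next
    case (Cons a as)
    then obtain x where x: "cornered D x" "corner_prod D as = cls D x" "lin phi x = prod_list (map haar as)"
      by (metis insert_subset list.simps(15))
    obtain z where z: "cornered D (z * pgen)" "a = cls D (z * pgen)"
      using Cons.prems by (metis coeff_space_cases insert_subset list.simps(15))
    have "corner_prod D (a # as) = alg_mult D a (corner_prod D as)" by (simp add: corner_prod_def)
    also have "\<dots> = cls D (z * pgen * x)" unfolding z(2) x(2) by (rule alg_mult_cls)
    finally have "corner_prod D (a # as) = cls D (z * pgen * x)" .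
    moreover have "lin phi (z * pgen * x) = prod_list (map haar (a # as))"
      using lin_phi_mult_pgen[of z 1] by (simp add: lin_phi_mult_pgen x(3) z(2) haar_cls[OF z(1)])
    ultimately show ?case using cornered_mult[OF z(1) x(1)] by (intro exI conjI)
  qed
  then obtain x where "cornered D x" "corner_prod D as = cls D x" "lin phi x = prod_list (map haar as)"
    by (elim exE conjE)
  then show ?thesis by (simp add: haar_cls)
qed

section \<open>Fixed vectors\<close>

text \<open>
  Sorting by the basis vector in the first leg reduces fixedness of \<open>\<xi>\<close> to one equation in the algebra
  for each multi-index.
\<close>
lemma coaction_diff:
  fixes \<xi> :: "'n::finite list \<Rightarrow>\<^sub>0 complex"
  assumes "\<xi> \<in> tensor_power k"
  shows "(\<Sum>j\<in>Poly_Mapping.keys \<xi>. scale (coef \<xi> j) (\<Sum>i | length i = k. tens (basis_vec i) (pgen * uprod i j * pgen)))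
      - tens \<xi> pgen = (\<Sum>i | length i = k. tens (basis_vec i) (pgen * (lext (uprod i) \<xi> * pgen) - scale (coef \<xi> i) pgen))"
proof -
  have "pgen * (lext (uprod i) \<xi> * pgen) = (\<Sum>j\<in>Poly_Mapping.keys \<xi>. scale (coef \<xi> j) (pgen * uprod i j * pgen))" for i
    by (simp add: lext_def sum_distrib_left sum_distrib_right scale_mult_left scale_mult_right mult.assoc)
  then have "(\<Sum>i | length i = k. tens (basis_vec i) (pgen * (lext (uprod i) \<xi> * pgen))) =
      (\<Sum>j\<in>Poly_Mapping.keys \<xi>. scale (coef \<xi> j) (\<Sum>i | length i = k. tens (basis_vec i) (pgen * uprod i j * pgen)))"
    by (simp add: tens_sum_right tens_scale_right pm.scale_sum_right) (rule sum.swap)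
  moreover have "tens \<xi> pgen = (\<Sum>i | length i = k. tens (basis_vec i) (scale (coef \<xi> i) pgen))"
  proof -
    have "Poly_Mapping.keys \<xi> \<subseteq> {i. length i = k}" using assms by (auto simp: tensor_power_def)
    then have "(\<Sum>i | length i = k. sg i (coef \<xi> i)) = \<xi>"
      by (subst (2) single_sum, intro sum.mono_neutral_right finite_lists) (auto simp: in_keys_iff)
    then have "tens \<xi> pgen = tens (\<Sum>i | length i = k. scale (coef \<xi> i) (basis_vec i)) pgen" by simp
    then show ?thesis by (simp only: tens_sum_left tens_scale_left tens_scale_right)
  qed
  ultimately show ?thesis by (simp add: tens_diff_right sum_subtractf)
qed

lemma mem_fixed_vectors:
  fixes \<xi> :: "'n::finite list \<Rightarrow>\<^sub>0 complex"
  shows "\<xi> \<in> fixed_vectors D k \<longleftrightarrow> \<xi> \<in> tensor_power k \<and>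
    (\<Sum>i | length i = k. tens (basis_vec i) (pgen * (lext (uprod i) \<xi> * pgen) - scale (coef \<xi> i) pgen)) \<in> mixed_null D k"
  unfolding fixed_vectors_def mem_Collect_eq coaction_def mixed_null_def tensor_null_def span_coset_eq_iff
  by (intro conj_cong refl) (simp only: coaction_diff)

text \<open>
  For vectors in the span, the equations hold in the algebra by the relations. Conversely, apply
  \<open>phi\<close> to the equations of a fixed vector: its values on words in the \<open>u\<^sub>i\<^sub>j\<close> are the entries of the
  projection, so they say that the projection fixes the vector.
\<close>
lemma fixed_vectors_eq:
  fixes k :: nat
  shows "(fixed_vectors D k :: ('n::finite list \<Rightarrow>\<^sub>0 complex) set) = comp_span L k"
proof (intro equalityI subsetI)
  fix \<xi> :: "'n list \<Rightarrow>\<^sub>0 complex" assume \<xi>: "\<xi> \<in> comp_span L k"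
  have "\<xi> \<in> tensor_power k"
    using lookup_comp_span_length[OF \<xi>] unfolding tensor_power_def by (intro CollectI ballI) (simp only: in_keys_iff)
  moreover have "tens (basis_vec i) (pgen * (lext (uprod i) \<xi> * pgen) - scale (coef \<xi> i) pgen) \<in> mixed_null D k"
    if "i \<in> {i. length i = k}" for i
  proof -
    have "pgen * (lext (uprod i) \<xi> * pgen) - scale (coef \<xi> i) pgen \<in> rel_ideal D"
      using eqv_scale_pgen_mult[OF eqv_lext_uprod[OF \<xi>, of i]] that by (simp add: eqv_def)
    moreover have "basis_vec i \<in> tensor_power k" using that by (simp add: tensor_power_def)
    ultimately show ?thesis unfolding mixed_null_def tensor_null_def
      by (intro pm.span_base UnI2) blast
  qed
  ultimately show "\<xi> \<in> fixed_vectors D k"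
    unfolding mem_fixed_vectors mixed_null_def tensor_null_def by (intro conjI pm.span_sum)
next
  fix \<xi> :: "'n list \<Rightarrow>\<^sub>0 complex" assume "\<xi> \<in> fixed_vectors D k"
  note mem = this[unfolded mem_fixed_vectors]
  note \<xi> = conjunct1[OF mem] and null = conjunct2[OF mem]
  \<comment> \<open>The functional is the \<open>i\<close>-th coordinate on the first leg tensored with \<open>phi\<close> on the second.\<close>
  have null0: "lin (\<lambda>(a, w). (if a = i then 1 else 0) * phi w) t = 0" if "t \<in> mixed_null D k" for i :: "'n list" and t
    using that unfolding mixed_null_def tensor_null_def
  proof (rule lin_span_zero)
    fix y assume "y \<in> {tens x y |x y. x \<in> {0 :: 'n list \<Rightarrow>\<^sub>0 complex} \<and> y \<in> free_alg} \<union> {tens x y |x y. x \<in> tensor_power k \<and> y \<in> rel_ideal D}"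
    then show "lin (\<lambda>(a, w). (if a = i then 1 else 0) * phi w) y = 0"
      by (elim UnE CollectE exE conjE) (simp_all only: singleton_iff tens_zero_left lin_zero lin_tens lin_phi_rel_ideal mult_zero_right)
  qed
  have coef: "coef \<xi> i = (\<Sum>j\<in>Poly_Mapping.keys \<xi>. coef \<xi> j * entry L i j)" if i: "length i = k" for i
  proof -
    have len: "length j = k" if "j \<in> Poly_Mapping.keys \<xi>" for j using \<xi> that by (simp add: tensor_power_def)
    have "0 = (\<Sum>l | length l = k. (if l = i then 1 else 0) * lin phi (pgen * lext (uprod l) \<xi> * pgen - scale (coef \<xi> l) pgen))"
      using null0[OF null, of i] by (simp add: lin_sum lin_tens mult.assoc)
    also have "\<dots> = lin phi (pgen * lext (uprod i) \<xi> * pgen - scale (coef \<xi> i) pgen)"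
      using i by (simp add: sum.delta[OF finite_lists] if_distrib[of "\<lambda>x. x * _"] cong: if_cong)
    also have "\<dots> = lin phi (lext (uprod i) \<xi>) - coef \<xi> i"
      by (simp add: lin_phi_compress)
    also have "lin phi (lext (uprod i) \<xi>) = (\<Sum>j\<in>Poly_Mapping.keys \<xi>. coef \<xi> j * entry L i j)"
      using len i by (simp add: lext_def lin_sum uprod_single phi_U)
    finally show ?thesis by simp
  qed
  have "\<xi> = (\<Sum>j\<in>Poly_Mapping.keys \<xi>. scale (coef \<xi> j) (proj L k (basis_vec j)))"
  proof (rule poly_mapping_eqI)
    fix i
    show "coef \<xi> i = coef (\<Sum>j\<in>Poly_Mapping.keys \<xi>. scale (coef \<xi> j) (proj L k (basis_vec j))) i"
    proof (cases "length i = k")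
      case True
      have "entry L i j = coef (proj L k (basis_vec j)) i" if "j \<in> Poly_Mapping.keys \<xi>" for j
        using \<xi> that by (simp add: tensor_power_def entry_def)
      then show ?thesis using coef[OF True] by (simp add: lookup_sum)
    next
      case False
      then have "coef (proj L k x) i = 0" for x using lookup_comp_span_length[OF proj_mem[OF L_pos]] by metis
      moreover have "coef \<xi> i = 0" using \<xi> False by (auto simp: tensor_power_def in_keys_iff)
      ultimately show ?thesis by (simp add: lookup_sum)
    qed
  qed
  moreover have "(\<Sum>j\<in>Poly_Mapping.keys \<xi>. scale (coef \<xi> j) (proj L k (basis_vec j))) \<in> comp_span L k"
    unfolding comp_span_def by (intro pm.span_sum pm.span_scale proj_mem[OF L_pos, unfolded comp_span_def])
  ultimately show "\<xi> \<in> comp_span L k" by (rule back_subst[of "\<lambda>x. x \<in> comp_span L k", OF _ sym, rotated])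
qed

end

theorem theorem3p7:
  fixes D :: "nat \<Rightarrow> partition set"
  assumes "blockwise D"
  shows "(\<forall>k\<ge>1. (fixed_vectors D k :: ('n::finite list \<Rightarrow>\<^sub>0 complex) set)
             = pm.span (part_vec k ` D k)) \<and>
         (\<exists>h :: 'n falg set \<Rightarrow> complex.
            (haar_functional D h \<and> unital_functional D h) \<and>
            (\<forall>h'. haar_functional D h' \<and> unital_functional D h' \<longrightarrow> h' = h) \<and>
            h (cls D pgen) = 1 \<and>
            (\<forall>k\<ge>1. \<forall>i j. length i = k \<and> length j = k \<longrightarrow>
               h (cls D (pgen * uprod i j * pgen)) = proj_entry D k i j) \<and>
            (\<forall>as. as \<noteq> [] \<and> set as \<subseteq> coeff_space D \<longrightarrow>
               h (corner_prod D as) = prod_list (map h as)))"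
proof -
  interpret blockwise_category D by (rule blockwise_category.intro) (rule assms)
  show ?thesis
  proof (intro conjI exI[of _ haar] allI impI)
    fix k :: nat assume "1 \<le> k"
    then show "(fixed_vectors D k :: ('n list \<Rightarrow>\<^sub>0 complex) set) = pm.span (part_vec k ` D k)"
      by (simp only: fixed_vectors_eq part_span_eq_comp_span)
  next
    show "unital_functional D haar" unfolding unital_functional_def by (rule haar_pgen)
  next
    fix h' :: "'n falg set \<Rightarrow> complex" assume "haar_functional D h' \<and> unital_functional D h'"
    then show "h' = haar" by (elim conjE) (rule haar_unique)
  next
    fix k :: nat and i j :: "'n list" assume "1 \<le> k" "length i = k \<and> length j = k"
    then show "haar (cls D (pgen * uprod i j * pgen)) = proj_entry D k i j" by (elim conjE) (rule haar_uprod)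
  next
    fix as :: "'n falg set list" assume "as \<noteq> [] \<and> set as \<subseteq> coeff_space D"
    then show "haar (corner_prod D as) = prod_list (map haar as)" by (elim conjE) (rule haar_prod)
  qed (rule haar_functional_haar haar_pgen)+
qed

end
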